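(* Let $\tau>0$. Assume the model and sampling setup (M), that the kernels satisfy (K1), (K2), (K4) and (K3) with $p=\infty$, $s=\tau$, and that $R\in\mathrm W^\tau_\infty(\mathbb S^{d-1})$. Suppose $\hat f_X$, $f_X$, $T_N$ and $r$ satisfy (a) $N^{1/2}T_N^{-(d-1)/2}(\log N)^rM_N=o_p(1)$; (b) $N^{-1/2}T_N^{(d-1)/2}(\log N)^{r+\epsilon}=o(1)$ for some $\epsilon>0$; (c) $N^{1/2}T_N^{-(2\tau+d-1)/2}=o(1)$; (d) $N^{1/2}T_N^{(d-1)/2}\sigma(\{0<f_X<(\log N)^{-r}\})=o(1)$ and $\sup_{x\in H^+}f_X(x)<\infty$. Then for every $x\in\mathbb S^{d-1}$, $$N^{1/2}s_{1N}(x)^{-1}\big(\hat R(x)-R(x)\big)\xrightarrow{d}N(0,1),\qquad s_{1N}^2(x)=\mathrm{var}\Big(\frac{(2Y-1)K_{2T_N}^-(X,x)}{\max(f_X(X),(\log N)^{-r})}\Big).$$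
   Context: Spherical harmonics: $\mathbb S^{d-1}$ ($d\ge2$) is the unit sphere in $\mathbb R^d$ with surface measure $\sigma$, $|\mathbb S^{d-1}|=2\pi^{d/2}/\Gamma(d/2)$, $\|\cdot\|_p$ the $\mathrm L^p(\sigma)$ norm. $H^{n,d}$: restrictions to $\mathbb S^{d-1}$ of homogeneous harmonic polynomials of degree $n$, dimension $h(n,d)=\frac{(2n+d-2)(n+d-2)!}{n!(d-2)!(n+d-2)}$ ($h(0,d)=1$, $h(n,2)=2$ for $n\ge1$); $Q_{n,d}$ the orthogonal projector onto $H^{n,d}$, with kernel $q_{n,d}(x,y)=\frac{h(n,d)C_n^{\nu(d)}(x'y)}{|\mathbb S^{d-1}|C_n^{\nu(d)}(1)}$, $\nu(d)=(d-2)/2$, $C_n^\nu$ Gegenbauer polynomials ($C_n^\nu(t)=\sum_{l=0}^{\lfloor n/2\rfloor}\frac{(-1)^l(\nu)_{n-l}}{l!(n-2l)!}(2t)^{n-2l}$ for $\nu>0$; $C_0^0=1$, $C_n^0(t)=\frac2n\cos(n\arccos t)$). $\zeta_{n,d}=n(n+d-2)$. $\mathrm W^s_p(\mathbb S^{d-1})$: $f\in\mathrm L^p$ with $(-\Delta^S)^{s/2}f:=\sum_n\zeta_{n,d}^{s/2}Q_{n,d}f\in\mathrm L^p$ (as a distribution), norm $\|f\|_{p,s}=\|f\|_p+\|(-\Delta^S)^{s/2}f\|_p$. Kernels: $K_T(x,y)=\sum_{n=0}^T\chi(n,T)q_{n,d}(x,y)$ with real weights; conditions: (K1) $\sup_T\|K_T(x,\cdot)\|_1<\infty$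 (independent of $x$); (K2) $\exists C,\alpha$: $|K_T(z,x)-K_T(z,y)|\le C\|x-y\|T^\alpha$ for all $x,y,z,T$; (K3) for given $p,s$: $\exists C$ $\forall f\in\mathrm W^s_p$, $\|f-\int K_T(\cdot,y)f(y)d\sigma(y)\|_p\le CT^{-s}\|f\|_{p,s}$; (K4) $\chi(n,T)\in[0,1]$ and $\exists c>0$: $\chi(n,T)\ge c$ for $0\le n\le\lfloor T/2\rfloor$. The odd part is $K_{2T}^-(x,y)=\sum_{p=0}^{T-1}\chi(2p+1,2T)q_{2p+1,d}(x,y)$. Setup (M): $\beta,X$ independent random vectors in $\mathbb S^{d-1}$, $\beta$ with probability density $f_\beta$ w.r.t. $\sigma$, $X$ with density $f_X$ w.r.t. $\sigma$, positive $\sigma$-a.e. on $H^+=\{x:x_1\ge0\}$ and zero outside; $Y=\mathbb I\{X'\beta\ge0\}$; $r(x)=\mathbb P(Y=1|X=x)$ on $H^+$; $R(x)=r(x)$ for $x_1\ge0$ and $R(x)=1-r(-x)$ for $x_1<0$. Data $(y_i,x_i)_{i=1}^N$ are i.i.d. copies of $(Y,X)$; $\hat f_X$ is an estimator of $f_X$ computed from the data; $r>0$ is a trimming constant; $T_N$ is a sequence of integers. Estimator: $\hat R(x)=\frac12+\frac1N\sum_{i=1}^N\frac{(2y_i-1)K_{2T_N}^-(x_i,x)}{\max(\hat f_X(x_i),(\log N)^{-r})}$. Also $M_N=\max_{i\le N}\big|\frac{\max(f_X(x_i),(\log N)^{-r})}{\max(\hat f_X(x_i),(\log N)^{-r})}-1\big|$.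 *)

theory Defs
  imports "HOL-Analysis.Analysis" "HOL-Probability.Probability"
begin

text \<open>sigma(A) = d * Lebesgue volume of the cone {t x : 0 < t <= 1, x in A}.\<close>
definition sphere_measure :: "'a::euclidean_space measure" where
  "sphere_measure =
     density (distr (restrict_space lborel (cball 0 1 - {0})) (restrict_space borel (sphere 0 1))
                    (\<lambda>x. x /\<^sub>R norm x))
             (\<lambda>_. ennreal (real DIM('a)))"

definition sphere_area :: "nat \<Rightarrow> real" where
  "sphere_area d = 2 * pi powr (real d / 2) / Gamma (real d / 2)"

definition gegenbauer :: "real \<Rightarrow> nat \<Rightarrow> real \<Rightarrow> real" where
  "gegenbauer \<nu> n t =
     (if \<nu> = 0 then (if n = 0 then 1 else 2 / real n * cos (real n * arccos t))
      else (\<Sum>l = 0..n div 2. (-1) ^ l * pochhammer \<nu> (n - l) / (fact l * fact (n - 2 * l))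
                               * (2 * t) ^ (n - 2 * l)))"

definition hdim :: "nat \<Rightarrow> nat \<Rightarrow> real" where
  "hdim n d = (if n = 0 then 1 else
     real (2 * n + d - 2) * fact (n + d - 2) / (fact n * fact (d - 2) * real (n + d - 2)))"

definition nu :: "nat \<Rightarrow> real" where
  "nu d = (real d - 2) / 2"

definition zeta :: "nat \<Rightarrow> nat \<Rightarrow> real" where
  "zeta n d = real n * (real n + real d - 2)"

text \<open>Kernel q_{n,d} of the orthogonal projector onto H^{n,d}; d = DIM('a).\<close>
definition qker :: "nat \<Rightarrow> 'a::euclidean_space \<Rightarrow> 'a \<Rightarrow> real" where
  "qker n x y = hdim n DIM('a) * gegenbauer (nu DIM('a)) n (x \<bullet> y)
                / (sphere_area DIM('a) * gegenbauer (nu DIM('a)) n 1)"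

definition Qproj :: "nat \<Rightarrow> ('a::euclidean_space \<Rightarrow> real) \<Rightarrow> 'a \<Rightarrow> real" where
  "Qproj n f x = (\<integral>y. qker n x y * f y \<partial>sphere_measure)"

definition Kker :: "(nat \<Rightarrow> nat \<Rightarrow> real) \<Rightarrow> nat \<Rightarrow> 'a::euclidean_space \<Rightarrow> 'a \<Rightarrow> real" where
  "Kker wt T x y = (\<Sum>n = 0..T. wt n T * qker n x y)"

definition Kodd :: "(nat \<Rightarrow> nat \<Rightarrow> real) \<Rightarrow> nat \<Rightarrow> 'a::euclidean_space \<Rightarrow> 'a \<Rightarrow> real" where
  "Kodd wt T x y = (\<Sum>p<T. wt (2 * p + 1) (2 * T) * qker (2 * p + 1) x y)"

definition Linf_norm :: "('a::euclidean_space \<Rightarrow> real) \<Rightarrow> ereal" where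
  "Linf_norm f = esssup sphere_measure (\<lambda>x. ereal \<bar>f x\<bar>)"

definition in_Linf :: "('a::euclidean_space \<Rightarrow> real) \<Rightarrow> bool" where
  "in_Linf f \<longleftrightarrow> f \<in> borel_measurable sphere_measure \<and> Linf_norm f < \<infinity>"

text \<open>g represents the distribution (-Delta)^{s/2} f = sum_n zeta^{s/2} Q_n f, with f, g in L^infinity:
  a distribution on the sphere is determined by its projections onto the spaces H^{n,d}.\<close>
definition frac_lap_Linf :: "real \<Rightarrow> ('a::euclidean_space \<Rightarrow> real) \<Rightarrow> ('a \<Rightarrow> real) \<Rightarrow> bool" where
  "frac_lap_Linf s f g \<longleftrightarrow> in_Linf f \<and> in_Linf g \<and>
     (\<forall>n. \<forall>x\<in>sphere 0 1. Qproj n g x = zeta n DIM('a) powr (s / 2) * Qproj n f x)"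

definition sobolev_Linf :: "real \<Rightarrow> ('a::euclidean_space \<Rightarrow> real) \<Rightarrow> bool" where
  "sobolev_Linf s f \<longleftrightarrow> (\<exists>g. frac_lap_Linf s f g)"

definition K1 :: "(nat \<Rightarrow> nat \<Rightarrow> real) \<Rightarrow> 'a::euclidean_space itself \<Rightarrow> bool" where
  "K1 wt _ \<longleftrightarrow> (\<exists>B. \<forall>T. \<forall>x\<in>(sphere 0 1 :: 'a set).
      (\<integral>\<^sup>+ y. ennreal \<bar>Kker wt T x y\<bar> \<partial>sphere_measure) \<le> ennreal B)"

definition K2 :: "(nat \<Rightarrow> nat \<Rightarrow> real) \<Rightarrow> 'a::euclidean_space itself \<Rightarrow> bool" where
  "K2 wt _ \<longleftrightarrow> (\<exists>C \<alpha>. \<forall>T\<ge>1. \<forall>x\<in>(sphere 0 1 :: 'a set). \<forall>y\<in>sphere 0 1. \<forall>z\<in>sphere 0 1.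
      \<bar>Kker wt T z x - Kker wt T z y\<bar> \<le> C * norm (x - y) * real T powr \<alpha>)"

definition K3_inf :: "(nat \<Rightarrow> nat \<Rightarrow> real) \<Rightarrow> real \<Rightarrow> 'a::euclidean_space itself \<Rightarrow> bool" where
  "K3_inf wt s _ \<longleftrightarrow> (\<exists>C. \<forall>T\<ge>1. \<forall>(f :: 'a \<Rightarrow> real) g. frac_lap_Linf s f g \<longrightarrow>
      Linf_norm (\<lambda>x. f x - (\<integral>y. Kker wt T x y * f y \<partial>sphere_measure))
        \<le> ereal (C * real T powr (- s)) * (Linf_norm f + Linf_norm g))"

definition K4 :: "(nat \<Rightarrow> nat \<Rightarrow> real) \<Rightarrow> bool" where
  "K4 wt \<longleftrightarrow> (\<forall>n T. 0 \<le> wt n T \<and> wt n T \<le> 1) \<and>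
             (\<exists>c>0. \<forall>T n. n \<le> T div 2 \<longrightarrow> wt n T \<ge> c)"

definition o_p1 :: "'w measure \<Rightarrow> (nat \<Rightarrow> 'w \<Rightarrow> real) \<Rightarrow> bool" where
  "o_p1 M Z \<longleftrightarrow> (\<forall>\<epsilon>>0. ((\<lambda>N. measure M {\<omega> \<in> space M. \<bar>Z N \<omega>\<bar> > \<epsilon>}) \<longlonglongrightarrow> 0))"

end

theory Submission
  imports Defs
begin

text \<open>
  On the whole sphere \<open>R x = P (x \<bullet> \<beta> \<ge> 0)\<close>, which is continuous with \<open>R - 1/2\<close> odd. Up to the factor
  \<open>1 + O (M_N)\<close> caused by the estimated density, \<open>Rhat - 1/2\<close> is an average of i.i.d. bounded variables,
  to which the central limit theorem for triangular arrays applies; conditions (a), (c) and (d)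
  make the density error, the smoothing bias and the trimming bias negligible against the standard
  error \<open>s1 / sqrt N\<close>, and (b) is the Lyapunov condition.

  The order of \<open>s1\<close> is \<open>T powr ((d - 1) / 2)\<close>. It comes from the expansion of the Gegenbauer polynomials
  in cosines with nonnegative coefficients: \<open>|Kodd z x| \<le> Kodd x x \<approx> T ^ (d - 1)\<close>, and \<open>Kodd z x\<close>
  exceeds half of this value for \<open>|z - x| \<le> 1 / (2 T)\<close>. An odd function times the odd kernel has the same integral over both half spheres, so integrals over
  the support of \<open>X\<close> turn into integrals over the sphere.
\<close>

section \<open>Gegenbauer polynomials\<close>

unbundle no vec_syntax and fps_syntax

text \<open>The sample behind \<open>fhat\<close> is the one averaged in \<open>Rhat\<close>, so the
  summands of \<open>Rhat\<close> are dependent. The density error is therefore taken out uniformly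
  through \<open>MN\<close>; what it multiplies is an average of absolute values, whose expectation
  stays bounded by (K1), because the denominator \<open>max fX trim\<close> absorbs the density of
  \<open>X\<close>. The delicate point is the lower bound of \<open>s1\<close>. With
  \<open>p = T powr ((d - 1) / 2)\<close> and \<open>S\<close> the measure of the trimmed region,
  trimming can remove a multiple of \<open>p ^ 4 * S\<close> from a second moment of order
  \<open>p ^ 2\<close>. Conditions (b) and (d) multiply to \<open>p ^ 2 * S\<close> tending to 0,
  which makes this loss negligible; the squared mean stays bounded while \<open>p\<close> tends to
  infinity. Apart from (K1) to (K4), harmonic analysis enters only through values of Gegenbauer
  polynomials and the reflection \<open>x \<mapsto> - x\<close>.\<close>

lemma abs_sin_nat_mult_le: "\<bar>sin (real n * x)\<bar> \<le> real n * \<bar>sin x\<bar>"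
proof (induction n)
  case (Suc n)
  have "\<bar>sin (real (Suc n) * x)\<bar> = \<bar>sin (real n * x) * cos x + cos (real n * x) * sin x\<bar>"
    by (simp add: algebra_simps sin_add)
  also have "\<dots> \<le> \<bar>sin (real n * x)\<bar> * \<bar>cos x\<bar> + \<bar>cos (real n * x)\<bar> * \<bar>sin x\<bar>"
    by (metis abs_mult abs_triangle_ineq)
  also have "\<dots> \<le> \<bar>sin (real n * x)\<bar> * 1 + 1 * \<bar>sin x\<bar>"
    by (intro add_mono mult_left_mono mult_right_mono) auto
  finally show ?case using Suc by (simp add: algebra_simps)
qed auto

text \<open>The half-angle formula reduces this to
  \<open>\<bar>sin (n y)\<bar> \<le> n \<bar>sin y\<bar>\<close>. The bound is quadratic in
  \<open>n\<close>, so one cap of radius of order \<open>1 / T\<close> serves all degrees up to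
  \<open>2 T\<close> at once.\<close>

lemma one_minus_cos_mult_le: "1 - cos (real n * x) \<le> (real n)\<^sup>2 * (1 - cos x)"
proof -
  have *: "1 - cos y = 2 * (sin (y / 2))\<^sup>2" for y :: real
    using cos_double_sin[of "y / 2"] by simp
  have "(sin (real n * (x / 2)))\<^sup>2 \<le> (real n * \<bar>sin (x / 2)\<bar>)\<^sup>2"
    using abs_sin_nat_mult_le[of n "x / 2"] by (metis abs_ge_zero power2_abs power_mono)
  then show ?thesis unfolding * by (simp add: power_mult_distrib)
qed

text \<open>\<open>P\<close> is invertible because its constant term is nonzero, so both series
  satisfy \<open>F' = S F\<close> with the same \<open>S\<close>. Coefficient \<open>m + 1\<close>
  of a solution is then determined by those up to \<open>m\<close>, as characteristic zero allows
  division by \<open>m + 1\<close>.\<close>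

lemma fps_linear_ode_unique:
  fixes F G P Q :: "'b::field_char_0 fps"
  assumes "P * fps_deriv F = Q * F" "P * fps_deriv G = Q * G" "P $ 0 \<noteq> 0" "F $ 0 = G $ 0"
  shows "F = G"
proof -
  define S where "S = inverse P * Q"
  have *: "fps_deriv H = S * H" if "P * fps_deriv H = Q * H" for H
  proof -
    have "fps_deriv H = inverse P * (P * fps_deriv H)"
      using assms(3) by (simp add: mult.assoc[symmetric] inverse_mult_eq_1)
    then show ?thesis using that by (simp add: S_def mult.assoc)
  qed
  have "F $ n = G $ n" for n
  proof (induction n rule: less_induct)
    case (less n)
    show ?case
    proof (cases n)
      case 0 then show ?thesis using assms by simp
    next
      case (Suc m)
      have "of_nat (Suc m) * F $ Suc m = (S * F) $ m" "of_nat (Suc m) * G $ Suc m = (S * G) $ m"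
        using *[OF assms(1)] *[OF assms(2)] fps_deriv_nth[of F m] fps_deriv_nth[of G m] by simp_all
      moreover have "(S * F) $ m = (S * G) $ m"
        unfolding fps_mult_nth using less.IH Suc by (intro sum.cong) auto
      ultimately have "of_nat (Suc m) * F $ Suc m = of_nat (Suc m) * G $ Suc m" by metis
      then show ?thesis unfolding Suc by (metis mult_cancel_left of_nat_neq_0)
    qed
  qed
  then show ?thesis by (simp add: fps_eq_iff)
qed

text \<open>\<open>A\<close> is the binomial series of \<open>(1 - X) powr (- v)\<close>. The
  equation encodes its recursion \<open>(k + 1) a (k + 1) = (v + k) a k\<close> and stands in for
  real powers of formal series.\<close>

lemma fps_pochhammer_deriv:
  fixes v :: "'b::field_char_0"
  defines "A \<equiv> Abs_fps (\<lambda>k. pochhammer v k / fact k)"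
  shows "(1 - fps_X) * fps_deriv A = fps_const v * A"
proof (rule fps_ext)
  fix n
  have a: "of_nat (Suc k) * A $ Suc k = (v + of_nat k) * A $ k" for k
    by (simp add: A_def pochhammer_Suc field_simps del: of_nat_Suc)
  show "((1 - fps_X) * fps_deriv A) $ n = (fps_const v * A) $ n"
  proof (cases n)
    case 0
    then show ?thesis using a[of 0] by (simp add: left_diff_distrib)
  next
    case (Suc m)
    have "((1 - fps_X) * fps_deriv A) $ n
        = of_nat (Suc n) * A $ Suc n - of_nat (Suc m) * A $ Suc m"
      using Suc by (simp add: left_diff_distrib)
    also have "of_nat (Suc n) * A $ Suc n = (v + of_nat n) * A $ n" by (rule a)
    finally show ?thesis using Suc by (simp add: algebra_simps)
  qed
qed

lemma fps_nth_const_minus_X_power: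
  fixes c :: "'b::comm_ring_1"
  shows "((fps_const c - fps_X) ^ i) $ j = (if j \<le> i then of_nat (i choose j) * (-1) ^ j * c ^ (i - j) else 0)"
proof -
  have "(fps_const c - fps_X) ^ i = (- fps_X + fps_const c) ^ i" by simp
  also have "\<dots> = (\<Sum>k\<le>i. of_nat (i choose k) * (- fps_X) ^ k * fps_const c ^ (i - k))"
    by (rule binomial_ring)
  also have "\<dots> = (\<Sum>k\<le>i. fps_const (of_nat (i choose k) * (-1) ^ k * c ^ (i - k)) * fps_X ^ k)"
  proof (intro sum.cong refl)
    fix k
    have "(- fps_X :: 'b fps) ^ k = fps_const ((-1) ^ k) * fps_X ^ k"
      by (cases "even k") (simp_all add: fps_const_neg[symmetric] del: fps_const_neg)
    then show "of_nat (i choose k) * (- fps_X) ^ k * fps_const c ^ (i - k)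
        = fps_const (of_nat (i choose k) * (-1) ^ k * c ^ (i - k)) * fps_X ^ k"
      by (simp add: fps_of_nat[symmetric] ac_simps)
  qed
  also have "\<dots> $ j = (\<Sum>k\<le>i. if k = j then of_nat (i choose k) * (-1) ^ k * c ^ (i - k) else 0)"
    unfolding fps_sum_nth by (intro sum.cong refl) (simp add: fps_X_power_nth)
  finally show ?thesis by (simp add: sum.delta)
qed

text \<open>The substituted series is \<open>X (2 c - X)\<close>, whose \<open>i\<close>-th power
  has terms of degrees \<open>i\<close> to \<open>2 i\<close> only; collecting the coefficient of
  \<open>X ^ n\<close> gives back the defining finite sum. Complex coefficients prepare for the
  factorization by \<open>cis\<close>.\<close>

lemma gegenbauer_nth:
  fixes c v :: real
  assumes "v \<noteq> 0"
  shows "complex_of_real (gegenbauer v n c) =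
    (Abs_fps (\<lambda>k. pochhammer (complex_of_real v) k / fact k) oo
      (fps_const (2 * complex_of_real c) * fps_X - fps_X\<^sup>2)) $ n"
proof -
  let ?c = "2 * complex_of_real c" and ?v = "complex_of_real v"
  have eq: "fps_const ?c * fps_X - fps_X\<^sup>2 = fps_X * (fps_const ?c - fps_X)"
    by (simp add: algebra_simps power2_eq_square)
  define t where "t i = pochhammer ?v i / fact i *
      (if n - i \<le> i then of_nat (i choose (n - i)) * (-1) ^ (n - i) * ?c ^ (i - (n - i)) else 0)" for i
  have "(Abs_fps (\<lambda>k. pochhammer ?v k / fact k) oo (fps_const ?c * fps_X - fps_X\<^sup>2)) $ n
     = (\<Sum>i=0..n. t i)"
    unfolding fps_compose_nth eq power_mult_distrib
    by (intro sum.cong refl)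
       (simp add: fps_X_power_mult_nth fps_nth_const_minus_X_power t_def)
  \<comment> \<open>With \<open>l = n - i\<close> the summation index of \<open>gegenbauer\<close>
    appears; terms with \<open>2 l > n\<close> vanish, since then \<open>n - i > i\<close>.\<close>
  also have "\<dots> = (\<Sum>l=0..n. t (n - l))"
    by (rule sum.reindex_bij_witness[of _ "\<lambda>l. n - l" "\<lambda>l. n - l"]) auto
  also have "\<dots> = (\<Sum>l=0..n div 2. t (n - l))"
    by (rule sum.mono_neutral_right) (auto simp: t_def)
  also have "\<dots> = (\<Sum>l=0..n div 2. complex_of_real
      ((-1) ^ l * pochhammer v (n - l) / (fact l * fact (n - 2 * l)) * (2 * c) ^ (n - 2 * l)))"
  proof (intro sum.cong refl)
    fix l assume "l \<in> {0..n div 2}"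
    then have l: "2 * l \<le> n" by auto
    then have e: "n - (n - l) = l" "n - l - l = n - 2 * l" "l \<le> n - l" by auto
    have p: "pochhammer ?v k = complex_of_real (pochhammer v k)" for k
      by (simp add: pochhammer_of_real)
    have b: "complex_of_nat ((n - l) choose l) = fact (n - l) / (fact l * fact (n - 2 * l))"
      using binomial_fact[OF e(3), where 'a=complex] e(2) by simp
    show "t (n - l) = complex_of_real
      ((-1) ^ l * pochhammer v (n - l) / (fact l * fact (n - 2 * l)) * (2 * c) ^ (n - 2 * l))"
      unfolding t_def e b p using e(3) by simp
  qed
  finally show ?thesis using assms by (simp add: gegenbauer_def)
qed

text \<open>The generating function \<open>(1 - 2 cos \<theta> X + X\<^sup>2) powr (- v)\<close> splits into
  \<open>(1 - cis \<theta> X) powr (- v) * (1 - cis (- \<theta>) X) powr (- v)\<close>: both sides solve the same first order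
  linear equation. The coefficients of the resulting cosine sum are nonnegative.\<close>
lemma gegenbauer_cos:
  fixes v \<theta> :: real
  assumes "v \<noteq> 0"
  shows "gegenbauer v n (cos \<theta>) =
    (\<Sum>k=0..n. pochhammer v k / fact k * (pochhammer v (n - k) / fact (n - k))
        * cos ((real n - 2 * real k) * \<theta>))"
proof -
  define A where "A = Abs_fps (\<lambda>k. pochhammer (complex_of_real v) k / fact k)"
  define u where "u = cis \<theta>"
  define w where "w = cis (- \<theta>)"
  define p where "p = fps_const (2 * complex_of_real (cos \<theta>)) * fps_X - fps_X\<^sup>2"
  have uw: "u * w = 1" by (simp add: u_def w_def cis_mult)
  have us: "u + w = 2 * complex_of_real (cos \<theta>)"
    by (simp add: u_def w_def complex_eq_iff)
  have A: "(1 - fps_X) * fps_deriv A = fps_const (complex_of_real v) * A"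
    unfolding A_def by (rule fps_pochhammer_deriv)
  have comp: "(1 - q) * (fps_deriv A oo q) = fps_const (complex_of_real v) * (A oo q)" if "q $ 0 = 0" for q
  proof -
    have "((1 - fps_X) * fps_deriv A) oo q = (fps_const (complex_of_real v) * A) oo q"
      using A by simp
    then show ?thesis using that
      by (simp add: fps_compose_mult_distrib fps_compose_sub_distrib)
  qed
  have p0: "p $ 0 = 0" by (simp add: p_def)
  let ?v = "fps_const (complex_of_real v)"
  define U where "U = fps_const u * fps_X"
  define W where "W = fps_const w * fps_X"
  have UW0: "U $ 0 = 0" "W $ 0 = 0" by (simp_all add: U_def W_def)
  have dUW: "fps_deriv U = fps_const u" "fps_deriv W = fps_const w" by (simp_all add: U_def W_def)
  have UWp: "(1 - U) * (1 - W) = 1 - p"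
  proof -
    have "(1 - U) * (1 - W) = 1 - fps_const (u + w) * fps_X + fps_const (u * w) * fps_X\<^sup>2"
      by (simp add: U_def W_def algebra_simps power2_eq_square fps_const_add[symmetric]
            fps_const_mult[symmetric] del: fps_const_add fps_const_mult)
    then show ?thesis by (simp add: uw us p_def)
  qed
  have dp: "fps_deriv p = - (fps_deriv ((1 - U) * (1 - W)))" unfolding UWp by simp
  have dp': "fps_deriv p = fps_const u * (1 - W) + fps_const w * (1 - U)"
    unfolding dp by (simp add: dUW algebra_simps)
  have "A oo p = (A oo U) * (A oo W)"
  proof (rule fps_linear_ode_unique[where P="1 - p" and Q="?v * fps_deriv p"])
    show "(1 - p) * fps_deriv (A oo p) = ?v * fps_deriv p * (A oo p)"
      using comp[OF p0] by (simp add: fps_compose_deriv p0 ac_simps)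
    \<comment> \<open>\<open>1 - p\<close> is the product \<open>(1 - U) (1 - W)\<close>: in each
      summand of the product rule one factor is used up by the equation of \<open>A\<close>, and the
      other one goes into \<open>fps_deriv p\<close>.\<close>
    have "(1 - p) * fps_deriv ((A oo U) * (A oo W))
       = (1 - W) * fps_const w * (A oo U) * (1 - U) * (fps_deriv A oo W) 
         + (1 - U) * fps_const u * (A oo W) * (1 - W) * (fps_deriv A oo U)"
      unfolding UWp[symmetric] by (simp add: fps_compose_deriv UW0 dUW algebra_simps)
    also have "\<dots> = (1 - U) * fps_const w * (A oo U) * ((1 - W) * (fps_deriv A oo W))
         + (1 - W) * fps_const u * (A oo W) * ((1 - U) * (fps_deriv A oo U))"
      by (simp add: ac_simps)
    also have "\<dots> = ?v * fps_deriv p * ((A oo U) * (A oo W))"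
      unfolding comp[OF UW0(1)] comp[OF UW0(2)] dp'
      by (simp add: algebra_simps del: fps_const_mult fps_const_add)
    finally show "(1 - p) * fps_deriv ((A oo U) * (A oo W)) = ?v * fps_deriv p * ((A oo U) * (A oo W))" .
  qed (simp_all add: p0 A_def)
  then have "complex_of_real (gegenbauer v n (cos \<theta>)) = ((A oo U) * (A oo W)) $ n"
    using gegenbauer_nth[OF assms, of n "cos \<theta>"] by (simp add: A_def p_def)
  also have "\<dots> = (\<Sum>k=0..n. complex_of_real (pochhammer v k / fact k * (pochhammer v (n - k) / fact (n - k)))
        * (u ^ k * w ^ (n - k)))"
    unfolding fps_mult_nth U_def W_def fps_compose_linear
    by (intro sum.cong refl) (simp add: A_def pochhammer_of_real)
  also have "\<dots> = (\<Sum>k=0..n. complex_of_real (pochhammer v k / fact k * (pochhammer v (n - k) / fact (n - k)))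
        * cis (- ((real n - 2 * real k) * \<theta>)))"
    by (intro sum.cong refl) (auto simp: u_def w_def Complex.DeMoivre cis_mult of_nat_diff algebra_simps)
  \<comment> \<open>Taking real parts drops the sine terms without pairing \<open>k\<close> with
    \<open>n - k\<close>.\<close>
  finally have "Re (complex_of_real (gegenbauer v n (cos \<theta>))) =
     Re (\<Sum>k=0..n. complex_of_real (pochhammer v k / fact k * (pochhammer v (n - k) / fact (n - k)))
        * cis (- ((real n - 2 * real k) * \<theta>)))"
    by simp
  then show ?thesis by (simp add: Re_sum del: of_real_mult of_real_divide)
qed

text \<open>For \<open>v > 0\<close> all coefficients of the cosine sum are positive, so every term
  is largest at angle 0; as the frequencies \<open>n - 2 k\<close> are at most \<open>n\<close> in
  absolute value, each cosine falls short of 1 by at most \<open>n\<^sup>2 (1 - t)\<close>. For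
  \<open>v = 0\<close>, the case of the circle, there is a single cosine.\<close>

lemma gegenbauer_bounds:
  fixes v t :: real
  assumes "v \<ge> 0" "\<bar>t\<bar> \<le> 1"
  shows gegenbauer_one_pos: "gegenbauer v n 1 > 0"
    and abs_gegenbauer_le: "\<bar>gegenbauer v n t\<bar> \<le> gegenbauer v n 1"
    and gegenbauer_ge: "gegenbauer v n t \<ge> gegenbauer v n 1 * (1 - (real n)\<^sup>2 * (1 - t))"
proof -
  define \<theta> where "\<theta> = arccos t"
  have t: "t = cos \<theta>" using assms by (simp add: \<theta>_def abs_le_iff cos_arccos)
  have c: "cos ((real n - 2 * real k) * \<theta>) \<ge> 1 - (real n)\<^sup>2 * (1 - t)" if "k \<le> n" for k
  proof -
    \<comment> \<open>Cosine is even, so the integer frequency may be replaced by a natural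
      number.\<close>
    define m where "m = nat \<bar>int n - 2 * int k\<bar>"
    have "real m = \<bar>real n - 2 * real k\<bar>" by (simp add: m_def)
    then have "cos ((real n - 2 * real k) * \<theta>) = cos (real m * \<theta>)"
      by (metis abs_if cos_minus mult_minus_left)
    moreover have "(real m)\<^sup>2 * (1 - t) \<le> (real n)\<^sup>2 * (1 - t)"
      using that assms by (intro mult_right_mono power_mono) (auto simp: m_def)
    ultimately show ?thesis using one_minus_cos_mult_le[of m \<theta>] t by simp
  qed
  have "gegenbauer v n 1 > 0 \<and> \<bar>gegenbauer v n t\<bar> \<le> gegenbauer v n 1
      \<and> gegenbauer v n t \<ge> gegenbauer v n 1 * (1 - (real n)\<^sup>2 * (1 - t))"
  proof (cases "v = 0")
    case True
    have "cos (real n * \<theta>) \<ge> 1 - (real n)\<^sup>2 * (1 - t)" using c[of 0] by simp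
    then have "2 / real n * cos (real n * \<theta>) \<ge> 2 / real n * (1 - (real n)\<^sup>2 * (1 - t))"
      by (intro mult_left_mono) auto
    moreover have "2 / real n * \<bar>cos (real n * \<theta>)\<bar> \<le> 2 / real n * 1"
      by (intro mult_left_mono) auto
    ultimately show ?thesis using True by (auto simp: gegenbauer_def \<theta>_def abs_mult)
  next
    case False
    then have v: "v > 0" using assms by simp
    define a where "a k = pochhammer v k / fact k * (pochhammer v (n - k) / fact (n - k))" for k
    have a: "a k > 0" for k using v by (simp add: a_def pochhammer_pos)
    have g: "gegenbauer v n (cos s) = (\<Sum>k=0..n. a k * cos ((real n - 2 * real k) * s))" for s
      using gegenbauer_cos[OF False, of n s] by (simp add: a_def)
    have g1: "gegenbauer v n 1 = (\<Sum>k=0..n. a k)" using g[of 0] by simp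
    have "gegenbauer v n 1 > 0" unfolding g1 by (rule sum_pos) (auto simp: a)
    moreover have "\<bar>gegenbauer v n t\<bar> \<le> (\<Sum>k=0..n. \<bar>a k * cos ((real n - 2 * real k) * \<theta>)\<bar>)"
      unfolding t g by (rule sum_abs)
    moreover have "\<dots> \<le> (\<Sum>k=0..n. a k)"
      using a by (intro sum_mono) (auto simp: abs_mult less_imp_le intro!: mult_left_le)
    moreover have "gegenbauer v n 1 * (1 - (real n)\<^sup>2 * (1 - t))
         = (\<Sum>k=0..n. a k * (1 - (real n)\<^sup>2 * (1 - t)))" unfolding g1 by (simp add: sum_distrib_right)
    moreover have "\<dots> \<le> (\<Sum>k=0..n. a k * cos ((real n - 2 * real k) * \<theta>))"
      using c a by (intro sum_mono mult_left_mono) (auto simp: less_imp_le)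
    ultimately show ?thesis unfolding t g g1 by linarith
  qed
  then show "gegenbauer v n 1 > 0" "\<bar>gegenbauer v n t\<bar> \<le> gegenbauer v n 1"
     "gegenbauer v n t \<ge> gegenbauer v n 1 * (1 - (real n)\<^sup>2 * (1 - t))" by auto
qed

lemma gegenbauer_minus:
  assumes "\<bar>t\<bar> \<le> 1"
  shows "gegenbauer v n (- t) = (-1) ^ n * gegenbauer v n t"
proof (cases "v = 0")
  case True
  have "cos (real n * (pi - arccos t)) = (-1) ^ n * cos (real n * arccos t)"
    by (simp add: right_diff_distrib cos_diff cos_npi sin_npi mult.commute[of "real n" pi])
  then show ?thesis using True assms by (simp add: gegenbauer_def arccos_minus abs_le_iff)
next
  case False
  have "(2 * - t) ^ (n - 2 * l) = (-1) ^ n * (2 * t) ^ (n - 2 * l)" if "l \<le> n div 2" for l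
  proof -
    have "even n \<longleftrightarrow> even (n - 2 * l)" using that by auto
    then show ?thesis by (simp add: uminus_power_if)
  qed
  then show ?thesis using False
    by (simp add: gegenbauer_def sum_distrib_left mult.left_commute del: power_minus_even)
qed

lemma continuous_on_gegenbauer: "continuous_on {-1..1} (gegenbauer v n)"
proof (cases "v = 0")
  case True
  then have "gegenbauer v n = (\<lambda>t. if n = 0 then 1 else 2 / real n * cos (real n * arccos t))"
    by (auto simp: gegenbauer_def)
  then show ?thesis by (cases "n = 0") (auto intro!: continuous_intros continuous_on_arccos')
next
  case False
  then have "gegenbauer v n = (\<lambda>t. \<Sum>l = 0..n div 2. (-1) ^ l * pochhammer v (n - l) /
       (fact l * fact (n - 2 * l)) * (2 * t) ^ (n - 2 * l))"
    by (auto simp: gegenbauer_def)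
  then show ?thesis by (simp only:) (intro continuous_intros)
qed

unbundle no fps_syntax and vec_syntax

section \<open>The surface measure\<close>

lemma space_sphere_measure [simp]: "space sphere_measure = sphere 0 1"
  by (simp add: sphere_measure_def)

lemma sets_sphere_measure [measurable_cong]:
  "sets sphere_measure = sets (restrict_space borel (sphere 0 1))"
  by (simp add: sphere_measure_def)

lemma sets_sphere_measure_iff: "A \<in> sets sphere_measure \<longleftrightarrow> A \<subseteq> sphere 0 1 \<and> A \<in> sets borel"
  by (simp add: sets_sphere_measure sets_restrict_space_iff)

lemma measurable_sphere_borel:
  assumes "f \<in> borel_measurable borel"
  shows "f \<in> borel_measurable sphere_measure"
  using measurable_restrict_space1[OF assms, of "sphere 0 1"]
  by (simp cong: measurable_cong_sets add: sets_sphere_measure)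

lemma measurable_id_sphere [measurable]: "(\<lambda>x. x) \<in> borel_measurable sphere_measure"
  by (rule measurable_sphere_borel) simp

lemma measurable_sphere_continuous:
  assumes "continuous_on (sphere 0 1) f"
  shows "f \<in> borel_measurable sphere_measure"
  using borel_measurable_continuous_on_restrict[OF assms]
  by (simp cong: measurable_cong_sets add: sets_sphere_measure)

lemma measurable_radial_projection:
  "(\<lambda>x::'a::euclidean_space. x /\<^sub>R norm x) \<in>
     restrict_space lborel (cball 0 1 - {0}) \<rightarrow>\<^sub>M restrict_space borel (sphere 0 1)"
  by (rule measurable_restrict_space2)
     (auto simp: space_restrict_space intro!: measurable_restrict_space1)

lemma emeasure_sphere_measure:
  fixes A :: "'a::euclidean_space set"
  assumes "A \<in> sets sphere_measure"
  shows "emeasure sphere_measure A = ennreal (real DIM('a)) *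
           emeasure lborel {z \<in> cball 0 1 - {0}. z /\<^sub>R norm z \<in> A}"
proof -
  let ?p = "\<lambda>x::'a. x /\<^sub>R norm x" and ?L = "restrict_space (lborel :: 'a measure) (cball 0 1 - {0})"
  have A: "A \<in> sets (restrict_space borel (sphere 0 1))" using assms by (simp add: sets_sphere_measure)
  have "emeasure sphere_measure A = ennreal (real DIM('a)) * emeasure ?L (?p -` A \<inter> space ?L)"
    using A by (simp add: sphere_measure_def emeasure_density_const
        emeasure_distr[OF measurable_radial_projection A])
  also have "emeasure ?L (?p -` A \<inter> space ?L) = emeasure lborel (?p -` A \<inter> space ?L)"
    by (rule emeasure_restrict_space) (auto simp: space_restrict_space)
  also have "?p -` A \<inter> space ?L = {z \<in> cball 0 1 - {0}. ?p z \<in> A}"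
    by (auto simp: space_restrict_space)
  finally show ?thesis .
qed

lemma sets_sphere_cone:
  fixes A :: "'a::euclidean_space set"
  assumes "A \<in> sets sphere_measure"
  shows "{z \<in> cball 0 1 - {0}. z /\<^sub>R norm z \<in> A} \<in> sets borel"
proof -
  have [measurable]: "A \<in> sets borel" using assms by (simp add: sets_sphere_measure_iff)
  have "{z \<in> space borel. z /\<^sub>R norm z \<in> A} \<inter> (cball 0 1 - {0}) \<in> sets borel" by measurable
  then show ?thesis by (auto simp: Collect_conj_eq Int_commute elim!: back_subst[of "\<lambda>S. S \<in> sets borel"])
qed

lemma finite_measure_sphere: "finite_measure (sphere_measure :: 'a::euclidean_space measure)"
proof
  have "emeasure lborel {z::'a \<in> cball 0 1 - {0}. z /\<^sub>R norm z \<in> sphere 0 1} \<le> emeasure lborel (cball (0::'a) 1)"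
    by (rule emeasure_mono) auto
  also have "\<dots> < \<infinity>" using emeasure_lborel_cbox_finite by (simp add: emeasure_cball)
  finally show "emeasure (sphere_measure :: 'a measure) (space sphere_measure) \<noteq> \<infinity>"
    using emeasure_sphere_measure[of "sphere (0::'a) 1"]
    by (simp add: sets_sphere_measure_iff ennreal_mult_eq_top_iff less_top)
qed

interpretation sphere: finite_measure sphere_measure
  by (rule finite_measure_sphere)

lemma emeasure_lborel_uminus:
  fixes A :: "'a::euclidean_space set"
  assumes "A \<in> sets borel"
  shows "emeasure lborel (uminus -` A) = emeasure lborel A"
proof -
  have "(lborel :: 'a measure) = distr lborel borel uminus"
    using lborel_affine[of "-1" "0::'a"] by (simp add: density_1)
  then have "emeasure lborel A = emeasure (distr lborel borel uminus) A" by simp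
  also have "\<dots> = emeasure lborel (uminus -` A)" using assms by (simp add: emeasure_distr)
  finally show ?thesis ..
qed

lemma measurable_uminus_sphere [measurable]:
  "uminus \<in> (sphere_measure :: 'a::euclidean_space measure) \<rightarrow>\<^sub>M sphere_measure"
proof -
  have "uminus \<in> (restrict_space borel (sphere 0 1) :: 'a measure) \<rightarrow>\<^sub>M restrict_space borel (sphere 0 1)"
    by (rule measurable_restrict_space2) (auto simp: space_restrict_space intro!: measurable_restrict_space1)
  then show ?thesis by (simp cong: measurable_cong_sets add: sets_sphere_measure)
qed

text \<open>The cone over \<open>- A\<close> is the reflected cone over \<open>A\<close>, so
  invariance is inherited from Lebesgue measure.\<close>

lemma distr_sphere_uminus: "distr sphere_measure sphere_measure uminus = (sphere_measure :: 'a::euclidean_space measure)"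
proof (rule measure_eqI)
  fix A :: "'a set" assume "A \<in> sets (distr sphere_measure sphere_measure uminus)"
  then have A: "A \<in> sets sphere_measure" by simp
  have A': "uminus -` A \<inter> sphere 0 1 \<in> sets sphere_measure"
    using measurable_sets[OF measurable_uminus_sphere A] by simp
  have eq: "{z \<in> cball 0 1 - {0}. z /\<^sub>R norm z \<in> uminus -` A \<inter> sphere 0 1}
      = uminus -` {z \<in> cball 0 1 - {0}. z /\<^sub>R norm z \<in> A}" by auto
  show "emeasure (distr sphere_measure sphere_measure uminus) A = emeasure sphere_measure A"
    using emeasure_lborel_uminus[OF sets_sphere_cone[OF A]]
    unfolding emeasure_distr[OF measurable_uminus_sphere A] space_sphere_measure
      emeasure_sphere_measure[OF A'] emeasure_sphere_measure[OF A] eq by simp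
qed simp

lemma integral_sphere_uminus:
  fixes f :: "'a::euclidean_space \<Rightarrow> real"
  assumes "f \<in> borel_measurable sphere_measure"
  shows "(\<integral>x. f (- x) \<partial>sphere_measure) = (\<integral>x. f x \<partial>sphere_measure)"
  using integral_distr[OF measurable_uminus_sphere assms] by (simp add: distr_sphere_uminus)

text \<open>The cone over the great subsphere lies in a hyperplane. Ties
  \<open>x \<bullet> \<beta> = 0\<close> and the common boundary of the two half spheres can thus be
  ignored.\<close>

lemma AE_sphere_not_orthogonal:
  fixes e :: "'a::euclidean_space"
  assumes "e \<noteq> 0"
  shows "AE x in sphere_measure. x \<bullet> e \<noteq> 0"
proof -
  have S: "{x \<in> sphere 0 1. x \<bullet> e = 0} \<in> sets sphere_measure"
    by (auto simp: sets_sphere_measure_iff Collect_conj_eq intro!: borel_closed closed_Collect_eq continuous_intros)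
  have "{z::'a. e \<bullet> z = 0} \<in> null_sets lborel"
    using negligible_hyperplane[of e 0] assms by (auto simp: negligible_iff_null_sets null_sets_def
      intro: borel_closed closed_hyperplane)
  moreover have "{z \<in> cball 0 1 - {0}. z /\<^sub>R norm z \<in> {x \<in> sphere 0 1. x \<bullet> e = 0}} \<subseteq> {z. e \<bullet> z = 0}"
    by (auto simp: inner_commute)
  ultimately have "{z \<in> cball 0 1 - {0}. z /\<^sub>R norm z \<in> {x \<in> sphere 0 1. x \<bullet> e = 0}} \<in> null_sets lborel"
    using sets_sphere_cone[OF S] by (metis (no_types, lifting) null_sets_subset sets_lborel)
  then have "{x \<in> sphere 0 1. x \<bullet> e = 0} \<in> null_sets sphere_measure"
    using S unfolding null_sets_def mem_Collect_eq emeasure_sphere_measure[OF S] by simp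
  then show ?thesis by (rule AE_I') auto
qed

text \<open>Passing through \<open>z / t\<close> splits the error into the change of scale and the
  displacement from the axis; each part is at most \<open>\<rho> / t \<le> 2 \<rho>\<close>.\<close>

lemma radial_projection_near:
  fixes x z :: "'a::euclidean_space"
  assumes x: "norm x = 1" and t: "1/2 \<le> t" and z: "norm (z - t *\<^sub>R x) < \<rho>" and r: "\<rho> \<le> 1/4"
  shows "z \<noteq> 0" "norm (z /\<^sub>R norm z - x) \<le> 4 * \<rho>"
proof -
  have rho: "\<rho> > 0" using z norm_ge_zero[of "z - t *\<^sub>R x"] by linarith
  have *: "\<rho> \<le> 2 * \<rho> * t" using mult_left_mono[of 1 "2 * t" \<rho>] rho t by (simp add: ac_simps)
  have n: "\<bar>norm z - t\<bar> < \<rho>"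
    using norm_triangle_ineq3[of z "t *\<^sub>R x"] x t z by auto
  then have pos: "norm z > 0" using t r by linarith
  then show "z \<noteq> 0" by auto
  have "z /\<^sub>R norm z - x = (z /\<^sub>R norm z - z /\<^sub>R t) + (z - t *\<^sub>R x) /\<^sub>R t"
    using t by (simp add: scaleR_right_diff_distrib)
  then have "norm (z /\<^sub>R norm z - x) \<le> norm (z /\<^sub>R norm z - z /\<^sub>R t) + norm ((z - t *\<^sub>R x) /\<^sub>R t)"
    by (metis norm_triangle_ineq)
  also have "norm (z /\<^sub>R norm z - z /\<^sub>R t) = \<bar>inverse (norm z) - inverse t\<bar> * norm z"
    by (metis norm_scaleR scaleR_left_diff_distrib)
  also have "\<dots> = \<bar>(inverse (norm z) - inverse t) * norm z\<bar>"
    by (simp add: abs_mult)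
  also have "(inverse (norm z) - inverse t) * norm z = (t - norm z) / t"
    using pos t by (simp add: field_simps)
  also have "\<bar>\<dots>\<bar> \<le> 2 * \<rho>"
  proof -
    have "\<bar>t - norm z\<bar> \<le> \<rho>" using n by linarith
    also note *
    finally show ?thesis using t by (simp add: field_simps)
  qed
  also have "norm ((z - t *\<^sub>R x) /\<^sub>R t) \<le> 2 * \<rho>"
  proof -
    have t0: "t > 0" using t by simp
    have "norm ((z - t *\<^sub>R x) /\<^sub>R t) = norm (z - t *\<^sub>R x) / t"
      using t0 by (metis abs_inverse abs_of_pos divide_inverse mult.commute norm_scaleR)
    also have "\<dots> \<le> 2 * \<rho>"
      unfolding pos_divide_le_eq[OF t0] using z * by linarith
    finally show ?thesis .
  qed
  finally show "norm (z /\<^sub>R norm z - x) \<le> 4 * \<rho>" by simp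
qed

text \<open>The cone over a cap of radius \<open>\<delta>\<close> contains about \<open>1 / \<delta>\<close> disjoint balls of radius
  \<open>\<delta> / 4\<close> centred on the axis; this gives the exponent \<open>DIM('a) - 1\<close>.\<close>
lemma sphere_cap_measure_ge:
  obtains c where "c > 0" "\<And>(x::'a::euclidean_space) \<delta>. norm x = 1 \<Longrightarrow> 0 < \<delta> \<Longrightarrow> \<delta> \<le> 1/2 \<Longrightarrow>
    c * \<delta> ^ (DIM('a) - 1) \<le> measure sphere_measure {z \<in> sphere 0 1. norm (z - x) \<le> \<delta>}"
proof
  let ?d = "DIM('a)"
  let ?V = "unit_ball_vol (real ?d)"
  \<comment> \<open>\<open>real ?d\<close> is the normalization of \<open>sphere_measure\<close>,
    \<open>?V * (\<delta> / 4) ^ ?d\<close> the volume of one ball, and at least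
    \<open>1 / (4 \<delta>)\<close> balls are used; their number cancels one power of
    \<open>\<delta>\<close>.\<close>
  define c where "c = real ?d * ?V * (1/4) ^ ?d / 4"
  show "c > 0" by (simp add: c_def)
  fix x :: 'a and \<delta> :: real
  assume x: "norm x = 1" and d: "0 < \<delta>" "\<delta> \<le> 1/2"
  \<comment> \<open>A point within \<open>\<rho>\<close> of one of the centres projects to within
    \<open>4 * \<rho>\<close> of \<open>x\<close>.\<close>
  define \<rho> where "\<rho> = \<delta> / 4"
  have rho: "\<rho> > 0" "\<rho> \<le> 1/8" using d by (auto simp: \<rho>_def)
  \<comment> \<open>The ceiling gives at least \<open>1 / (4 \<delta>)\<close> balls, while every
    index \<open>j < k\<close> is still below \<open>1 / (4 \<delta>)\<close>. With spacing
    \<open>2 * \<rho>\<close> the centres therefore stay between 1/2 and 3/4 on the axis, and the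
    balls inside the unit ball.\<close>
  define k where "k = nat \<lceil>1 / \<delta> / 4\<rceil>"
  have k: "1 / \<delta> / 4 \<le> real k" "real k < 1 / \<delta> / 4 + 1"
    using d by (auto simp: k_def) (smt (verit) ceiling_correct divide_nonneg_nonneg of_nat_nat ceiling_mono ceiling_zero)+
  define t where "t j = 1/2 + 2 * real j * \<rho>" for j
  have tb: "1/2 \<le> t j" "t j \<le> 3/4" if "j < k" for j
  proof -
    show "1/2 \<le> t j" using rho by (simp add: t_def)
    have "real j \<le> real k - 1" using that by linarith
    then have "real j \<le> 1 / \<delta> / 4" using k by linarith
    then have "real j * \<rho> \<le> 1 / \<delta> / 4 * \<rho>" using rho by (intro mult_right_mono) auto
    also have "\<dots> = 1 / 16" using d by (simp add: \<rho>_def)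
    finally show "t j \<le> 3/4" by (simp add: t_def)
  qed
  let ?C = "{z \<in> sphere 0 1. norm (z - x) \<le> \<delta>}"
  have C: "?C \<in> sets sphere_measure"
    by (auto simp: sets_sphere_measure_iff Collect_conj_eq intro!: borel_closed closed_Collect_le continuous_intros)
  have sub: "(\<Union>j<k. ball (t j *\<^sub>R x) \<rho>) \<subseteq> {z \<in> cball 0 1 - {0}. z /\<^sub>R norm z \<in> ?C}"
  proof (intro UN_least subsetI)
    fix j z assume "j \<in> {..<k}" and z: "z \<in> ball (t j *\<^sub>R x) \<rho>"
    then have j: "j < k" by simp
    have z: "norm (z - t j *\<^sub>R x) < \<rho>" using z by (simp add: dist_norm norm_minus_commute)
    have "norm z \<le> norm (t j *\<^sub>R x) + norm (z - t j *\<^sub>R x)" by (metis norm_triangle_sub)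
    also have "\<dots> \<le> 1" using z x tb[OF j] rho by simp
    finally have zc: "z \<in> cball 0 1" by simp
    have r4: "\<rho> \<le> 1/4" using rho by simp
    moreover have "norm (z /\<^sub>R norm z - x) \<le> \<delta>"
      using radial_projection_near(2)[OF x tb(1)[OF j] z r4] by (simp add: \<rho>_def)
    moreover have "z \<noteq> 0" by (rule radial_projection_near(1)[OF x tb(1)[OF j] z r4])
    moreover have "z /\<^sub>R norm z \<in> sphere 0 1" using \<open>z \<noteq> 0\<close> by simp
    ultimately show "z \<in> {z \<in> cball 0 1 - {0}. z /\<^sub>R norm z \<in> ?C}" using zc by blast
  qed
  have disj: "disjoint_family_on (\<lambda>j. ball (t j *\<^sub>R x) \<rho>) {..<k}"
  proof (unfold disjoint_family_on_def, intro ballI impI)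
    fix i j :: nat assume "i \<noteq> j"
    have "dist (t i *\<^sub>R x) (t j *\<^sub>R x) = \<bar>t i - t j\<bar>"
      by (metis dist_norm mult.right_neutral norm_scaleR scaleR_left_diff_distrib x)
    also have "t i - t j = 2 * \<rho> * (real i - real j)" by (simp add: t_def algebra_simps)
    also have "\<bar>\<dots>\<bar> = 2 * \<rho> * \<bar>real i - real j\<bar>" using rho by (simp add: abs_mult)
    also have "\<dots> \<ge> 2 * \<rho> * 1" using \<open>i \<noteq> j\<close> rho by (intro mult_left_mono) auto
    finally have "\<rho> + \<rho> \<le> dist (t i *\<^sub>R x) (t j *\<^sub>R x)" by simp
    then show "ball (t i *\<^sub>R x) \<rho> \<inter> ball (t j *\<^sub>R x) \<rho> = {}"
      by (rule disjoint_ballI)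
  qed
  have "ennreal (real k * (?V * \<rho> ^ ?d)) = (\<Sum>j<k. emeasure lborel (ball (t j *\<^sub>R x) \<rho>))"
    using rho by (simp add: emeasure_ball ennreal_of_nat_eq_real_of_nat ennreal_mult)
  also have "\<dots> = emeasure lborel (\<Union>j<k. ball (t j *\<^sub>R x) \<rho>)"
    by (rule sum_emeasure) (use disj in auto)
  also have "\<dots> \<le> emeasure lborel {z \<in> cball 0 1 - {0}. z /\<^sub>R norm z \<in> ?C}"
    by (rule emeasure_mono[OF sub]) (use sets_sphere_cone[OF C] in simp)
  finally have "ennreal (real ?d) * ennreal (real k * (?V * \<rho> ^ ?d)) \<le> emeasure sphere_measure ?C"
    unfolding emeasure_sphere_measure[OF C] by (rule mult_left_mono) simp
  then have le: "real ?d * (real k * (?V * \<rho> ^ ?d)) \<le> measure sphere_measure ?C"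
    using rho by (simp add: sphere.emeasure_eq_measure ennreal_mult[symmetric])
  have "c * \<delta> ^ (?d - 1) = real ?d * (1 / \<delta> / 4 * (?V * \<rho> ^ ?d))"
  proof -
    have "\<delta> ^ ?d = \<delta> * \<delta> ^ (?d - 1)" by (simp add: power_eq_if)
    then show ?thesis using d by (simp add: c_def \<rho>_def power_divide)
  qed
  also have "\<dots> \<le> real ?d * (real k * (?V * \<rho> ^ ?d))"
    using k rho by (intro mult_left_mono mult_right_mono) auto
  finally show "c * \<delta> ^ (?d - 1) \<le> measure sphere_measure ?C" using le by simp
qed

section \<open>Triangular arrays and negligible remainders\<close>

text \<open>Each of the \<open>n\<close> factors differs from \<open>1 - t\<^sup>2 / (2 n)\<close>
  by a third moment, and boundedness turns that moment into \<open>\<epsilon>\<close> times the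
  variance \<open>1 / n\<close>. Telescoping the difference of the \<open>n\<close>-th powers costs
  a factor \<open>n\<close>, which leaves a multiple of \<open>\<epsilon>\<close>.\<close>

lemma (in prob_space) char_sum_iid_bounded_le:
  fixes W :: "nat \<Rightarrow> 'a \<Rightarrow> real"
  assumes indep: "indep_vars (\<lambda>_. borel) W {..<n}"
    and W0 [measurable]: "random_variable borel V"
    and distr: "\<And>i. i < n \<Longrightarrow> distr M borel (W i) = distr M borel V"
    and mean: "expectation V = 0" and second: "expectation (\<lambda>\<omega>. (V \<omega>)\<^sup>2) = 1 / real n"
    and bound: "AE \<omega> in M. \<bar>V \<omega>\<bar> \<le> \<epsilon>"
    and n: "n > 0" "t\<^sup>2 \<le> 4 * real n"
  shows "cmod (char (distr M borel (\<lambda>\<omega>. \<Sum>i<n. W i \<omega>)) t - (1 + (- (t\<^sup>2) / 2) / real n) ^ n)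
     \<le> \<bar>t\<bar> ^ 3 / 6 * \<epsilon>"
proof -
  define \<phi> where "\<phi> = char (distr M borel V) t"
  interpret V: real_distribution "distr M borel V" by (rule real_distribution_distr) simp
  have int1 [simp]: "integrable M V" by (rule integrable_const_bound[OF bound[folded real_norm_def]]) simp
  have "AE \<omega> in M. norm ((V \<omega>)\<^sup>2) \<le> \<epsilon>\<^sup>2"
    using bound by eventually_elim (metis abs_ge_zero norm_power power_mono real_norm_def)
  then have int2 [simp]: "integrable M (\<lambda>\<omega>. (V \<omega>)\<^sup>2)" by (rule integrable_const_bound) simp
  have intm: "integrable M (\<lambda>\<omega>. min (6 * (V \<omega>)\<^sup>2) (\<bar>t\<bar> * \<bar>V \<omega>\<bar> ^ 3))"
    by (rule Bochner_Integration.integrable_bound[of _ "\<lambda>\<omega>. 6 * (V \<omega>)\<^sup>2"]) auto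
  have "expectation (\<lambda>\<omega>. min (6 * (V \<omega>)\<^sup>2) (\<bar>t\<bar> * \<bar>V \<omega>\<bar> ^ 3)) \<le> expectation (\<lambda>\<omega>. \<bar>t\<bar> * \<epsilon> * (V \<omega>)\<^sup>2)"
  proof (rule integral_mono_AE[OF intm])
    show "AE \<omega> in M. min (6 * (V \<omega>)\<^sup>2) (\<bar>t\<bar> * \<bar>V \<omega>\<bar> ^ 3) \<le> \<bar>t\<bar> * \<epsilon> * (V \<omega>)\<^sup>2"
      using bound
    proof eventually_elim
      case (elim \<omega>)
      have "\<bar>V \<omega>\<bar> ^ 3 = \<bar>V \<omega>\<bar> * (V \<omega>)\<^sup>2" by (simp add: power3_eq_cube power2_eq_square)
      also have "\<dots> \<le> \<epsilon> * (V \<omega>)\<^sup>2" using elim by (intro mult_right_mono) auto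
      finally have "\<bar>t\<bar> * \<bar>V \<omega>\<bar> ^ 3 \<le> \<bar>t\<bar> * (\<epsilon> * (V \<omega>)\<^sup>2)" by (intro mult_left_mono) auto
      then show ?case by (simp add: mult.assoc)
    qed
  qed simp
  also have "\<dots> = \<bar>t\<bar> * \<epsilon> / n" using second by simp
  finally have m: "expectation (\<lambda>\<omega>. min (6 * (V \<omega>)\<^sup>2) (\<bar>t\<bar> * \<bar>V \<omega>\<bar> ^ 3)) \<le> \<bar>t\<bar> * \<epsilon> / n" .
  have "cmod (\<phi> - (1 - t\<^sup>2 * (1 / real n) / 2))
     \<le> t\<^sup>2 / 6 * expectation (\<lambda>\<omega>. min (6 * (V \<omega>)\<^sup>2) (\<bar>t\<bar> * \<bar>V \<omega>\<bar> ^ 3))"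
    using char_approx3'[OF W0 int1 int2 mean _ refl, of "1 / real n" t] mean second
    by (simp add: \<phi>_def)
  also have "\<dots> \<le> t\<^sup>2 / 6 * (\<bar>t\<bar> * \<epsilon> / n)" using m by (intro mult_left_mono) auto
  finally have d: "cmod (\<phi> - (1 + (- (t\<^sup>2) / 2) / real n)) \<le> t\<^sup>2 / 6 * (\<bar>t\<bar> * \<epsilon> / n)"
    by (simp add: field_simps)
  have "char (distr M borel (\<lambda>\<omega>. \<Sum>i<n. W i \<omega>)) t = (\<Prod>i<n. char (distr M borel (W i)) t)"
    by (rule char_distr_sum[OF indep])
  also have "\<dots> = \<phi> ^ n" by (simp add: distr \<phi>_def)
  finally have c: "char (distr M borel (\<lambda>\<omega>. \<Sum>i<n. W i \<omega>)) t = \<phi> ^ n" .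
  have "cmod (\<phi> ^ n - (complex_of_real (1 + (- (t\<^sup>2) / 2) / real n)) ^ n)
     \<le> n * cmod (\<phi> - complex_of_real (1 + (- (t\<^sup>2) / 2) / real n))"
  proof (rule norm_power_diff)
    show "cmod \<phi> \<le> 1" unfolding \<phi>_def by (rule V.cmod_char_le_1)
    \<comment> \<open>\<open>norm_power_diff\<close> asks for both bases in the unit disc, hence
      \<open>t\<^sup>2 \<le> 4 n\<close>.\<close>
    have "\<bar>1 + (- (t\<^sup>2) / 2) / real n\<bar> \<le> 1" using n by (auto simp: abs_le_iff field_simps)
    then show "cmod (complex_of_real (1 + (- (t\<^sup>2) / 2) / real n)) \<le> 1" by (simp only: norm_of_real)
  qed
  also have "\<dots> \<le> n * (t\<^sup>2 / 6 * (\<bar>t\<bar> * \<epsilon> / n))"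
    using d by (intro mult_left_mono) auto
  also have "\<dots> = \<bar>t\<bar> ^ 3 / 6 * \<epsilon>" using n by (simp add: power3_eq_cube power2_eq_square abs_mult[symmetric])
  finally show ?thesis by (simp add: c)
qed

text \<open>One i.i.d. sequence \<open>D\<close> serves all rows; only the function
  \<open>g n\<close> changes from row to row. A standardized summand is bounded by
  \<open>2 b n / (sqrt n * s n)\<close>, the factor 2 coming from the mean, so this single ratio
  takes the place of a Lyapunov sum.\<close>

lemma (in prob_space) triangular_clt_char:
  fixes D :: "nat \<Rightarrow> 'a \<Rightarrow> 'b" and g :: "nat \<Rightarrow> 'b \<Rightarrow> real"
  assumes indep: "indep_vars (\<lambda>_. S) D UNIV"
    and D0 [measurable]: "random_variable S D0"
    and distr: "\<And>i. distr M S (D i) = distr M S D0"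
    and g [measurable]: "\<And>n. g n \<in> borel_measurable S"
    and bound: "\<forall>\<^sub>F n in sequentially. AE \<omega> in M. \<bar>g n (D0 \<omega>)\<bar> \<le> b n"
    and s: "\<And>n. s n = sqrt (variance (\<lambda>\<omega>. g n (D0 \<omega>)))" "\<forall>\<^sub>F n in sequentially. s n > 0"
    and small: "(\<lambda>n. b n / (sqrt (real n) * s n)) \<longlonglongrightarrow> 0"
  shows "(\<lambda>n. char (distr M borel (\<lambda>\<omega>. \<Sum>i<n. (g n (D i \<omega>) - expectation (\<lambda>\<omega>. g n (D0 \<omega>))) / (sqrt (real n) * s n))) t)
     \<longlonglongrightarrow> complex_of_real (exp (- (t\<^sup>2) / 2))"
proof -
  define m where "m n = expectation (\<lambda>\<omega>. g n (D0 \<omega>))" for n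
  define h where "h n z = (g n z - m n) / (sqrt (real n) * s n)" for n z
  have D [measurable]: "random_variable S (D i)" for i
    using indep unfolding indep_vars_def2 by simp
  have h [measurable]: "h n \<in> borel_measurable S" for n unfolding h_def[abs_def] by measurable
  have ev: "\<forall>\<^sub>F n in sequentially. cmod (char (distr M borel (\<lambda>\<omega>. \<Sum>i<n. h n (D i \<omega>))) t
      - (1 + (- (t\<^sup>2) / 2) / real n) ^ n) \<le> \<bar>t\<bar> ^ 3 / 6 * (2 * (b n / (sqrt (real n) * s n)))"
    using bound s(2) eventually_gt_at_top[of "0::nat"] eventually_ge_at_top[of "nat \<lceil>t\<^sup>2 / 4\<rceil>"]
  proof eventually_elim
    case (elim n)
    have pos: "sqrt (real n) * s n > 0" using elim by simp
    have int [simp]: "integrable M (\<lambda>\<omega>. g n (D0 \<omega>))"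
      by (rule integrable_const_bound[OF elim(1)[folded real_norm_def]]) simp
    have mb: "\<bar>m n\<bar> \<le> b n"
    proof -
      have "\<bar>m n\<bar> \<le> expectation (\<lambda>\<omega>. \<bar>g n (D0 \<omega>)\<bar>)" unfolding m_def by (rule integral_abs_bound)
      also have "\<dots> \<le> expectation (\<lambda>\<omega>. b n)" using elim(1) by (intro integral_mono_AE) auto
      finally show ?thesis by (simp add: prob_space)
    qed
    show ?case
    proof (rule char_sum_iid_bounded_le[where V="\<lambda>\<omega>. h n (D0 \<omega>)"])
      show "indep_vars (\<lambda>_. borel) (\<lambda>i \<omega>. h n (D i \<omega>)) {..<n}"
        by (rule indep_vars_compose2[OF indep_vars_subset[OF indep]]) auto
      show "distr M borel (\<lambda>\<omega>. h n (D i \<omega>)) = distr M borel (\<lambda>\<omega>. h n (D0 \<omega>))" for i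
        using distr_distr[OF h D, of i n] distr_distr[OF h D0, of n] distr[of i]
        by (simp add: comp_def)
      show "expectation (\<lambda>\<omega>. h n (D0 \<omega>)) = 0"
        unfolding h_def by (simp add: m_def prob_space)
      have "expectation (\<lambda>\<omega>. (h n (D0 \<omega>))\<^sup>2)
          = expectation (\<lambda>\<omega>. (g n (D0 \<omega>) - m n)\<^sup>2) / (real n * (s n)\<^sup>2)"
        unfolding h_def power_divide power_mult_distrib by simp
      also have "expectation (\<lambda>\<omega>. (g n (D0 \<omega>) - m n)\<^sup>2) = (s n)\<^sup>2"
        unfolding s(1) m_def by (rule real_sqrt_pow2[symmetric]) simp
      finally show "expectation (\<lambda>\<omega>. (h n (D0 \<omega>))\<^sup>2) = 1 / real n"
        using elim(2,3) by simp
      show "AE \<omega> in M. \<bar>h n (D0 \<omega>)\<bar> \<le> 2 * (b n / (sqrt (real n) * s n))"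
        using elim(1)
      proof eventually_elim
        case (elim \<omega>)
        have "\<bar>g n (D0 \<omega>) - m n\<bar> \<le> 2 * b n" using elim mb by linarith
        then show ?case using pos
          by (simp add: h_def abs_divide divide_right_mono abs_of_pos del: mult_pos_pos)
      qed
      show "t\<^sup>2 \<le> 4 * real n" using elim(4) by linarith
    qed (use elim in simp_all)
  qed
  have lim0: "(\<lambda>n. \<bar>t\<bar> ^ 3 / 6 * (2 * (b n / (sqrt (real n) * s n)))) \<longlonglongrightarrow> 0"
    by (intro tendsto_mult_right_zero small)
  have "(\<lambda>n. complex_of_real ((1 + (-(t^2) / 2) / n)^n)) \<longlonglongrightarrow> complex_of_real (exp (-(t^2) / 2))"
    by (rule isCont_tendsto_compose [OF _ tendsto_exp_limit_sequentially]) auto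
  then have "(\<lambda>n. char (distr M borel (\<lambda>\<omega>. \<Sum>i<n. h n (D i \<omega>))) t) \<longlonglongrightarrow> complex_of_real (exp (- (t\<^sup>2) / 2))"
    by (rule Lim_transform) (rule Lim_null_comparison [OF _ lim0], use ev in simp)
  then show ?thesis by (simp add: h_def m_def)
qed

text \<open>\<open>\<bar>exp (i t B) - 1\<bar>\<close> is at most
  \<open>\<bar>t\<bar> \<bar>B\<bar>\<close> and at most 2; the first bound is used where
  \<open>\<bar>B\<bar> \<le> \<epsilon>\<close>, the second on the rare event. Working with
  characteristic functions postpones distribution functions to a single use of Levy's
  theorem.\<close>

lemma (in prob_space) slutsky_char:
  fixes A B :: "nat \<Rightarrow> 'a \<Rightarrow> real"
  assumes A [measurable]: "\<And>n. random_variable borel (A n)"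
    and B [measurable]: "\<And>n. random_variable borel (B n)"
    and lim: "(\<lambda>n. char (distr M borel (A n)) t) \<longlonglongrightarrow> l"
    and op: "o_p1 M B"
  shows "(\<lambda>n. char (distr M borel (\<lambda>\<omega>. A n \<omega> + B n \<omega>)) t) \<longlonglongrightarrow> l"
proof -
  have bd: "cmod (char (distr M borel (\<lambda>\<omega>. A n \<omega> + B n \<omega>)) t - char (distr M borel (A n)) t)
      \<le> \<bar>t\<bar> * \<epsilon> + 2 * measure M {\<omega> \<in> space M. \<bar>B n \<omega>\<bar> > \<epsilon>}" if "\<epsilon> > 0" for n \<epsilon>
  proof -
    let ?E = "{\<omega> \<in> space M. \<bar>B n \<omega>\<bar> > \<epsilon>}"
    have E [measurable]: "?E \<in> sets M" by measurable
    have i1: "integrable M (\<lambda>\<omega>. iexp (t * (A n \<omega> + B n \<omega>)))" "integrable M (\<lambda>\<omega>. iexp (t * A n \<omega>))"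
      by (auto intro!: integrable_const_bound[of _ 1])
    have i2: "integrable M (\<lambda>\<omega>. \<bar>t\<bar> * \<epsilon> + 2 * indicat_real ?E \<omega>)"
      by (intro Bochner_Integration.integrable_add integrable_mult_right integrable_real_indicator)
        (auto simp: less_top[symmetric])
    have "char (distr M borel (\<lambda>\<omega>. A n \<omega> + B n \<omega>)) t - char (distr M borel (A n)) t
        = expectation (\<lambda>\<omega>. iexp (t * (A n \<omega> + B n \<omega>)) - iexp (t * A n \<omega>))"
      unfolding char_def by (subst (1 2) integral_distr) (use i1 in \<open>auto simp del: of_real_add of_real_mult\<close>)
    also have "cmod \<dots> \<le> expectation (\<lambda>\<omega>. cmod (iexp (t * (A n \<omega> + B n \<omega>)) - iexp (t * A n \<omega>)))"
      by (rule integral_norm_bound)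
    also have "\<dots> \<le> expectation (\<lambda>\<omega>. \<bar>t\<bar> * \<epsilon> + 2 * indicat_real ?E \<omega>)"
    proof (rule integral_mono)
      fix \<omega> assume \<omega>: "\<omega> \<in> space M"
      have "iexp (t * (A n \<omega> + B n \<omega>)) - iexp (t * A n \<omega>) = iexp (t * A n \<omega>) * (iexp (t * B n \<omega>) - 1)"
        by (simp add: algebra_simps exp_add[symmetric])
      then have eq: "cmod (iexp (t * (A n \<omega> + B n \<omega>)) - iexp (t * A n \<omega>)) = cmod (iexp (t * B n \<omega>) - 1)"
        by (simp only: norm_mult norm_exp_i_times)
      have "cmod (iexp (t * B n \<omega>) - 1) \<le> \<bar>t * B n \<omega>\<bar>"
        using iexp_approx1[of "t * B n \<omega>" 0] by simp
      moreover have "cmod (iexp (t * B n \<omega>) - 1) \<le> 2"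
        using iexp_approx2[of "t * B n \<omega>" 0] by simp
      moreover have "\<bar>t * B n \<omega>\<bar> \<le> \<bar>t\<bar> * \<epsilon>" if "\<omega> \<notin> ?E"
        using that \<omega> by (auto simp: abs_mult intro!: mult_left_mono)
      moreover have "\<bar>t\<bar> * \<epsilon> \<ge> 0" using \<open>\<epsilon> > 0\<close> by simp
      ultimately show "cmod (iexp (t * (A n \<omega> + B n \<omega>)) - iexp (t * A n \<omega>)) \<le> \<bar>t\<bar> * \<epsilon> + 2 * indicat_real ?E \<omega>"
        unfolding eq by (cases "\<omega> \<in> ?E") (simp_all add: indicator_def)
    qed (use i1 i2 in \<open>auto simp del: of_real_add of_real_mult\<close>)
    also have "\<dots> = \<bar>t\<bar> * \<epsilon> + 2 * measure M ?E"
    proof -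
      have "integrable M (\<lambda>\<omega>. 2 * indicat_real ?E \<omega>)"
        by (intro integrable_mult_right integrable_real_indicator) (auto simp: less_top[symmetric])
      then show ?thesis
        by (subst Bochner_Integration.integral_add) (simp_all add: prob_space)
    qed
    finally show ?thesis .
  qed
  have "(\<lambda>n. char (distr M borel (\<lambda>\<omega>. A n \<omega> + B n \<omega>)) t - char (distr M borel (A n)) t) \<longlonglongrightarrow> 0"
  proof (rule tendstoI)
    fix r :: real assume r: "r > 0"
    \<comment> \<open>This makes the first term at most \<open>r / 2\<close>, the added 1 covering
      \<open>t = 0\<close>. The tail probability, below \<open>r / 4\<close>, is counted
      twice.\<close>
    define \<epsilon> where "\<epsilon> = r / (2 * (\<bar>t\<bar> + 1))"
    have e: "\<epsilon> > 0" using r by (simp add: \<epsilon>_def)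
    have te: "\<bar>t\<bar> * \<epsilon> \<le> r / 2" using r by (simp add: \<epsilon>_def field_simps)
    have "\<forall>\<^sub>F n in sequentially. measure M {\<omega> \<in> space M. \<bar>B n \<omega>\<bar> > \<epsilon>} < r / 4"
      using op e r by (intro order_tendstoD(2)[where y=0]) (auto simp: o_p1_def)
    then show "\<forall>\<^sub>F n in sequentially. dist (char (distr M borel (\<lambda>\<omega>. A n \<omega> + B n \<omega>)) t - char (distr M borel (A n)) t) 0 < r"
    proof eventually_elim
      case (elim n)
      then show ?case using bd[OF e, of n] te by simp
    qed
  qed
  from tendsto_add[OF this lim] show ?thesis by simp
qed

text \<open>Once \<open>b n < \<epsilon> / 2\<close>, a value of \<open>\<bar>B n\<bar>\<close>
  above \<open>\<epsilon>\<close> forces \<open>\<bar>A n\<bar>\<close> above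
  \<open>\<epsilon> / 2\<close>. Random and deterministic errors can thus be bounded together
  pointwise.\<close>

lemma o_p1_add:
  assumes [measurable]: "\<And>n. A n \<in> borel_measurable M" "\<And>n. B n \<in> borel_measurable M"
    and "prob_space M" "o_p1 M A" "b \<longlonglongrightarrow> 0"
    and le: "\<forall>\<^sub>F n in sequentially. \<forall>\<omega>\<in>space M. \<bar>B n \<omega>\<bar> \<le> \<bar>A n \<omega>\<bar> + b n"
  shows "o_p1 M B"
  unfolding o_p1_def
proof (intro allI impI)
  interpret prob_space M by fact
  fix \<epsilon> :: real assume e: "\<epsilon> > 0"
  show "(\<lambda>N. prob {\<omega> \<in> space M. \<epsilon> < \<bar>B N \<omega>\<bar>}) \<longlonglongrightarrow> 0"
  proof (rule tendsto_sandwich[of "\<lambda>_. 0"])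
    have "\<forall>\<^sub>F n in sequentially. b n < \<epsilon> / 2" using assms(5) e by (intro order_tendstoD(2)[where y=0]) auto
    then show "\<forall>\<^sub>F n in sequentially. prob {\<omega> \<in> space M. \<epsilon> < \<bar>B n \<omega>\<bar>} \<le> prob {\<omega> \<in> space M. \<epsilon> / 2 < \<bar>A n \<omega>\<bar>}"
      using le
    proof eventually_elim
      case (elim n)
      show ?case
      proof (rule finite_measure_mono)
        show "{\<omega> \<in> space M. \<epsilon> < \<bar>B n \<omega>\<bar>} \<subseteq> {\<omega> \<in> space M. \<epsilon> / 2 < \<bar>A n \<omega>\<bar>}"
          using elim by force
      qed measurable
    qed
    show "(\<lambda>n. prob {\<omega> \<in> space M. \<epsilon> / 2 < \<bar>A n \<omega>\<bar>}) \<longlonglongrightarrow> 0"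
      using assms(4)[unfolded o_p1_def, rule_format, of "\<epsilon> / 2"] e by simp
  qed auto
qed

text \<open>By Markov's inequality a bounded mean makes \<open>V\<close> tight:
  \<open>\<bar>A n * V n\<bar> > \<epsilon>\<close> requires \<open>V n \<ge> c\<close> or
  \<open>\<bar>A n\<bar> > \<epsilon> / c\<close>, and \<open>c\<close> is fixed before
  \<open>n\<close> grows.\<close>

lemma o_p1_mult_bounded:
  assumes A [measurable]: "\<And>n. A n \<in> borel_measurable M"
    and P: "prob_space M" and op: "o_p1 M A"
    and int: "\<forall>\<^sub>F n in sequentially. integrable M (V n)" and V0: "\<And>n \<omega>. V n \<omega> \<ge> 0"
    and E: "\<forall>\<^sub>F n in sequentially. (\<integral>\<omega>. V n \<omega> \<partial>M) \<le> K"
  shows "o_p1 M (\<lambda>n \<omega>. A n \<omega> * V n \<omega>)"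
  unfolding o_p1_def
proof (intro allI impI tendstoI)
  interpret prob_space M by fact
  fix \<epsilon> \<delta> :: real assume e: "\<epsilon> > 0" and d: "\<delta> > 0"
  \<comment> \<open>Chosen for \<open>K / c \<le> \<delta> / 2\<close>;
    \<open>\<bar>K\<bar> + 1\<close> keeps it positive whatever the sign of
    \<open>K\<close>.\<close>
  define c where "c = 2 * (\<bar>K\<bar> + 1) / \<delta>"
  have c: "c > 0" using d by (simp add: c_def)
  have "K * \<delta> \<le> (\<bar>K\<bar> + 1) * \<delta>" using d by (intro mult_right_mono) auto
  then have Kc: "K / c \<le> \<delta> / 2" using d by (simp add: c_def divide_le_eq)
  have "\<forall>\<^sub>F n in sequentially. prob {\<omega> \<in> space M. \<epsilon> / c < \<bar>A n \<omega>\<bar>} < \<delta> / 2"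
    using op[unfolded o_p1_def, rule_format, of "\<epsilon> / c"] e c d by (intro order_tendstoD(2)[where y=0]) auto
  then show "\<forall>\<^sub>F n in sequentially. dist (prob {\<omega> \<in> space M. \<epsilon> < \<bar>A n \<omega> * V n \<omega>\<bar>}) 0 < \<delta>"
    using int E
  proof eventually_elim
    case (elim n)
    have [measurable]: "V n \<in> borel_measurable M" using elim by auto
    have "prob {\<omega> \<in> space M. V n \<omega> \<ge> c} \<le> (\<integral>\<omega>. V n \<omega> \<partial>M) / c"
      by (rule integral_Markov_inequality_measure[OF elim(2), where A="{}"]) (use V0 c in auto)
    also have "\<dots> \<le> K / c" using elim c by (simp add: divide_right_mono)
    finally have V: "prob {\<omega> \<in> space M. V n \<omega> \<ge> c} \<le> \<delta> / 2" using Kc by linarith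
    have "prob {\<omega> \<in> space M. \<epsilon> < \<bar>A n \<omega> * V n \<omega>\<bar>}
        \<le> prob ({\<omega> \<in> space M. \<epsilon> / c < \<bar>A n \<omega>\<bar>} \<union> {\<omega> \<in> space M. V n \<omega> \<ge> c})"
    proof (rule finite_measure_mono)
      show "{\<omega> \<in> space M. \<epsilon> < \<bar>A n \<omega> * V n \<omega>\<bar>}
         \<subseteq> {\<omega> \<in> space M. \<epsilon> / c < \<bar>A n \<omega>\<bar>} \<union> {\<omega> \<in> space M. V n \<omega> \<ge> c}"
      proof safe
        fix \<omega> assume *: "\<epsilon> < \<bar>A n \<omega> * V n \<omega>\<bar>" "\<not> c \<le> V n \<omega>"
        have "\<bar>A n \<omega> * V n \<omega>\<bar> \<le> \<bar>A n \<omega>\<bar> * c"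
          using V0[of n \<omega>] *(2) by (auto simp: abs_mult intro!: mult_left_mono)
        then show "\<epsilon> / c < \<bar>A n \<omega>\<bar>" using *(1) c by (simp add: divide_less_eq)
      qed
    qed measurable
    also have "\<dots> \<le> prob {\<omega> \<in> space M. \<epsilon> / c < \<bar>A n \<omega>\<bar>} + prob {\<omega> \<in> space M. V n \<omega> \<ge> c}"
      by (rule measure_Un_le) measurable
    finally show ?case using V elim(1) by simp
  qed
qed

section \<open>The kernels\<close>

lemma sphere_area_pos: "d \<ge> 1 \<Longrightarrow> sphere_area d > 0"
  by (simp add: sphere_area_def Gamma_real_pos)

text \<open>With \<open>d = k + 2\<close> no truncated subtraction is left. The fraction lies
  between 1 and 2, so the dimension has the order \<open>n ^ k\<close> of the binomial coefficient,
  as \<open>hdim_le\<close> and \<open>hdim_ge\<close> make precise.\<close>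

lemma hdim_eq_binomial:
  assumes "n \<ge> 1"
  shows "hdim n (k + 2) = (2 * real n + real k) / (real n + real k) * real ((n + k) choose k)"
proof -
  have "real ((n + k) choose k) = fact (n + k) / (fact k * fact n)"
    using binomial_fact[of k "n + k", where 'a=real] by simp
  then show ?thesis using assms by (simp add: hdim_def mult.commute)
qed

lemma hdim_le: "n \<ge> 1 \<Longrightarrow> hdim n (k + 2) \<le> 2 * (real k + 1) ^ k * real n ^ k"
proof -
  assume n: "n \<ge> 1"
  have "real ((n + k) choose k) \<le> real ((n + k) ^ k)"
    using binomial_le_pow[of k "n + k"] by (simp only: of_nat_le_iff)
  also have "\<dots> \<le> ((real k + 1) * real n) ^ k"
    unfolding of_nat_power using n mult_left_mono[of 1 "real n" "real k"]
    by (intro power_mono) (auto simp: algebra_simps)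
  finally have "real ((n + k) choose k) \<le> ((real k + 1) * real n) ^ k" .
  moreover have "(2 * real n + real k) / (real n + real k) \<le> 2" using n by (simp add: divide_le_eq)
  ultimately have "hdim n (k + 2) \<le> 2 * ((real k + 1) * real n) ^ k"
    unfolding hdim_eq_binomial[OF n] by (intro mult_mono) auto
  then show ?thesis by (simp add: power_mult_distrib)
qed

lemma hdim_ge: "n \<ge> 1 \<Longrightarrow> hdim n (k + 2) \<ge> (real n / real (k + 1)) ^ k"
proof -
  assume n: "n \<ge> 1"
  \<comment> \<open>The circle, \<open>k = 0\<close>, is separate: division by zero yields 0, and
    the power 0 makes both sides 1.\<close>
  have "(real n / real (k + 1)) ^ k \<le> (real (n + k) / real k) ^ k"
    by (cases "k = 0") (auto intro!: power_mono frac_le)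
  also have "\<dots> \<le> real ((n + k) choose k)" by (rule binomial_ge_n_over_k_pow_k) simp
  finally have "(real n / real (k + 1)) ^ k \<le> real ((n + k) choose k)" .
  moreover have "1 \<le> (2 * real n + real k) / (real n + real k)" using n by (simp add: le_divide_eq)
  ultimately have "1 * (real n / real (k + 1)) ^ k \<le> (2 * real n + real k) / (real n + real k) * real ((n + k) choose k)"
    by (intro mult_mono) auto
  then show ?thesis unfolding hdim_eq_binomial[OF n] by simp
qed

lemma hdim_nonneg: "hdim n d \<ge> 0"
  by (simp add: hdim_def)

text \<open>\<open>hdim n d / sphere_area d\<close> is the value of the kernel on the diagonal, so
  these are the Gegenbauer estimates at \<open>x \<bullet> y\<close> relative to the value at
  1.\<close>

lemma qker_bounds:
  fixes x y :: "'a::euclidean_space"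
  assumes d: "DIM('a) \<ge> 2" and xy: "norm x = 1" "norm y = 1"
  shows "\<bar>qker n x y\<bar> \<le> hdim n DIM('a) / sphere_area DIM('a)"
    and "hdim n DIM('a) / sphere_area DIM('a) * (1 - (real n)\<^sup>2 * (1 - x \<bullet> y)) \<le> qker n x y"
    and "qker n (- x) y = (-1) ^ n * qker n x y"
proof -
  let ?v = "nu DIM('a)" and ?h = "hdim n DIM('a) / sphere_area DIM('a)"
  have v: "?v \<ge> 0" using d by (simp add: nu_def)
  have t: "\<bar>x \<bullet> y\<bar> \<le> 1" using Cauchy_Schwarz_ineq2[of x y] xy by simp
  have h: "?h \<ge> 0" using sphere_area_pos[of "DIM('a)"] d hdim_nonneg by (simp add: divide_nonneg_pos)
  have g: "gegenbauer ?v n 1 > 0" by (rule gegenbauer_one_pos[OF v t])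
  have q: "qker n x y = ?h * (gegenbauer ?v n (x \<bullet> y) / gegenbauer ?v n 1)"
    by (simp add: qker_def)
  have "\<bar>gegenbauer ?v n (x \<bullet> y) / gegenbauer ?v n 1\<bar> \<le> 1"
    using abs_gegenbauer_le[OF v t, of n] g by (simp add: abs_divide)
  then show "\<bar>qker n x y\<bar> \<le> ?h" unfolding q using h
    by (simp add: abs_mult mult_left_le abs_of_nonneg del: abs_divide times_divide_eq_left times_divide_eq_right)
  have "1 - (real n)\<^sup>2 * (1 - x \<bullet> y) \<le> gegenbauer ?v n (x \<bullet> y) / gegenbauer ?v n 1"
    using gegenbauer_ge[OF v t, of n] g by (simp add: le_divide_eq mult.commute)
  then show "?h * (1 - (real n)\<^sup>2 * (1 - x \<bullet> y)) \<le> qker n x y"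
    unfolding q using h by (rule mult_left_mono)
  show "qker n (- x) y = (-1) ^ n * qker n x y"
    using gegenbauer_minus[OF t, of ?v n] by (simp add: qker_def)
qed

lemma qker_commute: "qker n x y = qker n y x"
  by (simp add: qker_def inner_commute)

lemma Kker_commute: "Kker wt T x y = Kker wt T y x"
  by (simp add: Kker_def qker_commute[of _ x])

lemma Kodd_commute: "Kodd wt T x y = Kodd wt T y x"
  by (simp add: Kodd_def qker_commute[of _ x])

lemma qker_minus_minus: "qker n (- x) y = qker n x (- y)"
  by (simp add: qker_def)

lemma Kker_minus_minus: "Kker wt T (- x) y = Kker wt T x (- y)"
  by (simp add: Kker_def qker_minus_minus)

lemma continuous_on_qker:
  fixes y :: "'a::euclidean_space"
  assumes "norm y = 1"
  shows "continuous_on (sphere 0 1) (\<lambda>x. qker n x y)"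
proof -
  have "(\<lambda>x. x \<bullet> y) ` sphere 0 1 \<subseteq> {-1..1}"
  proof (clarsimp simp: abs_le_iff[symmetric])
    fix x :: 'a assume "norm x = 1"
    then show "- 1 \<le> x \<bullet> y \<and> x \<bullet> y \<le> 1"
      using Cauchy_Schwarz_ineq2[of x y] assms by (auto simp: abs_le_iff)
  qed
  then have "continuous_on (sphere 0 1) (\<lambda>x. gegenbauer v n (x \<bullet> y))" for v
    by (intro continuous_on_compose2[OF continuous_on_gegenbauer] continuous_intros)
  then show ?thesis unfolding qker_def divide_inverse by (intro continuous_intros)
qed

lemma
  fixes y :: "'a::euclidean_space"
  assumes "norm y = 1"
  shows borel_measurable_qker: "(\<lambda>x. qker n x y) \<in> borel_measurable sphere_measure"
    and borel_measurable_Kker: "(\<lambda>x. Kker wt T x y) \<in> borel_measurable sphere_measure"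
    and borel_measurable_Kodd: "(\<lambda>x. Kodd wt T x y) \<in> borel_measurable sphere_measure"
  unfolding Kker_def Kodd_def
  by (intro measurable_sphere_continuous continuous_intros continuous_on_qker assms)+

lemma abs_Kker_le:
  fixes x y :: "'a::euclidean_space"
  assumes "DIM('a) \<ge> 2" "norm x = 1" "norm y = 1"
  shows "\<bar>Kker wt T x y\<bar> \<le> (\<Sum>n = 0..T. \<bar>wt n T\<bar> * (hdim n DIM('a) / sphere_area DIM('a)))"
  unfolding Kker_def
proof (rule order_trans[OF sum_abs], rule sum_mono)
  show "\<bar>wt n T * qker n x y\<bar> \<le> \<bar>wt n T\<bar> * (hdim n DIM('a) / sphere_area DIM('a))" for n
    unfolding abs_mult by (intro mult_left_mono qker_bounds(1) assms) auto
qed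

text \<open>This is \<open>Kodd wt T x x\<close> for every unit vector \<open>x\<close>. The
  dimension is an argument and not read off a type, so that it can be written as
  \<open>k + 2\<close>.\<close>

definition Kodd_diag :: "(nat \<Rightarrow> nat \<Rightarrow> real) \<Rightarrow> nat \<Rightarrow> nat \<Rightarrow> real" where
  "Kodd_diag wt T d = (\<Sum>p<T. wt (2 * p + 1) (2 * T) * (hdim (2 * p + 1) d / sphere_area d))"

lemma abs_Kodd_le:
  fixes x y :: "'a::euclidean_space"
  assumes "DIM('a) \<ge> 2" "norm x = 1" "norm y = 1" and wt: "\<And>n T. wt n T \<ge> 0"
  shows "\<bar>Kodd wt T x y\<bar> \<le> Kodd_diag wt T DIM('a)"
  unfolding Kodd_def Kodd_diag_def
proof (rule order_trans[OF sum_abs], rule sum_mono)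
  show "\<bar>wt (2 * p + 1) (2 * T) * qker (2 * p + 1) x y\<bar>
      \<le> wt (2 * p + 1) (2 * T) * (hdim (2 * p + 1) DIM('a) / sphere_area DIM('a))" for p
    unfolding abs_mult abs_of_nonneg[OF wt] by (intro mult_left_mono qker_bounds(1) assms)
qed

text \<open>Only degrees below \<open>2 T\<close> occur, and \<open>1 - x \<bullet> y\<close> is
  half the squared distance, hence at most \<open>1 / (8 T\<^sup>2)\<close>. The loss
  \<open>n\<^sup>2 (1 - x \<bullet> y)\<close> is thus at most 1/2 in every degree, and nonnegative
  weights keep this in the sum.\<close>

lemma Kodd_ge_half_diag:
  fixes x y :: "'a::euclidean_space"
  assumes d: "DIM('a) \<ge> 2" and xy: "norm x = 1" "norm y = 1" and wt: "\<And>n T. wt n T \<ge> 0"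
    and near: "norm (x - y) \<le> 1 / (2 * real T)"
  shows "Kodd wt T x y \<ge> Kodd_diag wt T DIM('a) / 2"
  unfolding Kodd_def Kodd_diag_def sum_divide_distrib
proof (rule sum_mono)
  fix p assume p: "p \<in> {..<T}"
  let ?h = "hdim (2 * p + 1) DIM('a) / sphere_area DIM('a)"
  have h: "?h \<ge> 0" using sphere_area_pos[of "DIM('a)"] d hdim_nonneg by (simp add: divide_nonneg_pos)
  have T: "real T > 0" using p by simp
  have "1 - x \<bullet> y = (norm (x - y))\<^sup>2 / 2"
    using xy by (simp add: power2_norm_eq_inner inner_diff inner_commute norm_eq_1)
  also have "\<dots> \<le> (1 / (2 * real T))\<^sup>2 / 2" using near by (intro divide_right_mono power_mono) auto
  finally have "(real (2 * p + 1))\<^sup>2 * (1 - x \<bullet> y) \<le> (2 * real T)\<^sup>2 * ((1 / (2 * real T))\<^sup>2 / 2)"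
    using p Cauchy_Schwarz_ineq2[of x y] xy by (intro mult_mono power_mono) auto
  also have "\<dots> = 1 / 2" using T by (simp add: power2_eq_square)
  finally have "1 / 2 \<le> 1 - (real (2 * p + 1))\<^sup>2 * (1 - x \<bullet> y)" by simp
  then have "?h * (1 / 2) \<le> ?h * (1 - (real (2 * p + 1))\<^sup>2 * (1 - x \<bullet> y))" using h by (rule mult_left_mono)
  also have "\<dots> \<le> qker (2 * p + 1) x y" by (rule qker_bounds(2)[OF d xy])
  finally have "wt (2 * p + 1) (2 * T) * (?h * (1 / 2)) \<le> wt (2 * p + 1) (2 * T) * qker (2 * p + 1) x y"
    by (rule mult_left_mono) (rule wt)
  then show "wt (2 * p + 1) (2 * T) * ?h / 2 \<le> wt (2 * p + 1) (2 * T) * qker (2 * p + 1) x y" by simp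
qed

text \<open>The upper half of the indices suffices: there are at least \<open>m / 2\<close> of them,
  each with \<open>2 p + 1 \<ge> m / 2\<close>.\<close>

lemma sum_odd_powers_ge: "(\<Sum>p<m. real (2 * p + 1) ^ k) \<ge> (real m / 2) ^ (k + 1)"
proof -
  have "real m / 2 \<le> real (card {m div 2..<m})" by simp
  moreover have "(real m / 2) ^ k \<le> real (2 * p + 1) ^ k" if "p \<in> {m div 2..<m}" for p
    using that by (intro power_mono) auto
  ultimately have "real m / 2 * (real m / 2) ^ k \<le> (\<Sum>p\<in>{m div 2..<m}. real (2 * p + 1) ^ k)"
    by (intro order_trans[OF mult_right_mono sum_bounded_below]) auto
  also have "\<dots> \<le> (\<Sum>p<m. real (2 * p + 1) ^ k)" by (rule sum_mono2) auto
  finally show ?thesis by simp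
qed

lemma Kodd_diag_le:
  fixes k :: nat
  assumes wt: "\<And>n T. 0 \<le> wt n T \<and> wt n T \<le> 1"
  obtains C where "C > 0" "\<And>T. Kodd_diag wt T (k + 2) \<le> C * real T ^ (k + 1)"
proof
  let ?a = "sphere_area (k + 2)"
  have a: "?a > 0" by (rule sphere_area_pos) simp
  define C where "C = 2 * (real k + 1) ^ k * 2 ^ k / ?a"
  show "C > 0" using a by (simp add: C_def)
  fix T
  have "wt (2 * p + 1) (2 * T) * (hdim (2 * p + 1) (k + 2) / ?a) \<le> 1 * (C * real T ^ k)" if "p < T" for p
  proof (rule mult_mono)
    have "hdim (2 * p + 1) (k + 2) \<le> 2 * (real k + 1) ^ k * real (2 * p + 1) ^ k" by (rule hdim_le) simp
    also have "\<dots> \<le> 2 * (real k + 1) ^ k * (2 * real T) ^ k"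
      using that by (intro mult_left_mono power_mono) auto
    finally show "hdim (2 * p + 1) (k + 2) / ?a \<le> C * real T ^ k"
      using a by (simp add: C_def divide_right_mono power_mult_distrib)
    show "0 \<le> hdim (2 * p + 1) (k + 2) / ?a" using a hdim_nonneg by (simp add: divide_nonneg_pos)
  qed (use wt in auto)
  then have "Kodd_diag wt T (k + 2) \<le> (\<Sum>p<T. 1 * (C * real T ^ k))"
    unfolding Kodd_diag_def by (intro sum_mono) auto
  then show "Kodd_diag wt T (k + 2) \<le> C * real T ^ (k + 1)" by (simp add: mult.left_commute)
qed

lemma Kodd_diag_ge:
  fixes k :: nat
  assumes K4: "K4 wt"
  obtains c where "c > 0" "\<And>T. c * real T ^ (k + 1) \<le> Kodd_diag wt T (k + 2)"
proof -
  let ?a = "sphere_area (k + 2)"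
  have a: "?a > 0" by (rule sphere_area_pos) simp
  obtain w where w: "w > 0" "\<And>T n. n \<le> T div 2 \<Longrightarrow> wt n T \<ge> w" and wt: "\<And>n T. wt n T \<ge> 0"
    using K4 unfolding K4_def by auto
  define b where "b = w / ((real k + 1) ^ k * ?a)"
  have b: "b > 0" using w a by (simp add: b_def)
  show ?thesis
  proof
    show "b / 4 ^ (k + 1) > 0" using b by simp
    fix T :: nat
    \<comment> \<open>For \<open>p < m\<close> the degree satisfies
      \<open>2 p + 1 \<le> 2 m - 1 \<le> T\<close>, which is the range where (K4), at
      \<open>2 T\<close>, bounds the weights from below. Rounding up leaves one term for
      \<open>T = 1\<close>.\<close>
    define m where "m = (T + 1) div 2"
    have m: "real T / 2 \<le> real m" "m \<le> T" by (auto simp: m_def)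
    have "b / 4 ^ (k + 1) * real T ^ (k + 1) = b * (real T / 2 / 2) ^ (k + 1)"
      by (simp add: power_divide power_mult_distrib[symmetric])
    also have "\<dots> \<le> b * (real m / 2) ^ (k + 1)"
      using b m by (intro mult_left_mono power_mono) auto
    also have "\<dots> \<le> b * (\<Sum>p<m. real (2 * p + 1) ^ k)"
      using b sum_odd_powers_ge[where m=m and k=k] by (intro mult_left_mono) auto
    also have "\<dots> = (\<Sum>p<m. w * ((real (2 * p + 1) / real (k + 1)) ^ k / ?a))"
      by (simp add: b_def sum_distrib_left power_divide mult.assoc add.commute)
    also have "\<dots> \<le> (\<Sum>p<m. wt (2 * p + 1) (2 * T) * (hdim (2 * p + 1) (k + 2) / ?a))"
    proof (intro sum_mono mult_mono)
      fix p assume "p \<in> {..<m}"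
      then show "w \<le> wt (2 * p + 1) (2 * T)" by (intro w) (auto simp: m_def)
      show "(real (2 * p + 1) / real (k + 1)) ^ k / ?a \<le> hdim (2 * p + 1) (k + 2) / ?a"
        by (rule divide_right_mono[OF hdim_ge]) (use a in auto)
    qed (use a w wt in auto)
    also have "\<dots> \<le> Kodd_diag wt T (k + 2)"
      unfolding Kodd_diag_def using m a wt hdim_nonneg
      by (intro sum_mono2) (auto intro!: mult_nonneg_nonneg divide_nonneg_pos)
    finally show "b / 4 ^ (k + 1) * real T ^ (k + 1) \<le> Kodd_diag wt T (k + 2)" .
  qed
qed

text \<open>Reflecting \<open>x\<close> changes the sign of exactly the odd degrees, so the
  difference keeps these and doubles them; the top degree \<open>2 T\<close> is even and drops out.
  Bounds on the full kernel transfer to \<open>Kodd\<close> in this way.\<close>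

lemma Kodd_eq_Kker:
  fixes x y :: "'a::euclidean_space"
  assumes "DIM('a) \<ge> 2" "norm x = 1" "norm y = 1"
  shows "Kodd wt T x y = (Kker wt (2 * T) x y - Kker wt (2 * T) (- x) y) / 2"
proof -
  let ?f = "\<lambda>n. wt n (2 * T) * qker n x y"
  have "(Kker wt (2 * T) x y - Kker wt (2 * T) (- x) y) / 2 = (\<Sum>n = 0..2 * T. if odd n then ?f n else 0)"
    unfolding Kker_def sum_subtractf[symmetric] sum_divide_distrib
    by (intro sum.cong refl) (auto simp: qker_bounds(3)[OF assms])
  also have "\<dots> = (\<Sum>n | n \<le> 2 * T \<and> odd n. ?f n)"
    by (subst sum.inter_filter[symmetric]) (auto intro!: sum.cong)
  also have "\<dots> = (\<Sum>p<T. ?f (2 * p + 1))"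
    by (rule sum.reindex_bij_witness[of _ "\<lambda>p. 2 * p + 1" "\<lambda>n. n div 2"]) (auto elim!: oddE)
  finally show ?thesis by (simp add: Kodd_def)
qed

lemma Kodd_minus:
  fixes x y :: "'a::euclidean_space"
  assumes "DIM('a) \<ge> 2" "norm x = 1" "norm y = 1"
  shows "Kodd wt T (- x) y = - Kodd wt T x y"
  using Kodd_eq_Kker[OF assms, of wt T] Kodd_eq_Kker[of "- x" y wt T] assms by simp

lemma integrable_sphere_bounded:
  fixes f :: "'a::euclidean_space \<Rightarrow> real"
  assumes "f \<in> borel_measurable sphere_measure" "\<And>x. norm x = 1 \<Longrightarrow> \<bar>f x\<bar> \<le> b"
  shows "integrable sphere_measure f"
  by (rule sphere.integrable_const_bound[of _ b]) (use assms in auto)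

text \<open>Orthogonality of the \<open>qker n\<close> is not needed for the lower bound: by \<open>Kodd_ge_half_diag\<close>
  the cap of radius \<open>1 / (2 T)\<close> around \<open>x\<close> already carries the right order.\<close>
lemma integral_sq_Kodd_ge:
  assumes d: "DIM('a::euclidean_space) \<ge> 2" and K4: "K4 wt"
  obtains c where "c > 0" "\<And>T (x::'a). T \<ge> 1 \<Longrightarrow> norm x = 1 \<Longrightarrow>
    c * real T ^ (DIM('a) - 1) \<le> (\<integral>z. (Kodd wt T z x)\<^sup>2 \<partial>sphere_measure)"
proof -
  define k where "k = DIM('a) - 2"
  have k: "DIM('a) = k + 2" "DIM('a) - 1 = k + 1" using d by (auto simp: k_def)
  have wt: "\<And>n T. wt n T \<ge> 0" using K4 by (auto simp: K4_def)
  obtain a where a: "a > 0" "\<And>(x::'a) \<delta>. norm x = 1 \<Longrightarrow> 0 < \<delta> \<Longrightarrow> \<delta> \<le> 1/2 \<Longrightarrow>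
    a * \<delta> ^ (DIM('a) - 1) \<le> measure sphere_measure {z \<in> sphere 0 1. norm (z - x) \<le> \<delta>}"
    using sphere_cap_measure_ge by blast
  obtain b where b: "b > 0" "\<And>T. b * real T ^ (k + 1) \<le> Kodd_diag wt T (k + 2)"
    using Kodd_diag_ge[OF K4] by blast
  show ?thesis
  proof
    \<comment> \<open>The square of \<open>b * T ^ (k + 1) / 2\<close> times the cap measure
      \<open>a * (1 / (2 T)) ^ (k + 1)\<close>: of the \<open>2 (k + 1)\<close> powers of
      \<open>T\<close>, half survive.\<close>
    show "b\<^sup>2 / 4 * a / 2 ^ (k + 1) > 0" using a b by simp
  next
    fix T :: nat and x :: 'a assume T: "T \<ge> 1" and x: "norm x = 1"
    let ?C = "{z \<in> sphere 0 1. norm (z - x) \<le> 1 / (2 * real T)}"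
    let ?D = "Kodd_diag wt T (k + 2)"
    have C: "?C \<in> sets sphere_measure"
      by (auto simp: sets_sphere_measure_iff Collect_conj_eq intro!: borel_closed closed_Collect_le continuous_intros)
    have D0: "0 \<le> b * real T ^ (k + 1)" using b by simp
    have "b\<^sup>2 / 4 * a / 2 ^ (k + 1) * real T ^ (DIM('a) - 1)
       = (b * real T ^ (k + 1) / 2)\<^sup>2 * (a * (1 / (2 * real T)) ^ (k + 1))"
      using T unfolding k by (simp add: power_divide power_mult_distrib power2_eq_square)
    also have "\<dots> \<le> (?D / 2)\<^sup>2 * measure sphere_measure ?C"
      using b D0 a(1) a(2)[OF x, of "1 / (2 * real T)"] T k by (intro mult_mono power_mono divide_right_mono) auto
    also have "\<dots> = (\<integral>z. (?D / 2)\<^sup>2 * indicator ?C z \<partial>sphere_measure)"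
    proof -
      have "?C \<inter> sphere 0 1 = ?C" by auto
      then show ?thesis using C by simp
    qed
    also have "\<dots> \<le> (\<integral>z. (Kodd wt T z x)\<^sup>2 \<partial>sphere_measure)"
    proof (rule integral_mono)
      show "integrable sphere_measure (\<lambda>z. (?D / 2)\<^sup>2 * indicator ?C z)"
        by (intro integrable_mult_right integrable_real_indicator C) (simp add: less_top[symmetric])
      show "integrable sphere_measure (\<lambda>z. (Kodd wt T z x)\<^sup>2)"
      proof (rule integrable_sphere_bounded)
        show "\<bar>(Kodd wt T z x)\<^sup>2\<bar> \<le> ?D\<^sup>2" if "norm z = 1" for z
          using abs_Kodd_le[OF d that x, of wt T] wt k by (simp add: abs_le_square_iff[symmetric])
      qed (use borel_measurable_Kodd[OF x] in measurable)
      fix z :: 'a assume z: "z \<in> space sphere_measure"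
      show "(?D / 2)\<^sup>2 * indicator ?C z \<le> (Kodd wt T z x)\<^sup>2"
      proof (cases "z \<in> ?C")
        case True
        then have "?D / 2 \<le> Kodd wt T z x"
          using Kodd_ge_half_diag[OF d _ x, of z wt T] wt k by auto
        moreover have "0 \<le> ?D / 2" using D0 b(2)[of T] by linarith
        ultimately show ?thesis using True by (simp add: power_mono del: power_divide)
      qed simp
    qed
    finally show "b\<^sup>2 / 4 * a / 2 ^ (k + 1) * real T ^ (DIM('a) - 1) \<le> (\<integral>z. (Kodd wt T z x)\<^sup>2 \<partial>sphere_measure)" .
  qed
qed

text \<open>\<open>Kodd\<close> is half the difference of two full kernels, based at
  \<open>x\<close> and at \<open>- x\<close>, and (K1) holds at both. \<open>max B 1\<close> appears
  because the real number in (K1) carries no sign condition and \<open>ennreal\<close> truncates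
  it.\<close>

lemma integral_abs_Kodd_le:
  assumes d: "DIM('a::euclidean_space) \<ge> 2" and K1: "K1 wt TYPE('a)" and wt: "\<And>n T. wt n T \<ge> 0"
  obtains B where "B > 0" "\<And>T (x::'a). norm x = 1 \<Longrightarrow> (\<integral>z. \<bar>Kodd wt T z x\<bar> \<partial>sphere_measure) \<le> B"
proof -
  obtain B where B: "\<And>T (x::'a). norm x = 1 \<Longrightarrow> (\<integral>\<^sup>+ y. ennreal \<bar>Kker wt T x y\<bar> \<partial>sphere_measure) \<le> ennreal B"
    using K1 unfolding K1_def by (auto simp: Ball_def)
  show ?thesis
  proof
    show "max B 1 > 0" by simp
    fix T :: nat and x :: 'a assume x: "norm x = 1"
    have m: "(\<lambda>y. Kker wt (2 * T) z y) \<in> borel_measurable sphere_measure" if "norm z = 1" for z :: 'a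
      using borel_measurable_Kker[OF that] by (simp add: Kker_commute[of _ _ z])
    have i: "integrable sphere_measure (\<lambda>y. \<bar>Kker wt (2 * T) z y\<bar>)" if "norm z = 1" for z :: 'a
      using m[OF that] abs_Kker_le[OF d that] by (intro integrable_abs integrable_sphere_bounded)
    have le: "(\<integral>y. \<bar>Kker wt (2 * T) z y\<bar> \<partial>sphere_measure) \<le> max B 1" if "norm z = 1" for z :: 'a
    proof -
      have "ennreal (\<integral>y. \<bar>Kker wt (2 * T) z y\<bar> \<partial>sphere_measure) \<le> ennreal (max B 1)"
        using B[OF that, of "2 * T"] nn_integral_eq_integral[OF i[OF that]]
        by (metis (no_types, lifting) AE_I2 abs_ge_zero ennreal_leI max.cobounded1 order_trans)
      then show ?thesis by (subst (asm) ennreal_le_iff) auto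
    qed
    have "(\<integral>z. \<bar>Kodd wt T z x\<bar> \<partial>sphere_measure)
        \<le> (\<integral>z. (\<bar>Kker wt (2 * T) x z\<bar> + \<bar>Kker wt (2 * T) (- x) z\<bar>) / 2 \<partial>sphere_measure)"
    proof (rule integral_mono)
      show "integrable sphere_measure (\<lambda>z. \<bar>Kodd wt T z x\<bar>)"
        using borel_measurable_Kodd[OF x] abs_Kodd_le[OF d _ x wt]
        by (intro integrable_abs integrable_sphere_bounded)
      show "integrable sphere_measure (\<lambda>z. (\<bar>Kker wt (2 * T) x z\<bar> + \<bar>Kker wt (2 * T) (- x) z\<bar>) / 2)"
        using i[of x] i[of "- x"] x by simp
      fix z :: 'a assume "z \<in> space sphere_measure"
      then show "\<bar>Kodd wt T z x\<bar> \<le> (\<bar>Kker wt (2 * T) x z\<bar> + \<bar>Kker wt (2 * T) (- x) z\<bar>) / 2"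
        using Kodd_eq_Kker[OF d x, of z wt T] by (simp add: Kodd_commute[of _ _ z])
    qed
    also have "\<dots> = ((\<integral>y. \<bar>Kker wt (2 * T) x y\<bar> \<partial>sphere_measure) + (\<integral>y. \<bar>Kker wt (2 * T) (- x) y\<bar> \<partial>sphere_measure)) / 2"
      using i[of x] i[of "- x"] x by simp
    also have "\<dots> \<le> max B 1" using le[of x] le[of "- x"] x by simp
    finally show "(\<integral>z. \<bar>Kodd wt T z x\<bar> \<partial>sphere_measure) \<le> max B 1" .
  qed
qed

text \<open>The even degrees of the kernel contribute nothing against an odd \<open>f\<close>, as
  reflecting the integration variable shows. This links the estimator, built on \<open>Kodd\<close>,
  with (K3), which speaks of the full kernel.\<close>

lemma integral_Kodd_eq_Kker:
  fixes f :: "'a::euclidean_space \<Rightarrow> real"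
  assumes d: "DIM('a) \<ge> 2" and x: "norm x = 1"
    and f: "f \<in> borel_measurable sphere_measure" "\<And>z. norm z = 1 \<Longrightarrow> \<bar>f z\<bar> \<le> b"
      and odd: "\<And>z. norm z = 1 \<Longrightarrow> f (- z) = - f z"
  shows "(\<integral>z. Kodd wt T z x * f z \<partial>sphere_measure) = (\<integral>z. Kker wt (2 * T) x z * f z \<partial>sphere_measure)"
proof -
  have m: "(\<lambda>y. Kker wt (2 * T) z y) \<in> borel_measurable sphere_measure" if "norm z = 1" for z :: 'a
    using borel_measurable_Kker[OF that] by (simp add: Kker_commute[of _ _ z])
  have i: "integrable sphere_measure (\<lambda>y. Kker wt (2 * T) z y * f y)" if "norm z = 1" for z :: 'a
  proof (rule integrable_sphere_bounded)
    show "\<bar>Kker wt (2 * T) z y * f y\<bar> \<le> (\<Sum>n = 0..2*T. \<bar>wt n (2*T)\<bar> * (hdim n DIM('a) / sphere_area DIM('a))) * b"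
      if "norm y = 1" for y
      unfolding abs_mult using abs_Kker_le[OF d \<open>norm z = 1\<close> that, of wt "2 * T"] f(2)[OF that]
      by (intro mult_mono) auto
  qed (use m[OF that] f(1) in measurable)
  have "(\<integral>z. Kker wt (2 * T) (- x) z * f z \<partial>sphere_measure)
      = (\<integral>z. Kker wt (2 * T) (- x) (- z) * f (- z) \<partial>sphere_measure)"
    using m[of "- x"] x f(1) by (intro integral_sphere_uminus[symmetric]) simp
  also have "\<dots> = (\<integral>z. - (Kker wt (2 * T) x z * f z) \<partial>sphere_measure)"
    by (intro Bochner_Integration.integral_cong refl) (simp add: Kker_minus_minus odd)
  finally have neg: "(\<integral>z. Kker wt (2 * T) (- x) z * f z \<partial>sphere_measure) = - (\<integral>z. Kker wt (2 * T) x z * f z \<partial>sphere_measure)"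
    by simp
  have eq: "Kodd wt T z x = (Kker wt (2 * T) x z - Kker wt (2 * T) (- x) z) / 2" if "norm z = 1" for z
    using Kodd_eq_Kker[OF d x that] by (simp add: Kodd_commute[of _ _ z])
  have "(\<integral>z. Kodd wt T z x * f z \<partial>sphere_measure)
      = (\<integral>z. (Kker wt (2 * T) x z * f z - Kker wt (2 * T) (- x) z * f z) / 2 \<partial>sphere_measure)"
    by (intro Bochner_Integration.integral_cong refl) (auto simp: eq algebra_simps diff_divide_distrib)
  also have "\<dots> = (\<integral>z. Kker wt (2 * T) x z * f z \<partial>sphere_measure)"
    using i[of x] i[of "- x"] x by (simp add: neg)
  finally show ?thesis .
qed

section \<open>Smoothing bias\<close>

text \<open>By continuity a violation at \<open>x\<close> persists on a small cap around
  \<open>x\<close>, and caps have positive measure.\<close>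

lemma sphere_AE_imp_all:
  fixes h :: "'a::euclidean_space \<Rightarrow> real"
  assumes cont: "continuous_on (sphere 0 1) h" and AE: "AE x in sphere_measure. \<bar>h x\<bar> \<le> b"
    and x: "norm x = 1"
  shows "\<bar>h x\<bar> \<le> b"
proof (rule ccontr)
  assume "\<not> \<bar>h x\<bar> \<le> b"
  then have pos: "\<bar>h x\<bar> - b > 0" by simp
  obtain c where c: "c > 0" "\<And>(x::'a) \<delta>. norm x = 1 \<Longrightarrow> 0 < \<delta> \<Longrightarrow> \<delta> \<le> 1/2 \<Longrightarrow>
    c * \<delta> ^ (DIM('a) - 1) \<le> measure sphere_measure {z \<in> sphere 0 1. norm (z - x) \<le> \<delta>}"
    using sphere_cap_measure_ge by blast
  obtain d where d: "d > 0" "\<And>z. norm z = 1 \<Longrightarrow> dist z x < d \<Longrightarrow> dist (h z) (h x) < \<bar>h x\<bar> - b"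
    using cont x pos unfolding continuous_on_iff by (metis mem_sphere_0)
  define \<delta> where "\<delta> = min (d / 2) (1 / 2)"
  have \<delta>: "\<delta> > 0" "\<delta> \<le> 1/2" "\<delta> < d" using d(1) by (auto simp: \<delta>_def min_def)
  let ?C = "{z \<in> sphere 0 1. norm (z - x) \<le> \<delta>}"
  have C: "?C \<in> sets sphere_measure"
    by (auto simp: sets_sphere_measure_iff Collect_conj_eq intro!: borel_closed closed_Collect_le continuous_intros)
  have "AE z in sphere_measure. z \<notin> ?C"
    using AE
  proof eventually_elim
    case (elim z)
    show ?case
    proof
      assume "z \<in> ?C"
      then have "dist (h z) (h x) < \<bar>h x\<bar> - b" using \<delta> by (intro d) (auto simp: dist_norm)
      then show False using elim by (simp add: dist_real_def)
    qed
  qed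
  then have "?C \<in> null_sets sphere_measure" using C by (simp add: AE_iff_null_sets)
  then have "measure sphere_measure ?C = 0" by (simp add: measure_def null_sets_def)
  then show False using c(2)[OF x \<delta>(1,2)] mult_pos_pos[OF c(1) zero_less_power[OF \<delta>(1), of "DIM('a) - 1"]] by linarith
qed

text \<open>Excludes the degenerate case in which essential suprema would be minus infinity and the
  norms in (K3) would not be real numbers.\<close>

lemma sphere_measure_nonzero: "emeasure (sphere_measure :: 'a::euclidean_space measure) (space sphere_measure) \<noteq> 0"
proof
  assume "emeasure (sphere_measure :: 'a measure) (space sphere_measure) = 0"
  then have "AE x :: 'a in sphere_measure. False"
    by (intro AE_I[of _ _ "space sphere_measure"]) (auto simp: sets_sphere_measure_iff)
  then have "AE x :: 'a in sphere_measure. \<bar>1::real\<bar> \<le> 0" by simp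
  moreover obtain x :: 'a where "norm x = 1" using SOME_Basis norm_Basis by blast
  ultimately show False using sphere_AE_imp_all[of "\<lambda>_. 1" 0 x] by simp
qed

lemma in_Linf_iff: "in_Linf f \<longleftrightarrow> f \<in> borel_measurable sphere_measure \<and> (\<exists>b. AE x in sphere_measure. \<bar>f x\<bar> \<le> b)"
proof
  assume f: "in_Linf f"
  then have [measurable]: "f \<in> borel_measurable sphere_measure" and lt: "Linf_norm f < \<infinity>"
    by (auto simp: in_Linf_def)
  have "\<exists>b::real. Linf_norm f \<le> ereal b" using lt by (cases "Linf_norm f") auto
  then obtain b where b: "Linf_norm f \<le> ereal b" by auto
  have "AE x in sphere_measure. ereal \<bar>f x\<bar> \<le> Linf_norm f" unfolding Linf_norm_def by (rule esssup_AE)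
  then have "AE x in sphere_measure. \<bar>f x\<bar> \<le> b"
    by eventually_elim (use b order_trans in fastforce)
  then show "f \<in> borel_measurable sphere_measure \<and> (\<exists>b. AE x in sphere_measure. \<bar>f x\<bar> \<le> b)" by auto
next
  assume "f \<in> borel_measurable sphere_measure \<and> (\<exists>b. AE x in sphere_measure. \<bar>f x\<bar> \<le> b)"
  then obtain b where [measurable]: "f \<in> borel_measurable sphere_measure" and b: "AE x in sphere_measure. \<bar>f x\<bar> \<le> b"
    by auto
  have "Linf_norm f \<le> ereal b" unfolding Linf_norm_def by (rule esssup_I) (use b in auto)
  then show "in_Linf f" by (auto simp: in_Linf_def)
qed

lemma Linf_norm_real:
  fixes f :: "'a::euclidean_space \<Rightarrow> real"
  assumes "in_Linf f"
  obtains b where "b \<ge> 0" "Linf_norm f = ereal b"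
proof -
  have "0 = esssup (sphere_measure :: 'a measure) (\<lambda>x. 0 :: ereal)"
    using esssup_const[OF sphere_measure_nonzero, of "0::ereal"] by simp
  also have "\<dots> \<le> Linf_norm f" unfolding Linf_norm_def by (rule esssup_mono) auto
  finally have "0 \<le> Linf_norm f" .
  moreover have "Linf_norm f < \<infinity>" using assms by (simp add: in_Linf_def)
  ultimately show ?thesis using that by (cases "Linf_norm f") auto
qed

lemma AE_sphere_uminus:
  fixes P :: "'a::euclidean_space \<Rightarrow> bool"
  assumes "AE x in sphere_measure. P x"
  shows "AE x in sphere_measure. P (- x)"
proof -
  have "AE x in distr (sphere_measure :: 'a measure) sphere_measure uminus. P x"
    unfolding distr_sphere_uminus by (rule assms)
  then show ?thesis by (rule AE_distrD[OF measurable_uminus_sphere])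
qed

text \<open>The kernel depends on \<open>x \<bullet> y\<close> only, so reflecting \<open>f\<close>
  amounts to reflecting the point at which the projection is evaluated.\<close>

lemma Qproj_odd_part:
  fixes f :: "'a::euclidean_space \<Rightarrow> real"
  assumes d: "DIM('a) \<ge> 2" and f: "in_Linf f" and x: "norm x = 1"
  shows "Qproj n (\<lambda>x. (f x - f (- x)) / 2) x = (Qproj n f x - Qproj n f (- x)) / 2"
proof -
  obtain b where f_m: "f \<in> borel_measurable sphere_measure" and b: "AE x in sphere_measure. \<bar>f x\<bar> \<le> b"
    using f by (auto simp: in_Linf_iff)
  have q_m: "(\<lambda>y. qker n z y) \<in> borel_measurable sphere_measure" if "norm z = 1" for z :: 'a
    using borel_measurable_qker[OF that, of n] by (simp add: qker_commute[of _ z])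
  have i: "integrable sphere_measure (\<lambda>y. qker n z y * f y)" if z: "norm z = 1" for z :: 'a
  proof (rule sphere.integrable_const_bound)
    show "AE y in sphere_measure. norm (qker n z y * f y) \<le> hdim n DIM('a) / sphere_area DIM('a) * b"
      using b AE_space
    proof eventually_elim
      case (elim y)
      then show ?case using qker_bounds(1)[OF d z, of y n]
        by (auto simp: abs_mult simp del: times_divide_eq_left intro!: mult_mono)
    qed
  qed (use q_m[OF z] f_m in measurable)
  have refl: "(\<integral>y. qker n x y * f (- y) \<partial>sphere_measure) = Qproj n f (- x)"
  proof -
    have "(\<integral>y. qker n x y * f (- y) \<partial>sphere_measure) = (\<integral>y. qker n (- x) (- y) * f (- y) \<partial>sphere_measure)"
      by (simp add: qker_minus_minus)
    also have "\<dots> = (\<integral>y. qker n (- x) y * f y \<partial>sphere_measure)"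
      using q_m[of "- x"] x f_m by (intro integral_sphere_uminus) simp
    finally show ?thesis by (simp add: Qproj_def)
  qed
  have i2: "integrable sphere_measure (\<lambda>y. qker n x y * f (- y))"
  proof -
    have "integrable (distr sphere_measure sphere_measure uminus) (\<lambda>y. qker n (- x) y * f y)"
      using i[of "- x"] x by (simp add: distr_sphere_uminus)
    then have "integrable sphere_measure (\<lambda>y. qker n (- x) (- y) * f (- y))"
      by (rule integrable_distr[OF measurable_uminus_sphere])
    then show ?thesis by (simp add: qker_minus_minus)
  qed
  have "Qproj n (\<lambda>x. (f x - f (- x)) / 2) x
      = (\<integral>y. (qker n x y * f y - qker n x y * f (- y)) / 2 \<partial>sphere_measure)"
    unfolding Qproj_def by (intro Bochner_Integration.integral_cong refl) (simp_all add: field_simps)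
  also have "\<dots> = (Qproj n f x - Qproj n f (- x)) / 2"
    using i[OF x] i2 refl by (simp add: Qproj_def)
  finally show ?thesis .
qed

lemma in_Linf_odd_part:
  fixes f :: "'a::euclidean_space \<Rightarrow> real"
  assumes "in_Linf f"
  shows "in_Linf (\<lambda>x. (f x - f (- x)) / 2)"
proof -
  obtain b where f_m [measurable]: "f \<in> borel_measurable sphere_measure" and b: "AE x in sphere_measure. \<bar>f x\<bar> \<le> b"
    using assms by (auto simp: in_Linf_iff)
  have m2: "(\<lambda>x. f (- x)) \<in> borel_measurable sphere_measure"
    using measurable_compose[OF measurable_uminus_sphere f_m] by simp
  have "AE x in sphere_measure. \<bar>(f x - f (- x)) / 2\<bar> \<le> b"
    using b AE_sphere_uminus[OF b] by eventually_elim auto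
  then show ?thesis using m2 by (auto simp: in_Linf_iff)
qed

text \<open>Half the difference of the defining identity at \<open>x\<close> and at
  \<open>- x\<close>, with the eigenvalue common to both.\<close>

lemma frac_lap_Linf_odd_part:
  fixes f g :: "'a::euclidean_space \<Rightarrow> real"
  assumes d: "DIM('a) \<ge> 2" and "frac_lap_Linf s f g"
  shows "frac_lap_Linf s (\<lambda>x. (f x - f (- x)) / 2) (\<lambda>x. (g x - g (- x)) / 2)"
  using assms(2) unfolding frac_lap_Linf_def
  by (auto simp: in_Linf_odd_part Qproj_odd_part[OF d] algebra_simps)

text \<open>(K2) is a Lipschitz bound in one argument, uniform in the other; by symmetry of the
  kernel and boundedness of \<open>f\<close> it passes to the integral.\<close>

lemma continuous_on_integral_Kker:
  fixes f :: "'a::euclidean_space \<Rightarrow> real"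
  assumes d: "DIM('a) \<ge> 2" and K2: "K2 wt TYPE('a)" and T: "T \<ge> 1" and f: "in_Linf f"
  shows "continuous_on (sphere 0 1) (\<lambda>x. \<integral>y. Kker wt T x y * f y \<partial>sphere_measure)"
proof -
  obtain b where f_m: "f \<in> borel_measurable sphere_measure" and b: "AE x in sphere_measure. \<bar>f x\<bar> \<le> b"
    using f by (auto simp: in_Linf_iff)
  obtain C \<alpha> where "\<forall>T\<ge>1. \<forall>x\<in>(sphere 0 1 :: 'a set). \<forall>y\<in>sphere 0 1. \<forall>z\<in>sphere 0 1.
      \<bar>Kker wt T z x - Kker wt T z y\<bar> \<le> C * norm (x - y) * real T powr \<alpha>"
    using K2 unfolding K2_def by blast
  then have C: "\<bar>Kker wt T x z - Kker wt T y z\<bar> \<le> C * norm (x - y) * real T powr \<alpha>"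
    if "norm x = 1" "norm y = 1" "norm z = 1" for x y z :: 'a
    using T that by (simp add: Kker_commute[of _ _ _ z])
  have m: "(\<lambda>y. Kker wt T z y) \<in> borel_measurable sphere_measure" if "norm z = 1" for z :: 'a
    using borel_measurable_Kker[OF that] by (simp add: Kker_commute[of _ _ z])
  have i: "integrable sphere_measure (\<lambda>y. Kker wt T z y * f y)" if z: "norm z = 1" for z :: 'a
  proof (rule sphere.integrable_const_bound)
    show "AE y in sphere_measure. norm (Kker wt T z y * f y)
        \<le> (\<Sum>n = 0..T. \<bar>wt n T\<bar> * (hdim n DIM('a) / sphere_area DIM('a))) * b"
      using b AE_space
    proof eventually_elim
      case (elim y)
      have y: "norm y = 1" using elim(2) by simp
      show ?case unfolding real_norm_def abs_mult
        using abs_Kker_le[OF d z y, of wt T] elim(1) by (intro mult_mono) auto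
    qed
  qed (use m[OF z] f_m in measurable)
  define L where "L = \<bar>C\<bar> * real T powr \<alpha> * \<bar>b\<bar> * measure (sphere_measure :: 'a measure) (space sphere_measure)"
  show ?thesis
  proof (rule lipschitz_on_continuous_on, rule lipschitz_onI)
    show "L \<ge> 0" by (simp add: L_def)
    fix x y :: 'a assume xy: "x \<in> sphere 0 1" "y \<in> sphere 0 1"
    have "\<bar>(\<integral>z. Kker wt T x z * f z \<partial>sphere_measure) - (\<integral>z. Kker wt T y z * f z \<partial>sphere_measure)\<bar>
       = \<bar>\<integral>z. Kker wt T x z * f z - Kker wt T y z * f z \<partial>sphere_measure\<bar>"
      using i xy by simp
    also have "\<dots> \<le> (\<integral>z. \<bar>Kker wt T x z * f z - Kker wt T y z * f z\<bar> \<partial>sphere_measure)"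
      by (rule integral_abs_bound)
    also have "\<dots> \<le> (\<integral>z. \<bar>C\<bar> * norm (x - y) * real T powr \<alpha> * \<bar>b\<bar> \<partial>(sphere_measure :: 'a measure))"
    proof (rule integral_mono_AE)
      show "AE z in sphere_measure. \<bar>Kker wt T x z * f z - Kker wt T y z * f z\<bar>
          \<le> \<bar>C\<bar> * norm (x - y) * real T powr \<alpha> * \<bar>b\<bar>"
        using b AE_space
      proof eventually_elim
        case (elim z)
        have "\<bar>Kker wt T x z - Kker wt T y z\<bar> \<le> C * norm (x - y) * real T powr \<alpha>"
          using C xy elim(2) by simp
        also have "\<dots> \<le> \<bar>C\<bar> * norm (x - y) * real T powr \<alpha>" by (intro mult_right_mono) auto
        finally have "\<bar>Kker wt T x z - Kker wt T y z\<bar> * \<bar>f z\<bar> \<le> \<bar>C\<bar> * norm (x - y) * real T powr \<alpha> * \<bar>b\<bar>"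
          using elim(1) by (intro mult_mono) auto
        then show ?case by (simp add: abs_mult[symmetric] left_diff_distrib)
      qed
    qed (use i xy in auto)
    also have "\<dots> = L * dist x y" by (simp add: L_def dist_norm)
    finally show "dist (\<integral>z. Kker wt T x z * f z \<partial>sphere_measure) (\<integral>z. Kker wt T y z * f z \<partial>sphere_measure) \<le> L * dist x y"
      by (simp add: dist_real_def)
  qed
qed

text \<open>(K3) is an almost everywhere bound; continuity makes it hold at every point. Only the odd
  part of \<open>R\<close> is smoothed, so that the even harmonics never enter.\<close>
lemma odd_part_approximation:
  fixes R :: "'a::euclidean_space \<Rightarrow> real"
  assumes d: "DIM('a) \<ge> 2" and K2: "K2 wt TYPE('a)" and K3: "K3_inf wt \<tau> TYPE('a)"
    and smooth: "sobolev_Linf \<tau> R" and cont: "continuous_on (sphere 0 1) R"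
  obtains C where "C > 0" "\<And>T x. T \<ge> 1 \<Longrightarrow> norm x = 1 \<Longrightarrow>
    \<bar>(R x - R (- x)) / 2 - (\<integral>y. Kker wt T x y * ((R y - R (- y)) / 2) \<partial>sphere_measure)\<bar>
      \<le> C * real T powr (- \<tau>)"
proof -
  define f where "f x = (R x - R (- x)) / 2" for x
  obtain g0 where "frac_lap_Linf \<tau> R g0" using smooth unfolding sobolev_Linf_def by blast
  then obtain g where fg: "frac_lap_Linf \<tau> f g"
    using frac_lap_Linf_odd_part[OF d] unfolding f_def[abs_def] by blast
  then have Lf: "in_Linf f" and Lg: "in_Linf g" by (auto simp: frac_lap_Linf_def)
  obtain bf where bf: "bf \<ge> 0" "Linf_norm f = ereal bf" by (rule Linf_norm_real[OF Lf])
  obtain bg where bg: "bg \<ge> 0" "Linf_norm g = ereal bg" by (rule Linf_norm_real[OF Lg])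
  obtain C where C: "\<And>T f g. T \<ge> 1 \<Longrightarrow> frac_lap_Linf \<tau> f (g :: 'a \<Rightarrow> real) \<Longrightarrow>
      Linf_norm (\<lambda>x. f x - (\<integral>y. Kker wt T x y * f y \<partial>sphere_measure))
        \<le> ereal (C * real T powr (- \<tau>)) * (Linf_norm f + Linf_norm g)"
    using K3 unfolding K3_inf_def by blast
  have cf: "continuous_on (sphere 0 1) f"
    unfolding f_def[abs_def]
    by (intro continuous_intros cont continuous_on_compose2[OF cont]) auto
  show ?thesis
  proof
    \<comment> \<open>The constant of (K3) may have any sign and both norms may vanish; hence
      \<open>\<bar>C\<bar>\<close> and the added 1.\<close>
    show "\<bar>C\<bar> * (bf + bg) + 1 > 0" using bf bg by (simp add: add_nonneg_pos)
    fix T :: nat and x :: 'a assume T: "T \<ge> 1" and x: "norm x = 1"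
    let ?h = "\<lambda>x. f x - (\<integral>y. Kker wt T x y * f y \<partial>sphere_measure)"
    have "AE x in sphere_measure. ereal \<bar>?h x\<bar> \<le> Linf_norm ?h" unfolding Linf_norm_def by (rule esssup_AE)
    moreover have "Linf_norm ?h \<le> ereal (C * real T powr (- \<tau>) * (bf + bg))"
      using C[OF T fg] bf bg by simp
    ultimately have ae: "AE x in sphere_measure. \<bar>?h x\<bar> \<le> C * real T powr (- \<tau>) * (bf + bg)"
      by (auto elim!: eventually_mono dest: order_trans)
    have "\<bar>?h x\<bar> \<le> C * real T powr (- \<tau>) * (bf + bg)"
      by (rule sphere_AE_imp_all[where h = ?h, OF _ ae x])
        (intro continuous_intros cf continuous_on_integral_Kker[OF d K2 T Lf])
    also have "\<dots> = C * (bf + bg) * real T powr (- \<tau>)" by simp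
    also have "\<dots> \<le> (\<bar>C\<bar> * (bf + bg) + 1) * real T powr (- \<tau>)"
    proof (rule mult_right_mono)
      have "C * (bf + bg) \<le> \<bar>C\<bar> * (bf + bg)" using bf bg by (intro mult_right_mono) auto
      then show "C * (bf + bg) \<le> \<bar>C\<bar> * (bf + bg) + 1" by simp
    qed simp
    finally show "\<bar>(R x - R (- x)) / 2 - (\<integral>y. Kker wt T x y * ((R y - R (- y)) / 2) \<partial>sphere_measure)\<bar>
      \<le> (\<bar>C\<bar> * (bf + bg) + 1) * real T powr (- \<tau>)" by (simp add: f_def)
  qed
qed

section \<open>Half spheres and trimming\<close>

text \<open>The first coordinate axis is replaced by any nonzero direction \<open>e\<close>, since
  only the symmetry between \<open>x \<bullet> e \<ge> 0\<close> and
  \<open>x \<bullet> e \<le> 0\<close> is used.\<close>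

locale half_sphere_density =
  fixes e :: "'a::euclidean_space" and fX :: "'a \<Rightarrow> real"
  assumes e_nonzero: "e \<noteq> 0"
    and fX_measurable [measurable]: "fX \<in> borel_measurable sphere_measure"
    and fX_nonneg: "0 \<le> fX x"
    and fX_pos: "AE x in sphere_measure. x \<bullet> e \<ge> 0 \<longrightarrow> fX x > 0"
    and fX_zero: "norm x = 1 \<Longrightarrow> x \<bullet> e < 0 \<Longrightarrow> fX x = 0"
begin

text \<open>\<open>0 < fX x\<close> keeps out the half sphere without data, which
  \<open>fX x < t\<close> alone would include.\<close>

definition trimmed_region :: "real \<Rightarrow> 'a set" where
  "trimmed_region t = {x \<in> sphere 0 1. 0 < fX x \<and> fX x < t}"

lemma sets_trimmed_region [measurable]: "trimmed_region t \<in> sets sphere_measure"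
proof -
  have "{x \<in> space sphere_measure. 0 < fX x \<and> fX x < t} \<in> sets sphere_measure" by measurable
  then show ?thesis by (simp add: trimmed_region_def)
qed

lemma trimmed_weight_bounds: "t > 0 \<Longrightarrow> 0 \<le> fX x / max (fX x) t" "t > 0 \<Longrightarrow> fX x / max (fX x) t \<le> 1"
  using fX_nonneg[of x] by (auto simp: divide_le_eq max_def)

text \<open>The weight is 1 where \<open>fX \<ge> t\<close>, 0 on the half sphere without data, and
  between 0 and 1 otherwise, so it differs from the indicator of the half sphere on the trimmed
  region only. This is how the density disappears from the integrals.\<close>

lemma AE_trimmed_weight:
  assumes t: "t > 0"
  shows "AE x in sphere_measure. \<bar>fX x / max (fX x) t - (if x \<bullet> e \<ge> 0 then 1 else 0)\<bar> \<le> indicator (trimmed_region t) x"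
  using fX_pos AE_space
proof eventually_elim
  case (elim x)
  show ?case
  proof (cases "x \<bullet> e \<ge> 0")
    case True
    then have pos: "fX x > 0" using elim by simp
    show ?thesis
    proof (cases "fX x < t")
      case lt: True
      then have "x \<in> trimmed_region t" using elim(2) pos by (simp add: trimmed_region_def)
      then show ?thesis using True trimmed_weight_bounds[OF t, of x] by (simp add: abs_le_iff)
    next
      case False
      then show ?thesis using True pos by (simp add: max_def)
    qed
  next
    case False
    then show ?thesis using fX_zero[of x] elim(2) by simp
  qed
qed

text \<open>The two closed half spheres are exchanged by the reflection and overlap in a null
  set.\<close>

lemma integral_even_eq_half:
  fixes G :: "'a \<Rightarrow> real"
  assumes G [measurable]: "G \<in> borel_measurable sphere_measure" and bd: "\<And>x. norm x = 1 \<Longrightarrow> \<bar>G x\<bar> \<le> D"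
    and even: "\<And>x. norm x = 1 \<Longrightarrow> G (- x) = G x"
  shows "(\<integral>x. G x \<partial>sphere_measure) = 2 * (\<integral>x. G x * (if x \<bullet> e \<ge> 0 then 1 else 0) \<partial>sphere_measure)"
proof -
  let ?p = "\<lambda>x. G x * (if x \<bullet> e \<ge> 0 then 1 else 0)" and ?n = "\<lambda>x. G x * (if x \<bullet> e \<le> 0 then 1 else 0)"
  have "(\<lambda>x. if x \<bullet> e \<ge> 0 then 1 else 0 :: real) \<in> borel_measurable sphere_measure"
    by (rule measurable_sphere_borel) simp
  from borel_measurable_times[OF G this] have p_m [measurable]: "?p \<in> borel_measurable sphere_measure" .
  have "(\<lambda>x. if x \<bullet> e \<le> 0 then 1 else 0 :: real) \<in> borel_measurable sphere_measure"
    by (rule measurable_sphere_borel) simp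
  from borel_measurable_times[OF G this] have n_m: "?n \<in> borel_measurable sphere_measure" .
  have i: "integrable sphere_measure ?p" "integrable sphere_measure ?n"
    by (rule integrable_sphere_bounded[of _ D]; use bd in \<open>force simp: abs_mult\<close>)+
  have "(\<integral>x. ?n x \<partial>sphere_measure) = (\<integral>x. ?p (- x) \<partial>sphere_measure)"
    by (intro Bochner_Integration.integral_cong refl) (auto simp: even)
  also have "\<dots> = (\<integral>x. ?p x \<partial>sphere_measure)" by (rule integral_sphere_uminus[OF p_m])
  finally have n: "(\<integral>x. ?n x \<partial>sphere_measure) = (\<integral>x. ?p x \<partial>sphere_measure)" .
  have "(\<integral>x. G x \<partial>sphere_measure) = (\<integral>x. ?p x + ?n x \<partial>sphere_measure)"
    by (rule integral_cong_AE[OF G borel_measurable_add[OF p_m n_m]])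
      (use AE_sphere_not_orthogonal[OF e_nonzero] in \<open>eventually_elim, auto\<close>)
  then show ?thesis using i n by simp
qed

text \<open>Meant for \<open>K * h\<close> and \<open>K\<^sup>2\<close>, which are products of two
  odd functions and therefore even.\<close>

lemma trimmed_integral_even:
  fixes G :: "'a \<Rightarrow> real"
  assumes G [measurable]: "G \<in> borel_measurable sphere_measure" and bd: "\<And>x. norm x = 1 \<Longrightarrow> \<bar>G x\<bar> \<le> D"
    and even: "\<And>x. norm x = 1 \<Longrightarrow> G (- x) = G x" and t: "t > 0"
  shows "\<bar>2 * (\<integral>x. G x * (fX x / max (fX x) t) \<partial>sphere_measure) - (\<integral>x. G x \<partial>sphere_measure)\<bar>
     \<le> 2 * D * measure sphere_measure (trimmed_region t)"
proof -
  let ?w = "\<lambda>x. fX x / max (fX x) t" and ?H = "\<lambda>x. if x \<bullet> e \<ge> 0 then 1 else 0 :: real"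
  have i: "integrable sphere_measure (\<lambda>x. G x * ?w x)"
  proof (rule integrable_sphere_bounded[of _ D])
    show "\<bar>G x * ?w x\<bar> \<le> D" if "norm x = 1" for x
      unfolding abs_mult using mult_mono[OF bd[OF that], of "\<bar>?w x\<bar>" 1] trimmed_weight_bounds[OF t, of x] bd[OF that]
      by (simp add: abs_of_nonneg del: abs_divide)
  qed measurable
  have iH: "integrable sphere_measure (\<lambda>x. G x * ?H x)"
    by (rule integrable_sphere_bounded[of _ D]; use bd in \<open>force simp: abs_mult\<close>)
  have "\<bar>(\<integral>x. G x * ?w x \<partial>sphere_measure) - (\<integral>x. G x * ?H x \<partial>sphere_measure)\<bar>
      = \<bar>\<integral>x. G x * ?w x - G x * ?H x \<partial>sphere_measure\<bar>" using i iH by simp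
  also have "\<dots> \<le> (\<integral>x. \<bar>G x * ?w x - G x * ?H x\<bar> \<partial>sphere_measure)" by (rule integral_abs_bound)
  also have "\<dots> \<le> (\<integral>x. D * indicator (trimmed_region t) x \<partial>sphere_measure)"
  proof (rule integral_mono_AE)
    show "integrable sphere_measure (\<lambda>x. D * indicator (trimmed_region t) x :: real)"
      by (intro integrable_mult_right integrable_real_indicator) (auto simp: less_top[symmetric])
    show "AE x in sphere_measure. \<bar>G x * ?w x - G x * ?H x\<bar> \<le> D * indicator (trimmed_region t) x"
      using AE_trimmed_weight[OF t] AE_space
    proof eventually_elim
      case (elim x)
      then have "\<bar>G x\<bar> * \<bar>?w x - ?H x\<bar> \<le> D * indicator (trimmed_region t) x"
        using bd[of x] by (intro mult_mono) auto
      then show ?case by (simp only: abs_mult[symmetric] right_diff_distrib)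
    qed
  qed (use i iH in auto)
  also have "\<dots> = D * measure sphere_measure (trimmed_region t)"
    using sets.sets_into_space[OF sets_trimmed_region[of t]] by (simp add: Int_absorb2)
  finally show ?thesis using integral_even_eq_half[OF G bd even] by simp
qed

end

text \<open>\<open>\<beta>\<close> has a density, so \<open>a \<bullet> \<beta> \<noteq> 0\<close>
  almost surely for \<open>a \<noteq> 0\<close>. The indicator of the event is then almost surely
  continuous at \<open>a\<close>, and dominated convergence applies; the symmetry is the complement
  rule up to ties.\<close>

lemma
  fixes \<beta> :: "'w \<Rightarrow> 'a::euclidean_space"
  assumes P: "prob_space M" and b: "distributed M sphere_measure \<beta> f"
  shows half_space_prob_continuous: "continuous_on (sphere 0 1) (\<lambda>x. measure M {\<omega> \<in> space M. x \<bullet> \<beta> \<omega> \<ge> 0})" (is ?A)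
    and half_space_prob_minus: "x \<noteq> 0 \<Longrightarrow> measure M {\<omega> \<in> space M. - x \<bullet> \<beta> \<omega> \<ge> 0} = 1 - measure M {\<omega> \<in> space M. x \<bullet> \<beta> \<omega> \<ge> 0}"
proof -
  interpret prob_space M by fact
  have b_m: "\<beta> \<in> M \<rightarrow>\<^sub>M sphere_measure" using b by (simp add: distributed_def)
  have [measurable]: "\<beta> \<in> borel_measurable M"
    using measurable_compose[OF b_m measurable_id_sphere] by simp
  have ae: "AE \<omega> in M. x \<bullet> \<beta> \<omega> \<noteq> 0" if "x \<noteq> 0" for x
  proof -
    have f: "f \<in> borel_measurable sphere_measure" using b by (simp add: distributed_def)
    have "AE y in density sphere_measure f. y \<bullet> x \<noteq> 0"
      unfolding AE_density[OF f] using AE_sphere_not_orthogonal[OF that] by eventually_elim simp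
    then have "AE y in distr M sphere_measure \<beta>. y \<bullet> x \<noteq> 0" unfolding distributed_distr_eq_density[OF b] .
    then have "AE \<omega> in M. \<beta> \<omega> \<bullet> x \<noteq> 0" by (rule AE_distrD[OF b_m])
    then show ?thesis by (simp add: inner_commute)
  qed
  show ?A
    unfolding continuous_on_sequentially comp_def
  proof (intro allI ballI impI)
    fix u :: "nat \<Rightarrow> 'a" and a assume a: "a \<in> sphere 0 1" and u: "(\<forall>n. u n \<in> sphere 0 1) \<and> u \<longlonglongrightarrow> a"
    have "(\<lambda>n. \<integral>\<omega>. indicat_real {\<omega> \<in> space M. u n \<bullet> \<beta> \<omega> \<ge> 0} \<omega> \<partial>M)
        \<longlonglongrightarrow> (\<integral>\<omega>. indicat_real {\<omega> \<in> space M. a \<bullet> \<beta> \<omega> \<ge> 0} \<omega> \<partial>M)"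
    proof (rule integral_dominated_convergence[where w="\<lambda>_. 1"])
      have "a \<noteq> 0" using a by auto
      from ae[OF this]
      show "AE \<omega> in M. (\<lambda>n. indicat_real {\<omega> \<in> space M. u n \<bullet> \<beta> \<omega> \<ge> 0} \<omega>) \<longlonglongrightarrow> indicat_real {\<omega> \<in> space M. a \<bullet> \<beta> \<omega> \<ge> 0} \<omega>"
        using AE_space
      proof eventually_elim
        case (elim \<omega>)
        have lim: "(\<lambda>n. u n \<bullet> \<beta> \<omega>) \<longlonglongrightarrow> a \<bullet> \<beta> \<omega>" using u by (intro tendsto_intros) auto
        consider "a \<bullet> \<beta> \<omega> > 0" | "a \<bullet> \<beta> \<omega> < 0" using elim by linarith
        then have "\<forall>\<^sub>F n in sequentially. indicat_real {\<omega> \<in> space M. u n \<bullet> \<beta> \<omega> \<ge> 0} \<omega> = indicat_real {\<omega> \<in> space M. a \<bullet> \<beta> \<omega> \<ge> 0} \<omega>"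
        proof cases
          case 1
          from order_tendstoD(1)[OF lim this] show ?thesis by eventually_elim (use 1 elim in \<open>auto simp: indicator_def\<close>)
        next
          case 2
          from order_tendstoD(2)[OF lim this] show ?thesis by eventually_elim (use 2 elim in \<open>auto simp: indicator_def\<close>)
        qed
        then show ?case by (rule tendsto_eventually)
      qed
    qed (auto simp: indicator_def)
    then show "(\<lambda>n. measure M {\<omega> \<in> space M. u n \<bullet> \<beta> \<omega> \<ge> 0}) \<longlonglongrightarrow> measure M {\<omega> \<in> space M. a \<bullet> \<beta> \<omega> \<ge> 0}"
      by simp
  qed
  show "measure M {\<omega> \<in> space M. - x \<bullet> \<beta> \<omega> \<ge> 0} = 1 - measure M {\<omega> \<in> space M. x \<bullet> \<beta> \<omega> \<ge> 0}" if x: "x \<noteq> 0"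
  proof -
    have "measure M {\<omega> \<in> space M. - x \<bullet> \<beta> \<omega> \<ge> 0} = measure M {\<omega> \<in> space M. \<not> x \<bullet> \<beta> \<omega> \<ge> 0}"
      by (rule finite_measure_eq_AE) (use ae[OF x] in \<open>auto elim!: eventually_mono\<close>)
    also have "\<dots> = 1 - measure M {\<omega> \<in> space M. x \<bullet> \<beta> \<omega> \<ge> 0}"
      by (rule prob_neg) measurable
    finally show ?thesis .
  qed
qed

text \<open>By independence the joint law is a product, and for fixed \<open>x\<close> integrating
  out \<open>\<beta>\<close> turns the sign \<open>2 Y - 1\<close> into twice the response
  probability minus 1.\<close>

lemma (in prob_space) expectation_binary_response:
  fixes \<beta> X :: "'a \<Rightarrow> 'b::euclidean_space"
  assumes X: "distributed M sphere_measure X (\<lambda>x. ennreal (fX x))" and nn: "\<And>x. 0 \<le> fX x"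
    and indep: "indep_var sphere_measure \<beta> sphere_measure X"
    and phi [measurable]: "\<phi> \<in> borel_measurable sphere_measure" and bd: "\<And>x. norm x = 1 \<Longrightarrow> \<bar>\<phi> x\<bar> \<le> D"
  shows "expectation (\<lambda>\<omega>. (2 * (if X \<omega> \<bullet> \<beta> \<omega> \<ge> 0 then 1 else 0) - 1) * \<phi> (X \<omega>))
    = (\<integral>x. (2 * prob {\<omega> \<in> space M. x \<bullet> \<beta> \<omega> \<ge> 0} - 1) * \<phi> x * fX x \<partial>sphere_measure)"
proof -
  have b_m [measurable]: "\<beta> \<in> M \<rightarrow>\<^sub>M sphere_measure" and X_m [measurable]: "X \<in> M \<rightarrow>\<^sub>M sphere_measure"
    and prod: "distr M sphere_measure \<beta> \<Otimes>\<^sub>M distr M sphere_measure X = distr M (sphere_measure \<Otimes>\<^sub>M sphere_measure) (\<lambda>\<omega>. (\<beta> \<omega>, X \<omega>))"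
    using indep unfolding indep_var_distribution_eq by auto
  define h where "h = (\<lambda>p :: 'b \<times> 'b. (2 * (if snd p \<bullet> fst p \<ge> 0 then 1 else 0) - 1) * \<phi> (snd p))"
  have [measurable]: "fst \<in> borel_measurable (sphere_measure \<Otimes>\<^sub>M (sphere_measure :: 'b measure))"
      "snd \<in> borel_measurable ((sphere_measure :: 'b measure) \<Otimes>\<^sub>M sphere_measure)"
    using measurable_compose[OF measurable_fst measurable_id_sphere] measurable_compose[OF measurable_snd measurable_id_sphere]
    by simp_all
  have h [measurable]: "h \<in> borel_measurable (sphere_measure \<Otimes>\<^sub>M sphere_measure)"
    unfolding h_def by measurable
  interpret B: prob_space "distr M sphere_measure \<beta>" by (rule prob_space_distr) simp
  interpret X: prob_space "distr M sphere_measure X" by (rule prob_space_distr) simp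
  interpret BX: pair_prob_space "distr M sphere_measure \<beta>" "distr M sphere_measure X" ..
  have int: "integrable (distr M sphere_measure \<beta> \<Otimes>\<^sub>M distr M sphere_measure X) h"
  proof (rule BX.P.integrable_const_bound)
    show "AE p in distr M sphere_measure \<beta> \<Otimes>\<^sub>M distr M sphere_measure X. norm (h p) \<le> D"
      by (rule AE_I2) (use bd in \<open>auto simp: h_def space_pair_measure abs_mult\<close>)
    show "h \<in> borel_measurable (distr M sphere_measure \<beta> \<Otimes>\<^sub>M distr M sphere_measure X)"
      unfolding prod by simp
  qed
  have inner: "(\<integral>b. h (b, x) \<partial>distr M sphere_measure \<beta>) = (2 * prob {\<omega> \<in> space M. x \<bullet> \<beta> \<omega> \<ge> 0} - 1) * \<phi> x" for x
  proof -
    have bm [measurable]: "\<beta> \<in> borel_measurable M" using measurable_compose[OF b_m measurable_id_sphere] by simp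
    have m: "(\<lambda>b. h (b, x)) \<in> borel_measurable sphere_measure"
      unfolding h_def by simp
    have i: "integrable M (indicat_real {\<omega> \<in> space M. x \<bullet> \<beta> \<omega> \<ge> 0})"
      by (intro integrable_real_indicator) (auto simp: less_top[symmetric])
    have "(\<integral>b. h (b, x) \<partial>distr M sphere_measure \<beta>) = (\<integral>\<omega>. h (\<beta> \<omega>, x) \<partial>M)"
      by (rule integral_distr[OF b_m m])
    also have "\<dots> = (\<integral>\<omega>. (2 * indicat_real {\<omega> \<in> space M. x \<bullet> \<beta> \<omega> \<ge> 0} \<omega> - 1) * \<phi> x \<partial>M)"
      by (intro Bochner_Integration.integral_cong refl) (auto simp: h_def indicator_def)
    also have "\<dots> = (2 * prob {\<omega> \<in> space M. x \<bullet> \<beta> \<omega> \<ge> 0} - 1) * \<phi> x"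
      using i by (simp add: prob_space)
    finally show ?thesis .
  qed
  \<comment> \<open>Measurability in \<open>x\<close> comes from integrating the jointly measurable
    \<open>h\<close> over the law of \<open>\<beta>\<close>.\<close>
  have rm: "(\<lambda>x. (2 * prob {\<omega> \<in> space M. x \<bullet> \<beta> \<omega> \<ge> 0} - 1) * \<phi> x) \<in> borel_measurable sphere_measure"
  proof -
    have h': "(\<lambda>p. h (snd p, fst p)) \<in> borel_measurable (sphere_measure \<Otimes>\<^sub>M distr M sphere_measure \<beta>)"
    proof -
      have "(\<lambda>p. (snd p, fst p)) \<in> sphere_measure \<Otimes>\<^sub>M distr M sphere_measure \<beta> \<rightarrow>\<^sub>M sphere_measure \<Otimes>\<^sub>M sphere_measure"
        by measurable
      from measurable_compose[OF this h] show ?thesis .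
    qed
    have "(\<lambda>x. \<integral>b. h (b, x) \<partial>distr M sphere_measure \<beta>) \<in> borel_measurable sphere_measure"
      by (rule B.borel_measurable_lebesgue_integral) (use h' in \<open>simp add: case_prod_unfold\<close>)
    then show ?thesis by (simp add: inner)
  qed
  have "expectation (\<lambda>\<omega>. (2 * (if X \<omega> \<bullet> \<beta> \<omega> \<ge> 0 then 1 else 0) - 1) * \<phi> (X \<omega>)) = expectation (\<lambda>\<omega>. h (\<beta> \<omega>, X \<omega>))"
    by (simp add: h_def)
  also have "\<dots> = integral\<^sup>L (distr M (sphere_measure \<Otimes>\<^sub>M sphere_measure) (\<lambda>\<omega>. (\<beta> \<omega>, X \<omega>))) h"
    by (rule integral_distr[symmetric]) simp_all
  also have "\<dots> = (\<integral>x. (\<integral>b. h (b, x) \<partial>distr M sphere_measure \<beta>) \<partial>distr M sphere_measure X)"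
    unfolding prod[symmetric] using BX.integral_snd[of "\<lambda>b x. h (b, x)"] int by simp
  also have "\<dots> = (\<integral>x. (2 * prob {\<omega> \<in> space M. x \<bullet> \<beta> \<omega> \<ge> 0} - 1) * \<phi> x \<partial>distr M sphere_measure X)"
    by (simp add: inner)
  also have "\<dots> = expectation (\<lambda>\<omega>. (2 * prob {\<omega>' \<in> space M. X \<omega> \<bullet> \<beta> \<omega>' \<ge> 0} - 1) * \<phi> (X \<omega>))"
    by (rule integral_distr[OF X_m rm])
  also have "\<dots> = (\<integral>x. fX x * ((2 * prob {\<omega> \<in> space M. x \<bullet> \<beta> \<omega> \<ge> 0} - 1) * \<phi> x) \<partial>sphere_measure)"
    by (rule distributed_integral[OF X rm nn, symmetric])
  finally show ?thesis by (simp add: ac_simps)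
qed

context half_sphere_density
begin

text \<open>The factor 2 of \<open>2 * h\<close> is the one that turns the half sphere into the
  whole sphere. The even function \<open>K * h\<close> is bounded by \<open>D / 2\<close>, which
  cancels the 2 in the trimming error.\<close>

lemma trimmed_bias_le:
  fixes h K :: "'a \<Rightarrow> real"
  assumes K [measurable]: "K \<in> borel_measurable sphere_measure" and K_bd: "\<And>z. norm z = 1 \<Longrightarrow> \<bar>K z\<bar> \<le> D"
    and K_odd: "\<And>z. norm z = 1 \<Longrightarrow> K (- z) = - K z"
    and h [measurable]: "h \<in> borel_measurable sphere_measure" and h_bd: "\<And>z. norm z = 1 \<Longrightarrow> \<bar>h z\<bar> \<le> 1/2"
    and h_odd: "\<And>z. norm z = 1 \<Longrightarrow> h (- z) = - h z"
    and t: "t > 0"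
  shows "\<bar>(\<integral>z. 2 * h z * (K z / max (fX z) t) * fX z \<partial>sphere_measure) - (\<integral>z. K z * h z \<partial>sphere_measure)\<bar>
     \<le> D * measure sphere_measure (trimmed_region t)"
proof -
  have m: "(\<lambda>z. K z * h z) \<in> borel_measurable sphere_measure" by measurable
  have bd: "\<bar>K z * h z\<bar> \<le> D / 2" if "norm z = 1" for z
    using mult_mono[OF K_bd[OF that] h_bd[OF that]] K_bd[OF that] by (simp add: abs_mult)
  have "(\<integral>z. 2 * h z * (K z / max (fX z) t) * fX z \<partial>sphere_measure)
      = 2 * (\<integral>z. (K z * h z) * (fX z / max (fX z) t) \<partial>sphere_measure)"
    by (simp flip: integral_mult_right_zero add: ac_simps)
  then show ?thesis
    using trimmed_integral_even[OF m bd _ t] by (simp add: K_odd h_odd)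
qed

text \<open>Of the two denominators in the square, one forms the trimmed weight with
  \<open>fX\<close>, and the other is at most \<open>B\<close> because
  \<open>t \<le> 1 \<le> B\<close>.\<close>

lemma trimmed_second_moment_ge:
  fixes K :: "'a \<Rightarrow> real"
  assumes K [measurable]: "K \<in> borel_measurable sphere_measure" and K_bd: "\<And>z. norm z = 1 \<Longrightarrow> \<bar>K z\<bar> \<le> D"
    and K_odd: "\<And>z. norm z = 1 \<Longrightarrow> K (- z) = - K z"
    and t: "0 < t" "t \<le> 1" and B: "B \<ge> 1" "\<And>z. norm z = 1 \<Longrightarrow> fX z \<le> B"
  shows "(\<integral>z. (K z)\<^sup>2 \<partial>sphere_measure) / 2 - D\<^sup>2 * measure sphere_measure (trimmed_region t)
    \<le> B * (\<integral>z. fX z * (K z / max (fX z) t)\<^sup>2 \<partial>sphere_measure)"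
proof -
  have m: "(\<lambda>z. (K z)\<^sup>2) \<in> borel_measurable sphere_measure" by measurable
  have bd: "\<bar>(K z)\<^sup>2\<bar> \<le> D\<^sup>2" if "norm z = 1" for z
    using K_bd[OF that] by (metis abs_ge_zero abs_power2 power2_abs power_mono)
  have 1: "(\<integral>z. (K z)\<^sup>2 \<partial>sphere_measure) / 2 - D\<^sup>2 * measure sphere_measure (trimmed_region t)
    \<le> (\<integral>z. (K z)\<^sup>2 * (fX z / max (fX z) t) \<partial>sphere_measure)"
    using trimmed_integral_even[OF m bd _ t(1)] by (simp add: K_odd abs_le_iff)
  have "(\<integral>z. (K z)\<^sup>2 * (fX z / max (fX z) t) \<partial>sphere_measure)
     \<le> (\<integral>z. B * (fX z * (K z / max (fX z) t)\<^sup>2) \<partial>sphere_measure)"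
  proof (rule integral_mono)
    have w: "0 \<le> fX z / max (fX z) t" "fX z / max (fX z) t \<le> 1" for z
      using trimmed_weight_bounds[OF t(1)] by auto
    show "integrable sphere_measure (\<lambda>z. (K z)\<^sup>2 * (fX z / max (fX z) t))"
    proof (rule integrable_sphere_bounded)
      show "\<bar>(K z)\<^sup>2 * (fX z / max (fX z) t)\<bar> \<le> D\<^sup>2 * 1" if "norm z = 1" for z
        unfolding abs_mult abs_of_nonneg[OF w(1)] by (intro mult_mono bd that w) auto
    qed measurable
    show "integrable sphere_measure (\<lambda>z. B * (fX z * (K z / max (fX z) t)\<^sup>2))"
    proof (intro integrable_mult_right integrable_sphere_bounded)
      show "\<bar>fX z * (K z / max (fX z) t)\<^sup>2\<bar> \<le> B * (D\<^sup>2 / t\<^sup>2)" if "norm z = 1" for z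
      proof -
        have "\<bar>(K z / max (fX z) t)\<^sup>2\<bar> \<le> D\<^sup>2 / t\<^sup>2"
          unfolding power_divide using bd[OF that] t by (auto intro!: frac_le power_mono)
        then show ?thesis unfolding abs_mult using B fX_nonneg[of z] that by (intro mult_mono) auto
      qed
    qed measurable
    fix z :: 'a assume "z \<in> space sphere_measure"
    then have z: "norm z = 1" by simp
    have mp: "max (fX z) t > 0" "max (fX z) t \<le> B" using t B z by auto
    have "(K z)\<^sup>2 * (fX z / max (fX z) t) = max (fX z) t * (fX z * (K z / max (fX z) t)\<^sup>2)"
      using mp by (simp add: power_divide power2_eq_square)
    also have "\<dots> \<le> B * (fX z * (K z / max (fX z) t)\<^sup>2)"
      using mp fX_nonneg[of z] by (intro mult_right_mono) auto
    finally show "(K z)\<^sup>2 * (fX z / max (fX z) t) \<le> B * (fX z * (K z / max (fX z) t)\<^sup>2)" .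
  qed
  then show ?thesis using 1 by simp
qed

text \<open>The density cancels the denominator up to a factor of at most 1, so first absolute
  moments are controlled by (K1) even where trimming leaves the summands large.\<close>

lemma trimmed_abs_moment_le:
  fixes K :: "'a \<Rightarrow> real"
  assumes K [measurable]: "K \<in> borel_measurable sphere_measure" and K_bd: "\<And>z. norm z = 1 \<Longrightarrow> \<bar>K z\<bar> \<le> D"
    and t: "0 < t"
  shows "(\<integral>z. fX z * \<bar>K z / max (fX z) t\<bar> \<partial>sphere_measure) \<le> (\<integral>z. \<bar>K z\<bar> \<partial>sphere_measure)"
proof (rule integral_mono')
  show "integrable sphere_measure (\<lambda>z. \<bar>K z\<bar>)"
    by (intro integrable_abs integrable_sphere_bounded[OF K K_bd])
  fix z
  have "fX z * \<bar>K z / max (fX z) t\<bar> = \<bar>K z\<bar> * (fX z / max (fX z) t)"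
    using t by (simp add: abs_divide abs_of_pos)
  also have "\<dots> \<le> \<bar>K z\<bar> * 1"
    using trimmed_weight_bounds[OF t, of z] by (intro mult_left_mono) auto
  finally show "fX z * \<bar>K z / max (fX z) t\<bar> \<le> \<bar>K z\<bar>" by simp
qed simp

end

text \<open>Only the numerical orders enter: \<open>P\<close> is \<open>T powr ((d - 1) / 2)\<close>, \<open>S\<close> the measure of the
  trimmed region, \<open>m\<close> and \<open>q\<close> the first two moments of a summand.\<close>
lemma eventually_sd_ge:
  fixes P S m q :: "nat \<Rightarrow> real"
  assumes P: "\<And>n. P n > 0" "(\<lambda>n. 1 / (P n)\<^sup>2) \<longlonglongrightarrow> 0" and PS: "(\<lambda>n. (P n)\<^sup>2 * S n) \<longlonglongrightarrow> 0"
    and c: "c > 0" "B > 0"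
    and q: "\<forall>\<^sub>F n in sequentially. c * (P n)\<^sup>2 - C * (P n)\<^sup>2 * ((P n)\<^sup>2 * S n) \<le> B * q n"
    and m: "\<forall>\<^sub>F n in sequentially. \<bar>m n\<bar> \<le> b"
  obtains c1 where "c1 > 0" "\<forall>\<^sub>F n in sequentially. c1 * P n \<le> sqrt (q n - (m n)\<^sup>2)"
proof
  \<comment> \<open>After division by \<open>(P n)\<^sup>2\<close> the lower bound of the variance
    tends to \<open>c / B\<close>; half of it is kept.\<close>
  show "sqrt (c / (2 * B)) > 0" using c by simp
  have "(\<lambda>n. (c - C * ((P n)\<^sup>2 * S n)) / B - b\<^sup>2 * (1 / (P n)\<^sup>2)) \<longlonglongrightarrow> (c - C * 0) / B - b\<^sup>2 * 0"
    by (intro tendsto_intros PS P) (use c in auto)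
  moreover have "c / (2 * B) < (c - C * 0) / B - b\<^sup>2 * 0" using c by (simp add: field_simps)
  ultimately have "\<forall>\<^sub>F n in sequentially. c / (2 * B) < (c - C * ((P n)\<^sup>2 * S n)) / B - b\<^sup>2 * (1 / (P n)\<^sup>2)"
    by (rule order_tendstoD(1))
  then show "\<forall>\<^sub>F n in sequentially. sqrt (c / (2 * B)) * P n \<le> sqrt (q n - (m n)\<^sup>2)"
    using q m
  proof eventually_elim
    case (elim n)
    have P2: "(P n)\<^sup>2 > 0" using P(1)[of n] by simp
    have "(m n)\<^sup>2 \<le> b\<^sup>2" using elim(3) by (metis abs_ge_zero power2_abs power_mono)
    moreover have "(c - C * ((P n)\<^sup>2 * S n)) / B * (P n)\<^sup>2 \<le> q n"
      using elim(2) c by (simp add: field_simps)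
    moreover have "c / (2 * B) * (P n)\<^sup>2 \<le> ((c - C * ((P n)\<^sup>2 * S n)) / B - b\<^sup>2 * (1 / (P n)\<^sup>2)) * (P n)\<^sup>2"
      using elim(1) P2 by (intro mult_right_mono) auto
    moreover have "((c - C * ((P n)\<^sup>2 * S n)) / B - b\<^sup>2 * (1 / (P n)\<^sup>2)) * (P n)\<^sup>2
        = (c - C * ((P n)\<^sup>2 * S n)) / B * (P n)\<^sup>2 - b\<^sup>2"
      using P2 by (simp add: left_diff_distrib)
    ultimately have "c / (2 * B) * (P n)\<^sup>2 \<le> q n - (m n)\<^sup>2" by linarith
    then have "sqrt (c / (2 * B) * (P n)\<^sup>2) \<le> sqrt (q n - (m n)\<^sup>2)" by (rule real_sqrt_le_mono)
    then show ?case unfolding real_sqrt_mult real_sqrt_abs using P(1)[of n] by (simp only: abs_of_pos)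
  qed
qed

text \<open>Undersmoothing, condition (c), forces \<open>T\<close> to infinity.\<close>
lemma powr_neg_tendsto_0_of_rate:
  fixes T :: "nat \<Rightarrow> nat"
  assumes T: "\<And>n. T n \<ge> 1" and a: "a > 0" and k: "k > 0"
    and rate: "(\<lambda>n. real n powr (1/2) * real (T n) powr (- a)) \<longlonglongrightarrow> 0"
  shows "(\<lambda>n. real (T n) powr (- k)) \<longlonglongrightarrow> 0"
proof -
  have "(\<lambda>n. real n powr (- (1/2))) \<longlonglongrightarrow> 0"
    by (rule tendsto_neg_powr) (auto simp: filterlim_real_sequentially)
  from tendsto_mult[OF this rate]
  have "(\<lambda>n. real n powr (- (1/2)) * (real n powr (1/2) * real (T n) powr (- a))) \<longlonglongrightarrow> 0" by simp
  then have "(\<lambda>n. real (T n) powr (- a)) \<longlonglongrightarrow> 0"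
  proof (rule Lim_transform_eventually)
    show "\<forall>\<^sub>F n in sequentially. real n powr (- (1/2)) * (real n powr (1/2) * real (T n) powr (- a)) = real (T n) powr (- a)"
      using eventually_gt_at_top[of 0] by eventually_elim (simp add: powr_minus field_simps)
  qed
  then have "(\<lambda>n. (real (T n) powr (- a)) powr (k / a)) \<longlonglongrightarrow> 0"
    by (rule tendsto_zero_powrI[OF _ tendsto_const]) (use a k in auto)
  then show ?thesis using a by (simp add: powr_powr)
qed

theorem theorem4p3:
  fixes M :: "'w measure"
    and \<beta> X :: "'w \<Rightarrow> 'a::euclidean_space"
    and e :: 'a
    and f\<beta> fX :: "'a \<Rightarrow> real"
    and Y :: "'w \<Rightarrow> real"
    and r R :: "'a \<Rightarrow> real"
    and ys :: "nat \<Rightarrow> 'w \<Rightarrow> real"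
    and xs :: "nat \<Rightarrow> 'w \<Rightarrow> 'a"
    and fhat :: "nat \<Rightarrow> 'w \<Rightarrow> 'a \<Rightarrow> real"
    and rt \<tau> :: real
    and T :: "nat \<Rightarrow> nat"
    and wt :: "nat \<Rightarrow> nat \<Rightarrow> real"
    and trim :: "nat \<Rightarrow> real"
    and Rhat :: "nat \<Rightarrow> 'w \<Rightarrow> 'a \<Rightarrow> real"
    and MN :: "nat \<Rightarrow> 'w \<Rightarrow> real"
    and s1 :: "nat \<Rightarrow> 'a \<Rightarrow> real"
  assumes dim: "DIM('a) \<ge> 2"
    and e_first: "e \<in> Basis"
    and tau_pos: "\<tau> > 0"
    \<comment> \<open>Setup (M)\<close>
    and P: "prob_space M"
    and beta_distr: "distributed M sphere_measure \<beta> (\<lambda>b. ennreal (f\<beta> b))"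
    and X_distr: "distributed M sphere_measure X (\<lambda>x. ennreal (fX x))"
    and indep: "prob_space.indep_var M sphere_measure \<beta> sphere_measure X"
    and fX_nonneg: "\<forall>x. 0 \<le> fX x"
    and fX_pos: "AE x in sphere_measure. x \<bullet> e \<ge> 0 \<longrightarrow> fX x > 0"
    and fX_zero: "\<forall>x\<in>sphere 0 1. x \<bullet> e < 0 \<longrightarrow> fX x = 0"
    and Y_def: "Y = (\<lambda>\<omega>. if X \<omega> \<bullet> \<beta> \<omega> \<ge> 0 then 1 else 0)"
    and r_def: "r = (\<lambda>x. measure M {\<omega> \<in> space M. x \<bullet> \<beta> \<omega> \<ge> 0})"
    and R_def: "R = (\<lambda>x. if x \<bullet> e \<ge> 0 then r x else 1 - r (- x))"
    \<comment> \<open>i.i.d. data\<close>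
    and data_indep: "prob_space.indep_vars M (\<lambda>_. borel \<Otimes>\<^sub>M sphere_measure)
                        (\<lambda>i \<omega>. (ys i \<omega>, xs i \<omega>)) UNIV"
    and data_distr: "\<forall>i. distr M (borel \<Otimes>\<^sub>M sphere_measure) (\<lambda>\<omega>. (ys i \<omega>, xs i \<omega>))
                        = distr M (borel \<Otimes>\<^sub>M sphere_measure) (\<lambda>\<omega>. (Y \<omega>, X \<omega>))"
    \<comment> \<open>the estimator of fX is a (measurable) function of the first N observations\<close>
    and fhat_est: "\<forall>N. \<exists>F :: (nat \<Rightarrow> real \<times> 'a) \<Rightarrow> 'a \<Rightarrow> real.
         (\<lambda>p. F (fst p) (snd p)) \<in> borel_measurable
            (PiM {..<N} (\<lambda>_. borel \<Otimes>\<^sub>M sphere_measure) \<Otimes>\<^sub>M sphere_measure) \<and>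
         (\<forall>\<omega>\<in>space M. \<forall>x\<in>sphere 0 1.
            fhat N \<omega> x = F (restrict (\<lambda>i. (ys i \<omega>, xs i \<omega>)) {..<N}) x)"
    and rt_pos: "rt > 0"
    and T_pos: "\<forall>N. T N \<ge> 1"
    \<comment> \<open>kernel conditions\<close>
    and K1: "K1 wt TYPE('a)"
    and K2: "K2 wt TYPE('a)"
    and K3: "K3_inf wt \<tau> TYPE('a)"
    and K4: "K4 wt"
    and R_smooth: "sobolev_Linf \<tau> R"
    \<comment> \<open>estimator and auxiliary quantities\<close>
    and trim_def: "trim = (\<lambda>N. ln (real N) powr (- rt))"
    and Rhat_def: "Rhat = (\<lambda>N \<omega> x. 1 / 2 + (1 / real N) *
         (\<Sum>i<N. (2 * ys i \<omega> - 1) * Kodd wt (T N) (xs i \<omega>) x / max (fhat N \<omega> (xs i \<omega>)) (trim N)))"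
    and MN_def: "MN = (\<lambda>N \<omega>. Max ((\<lambda>i. \<bar>max (fX (xs i \<omega>)) (trim N) / max (fhat N \<omega> (xs i \<omega>)) (trim N) - 1\<bar>)
                                  ` {..<N}))"
    and s1_def: "s1 = (\<lambda>N x. sqrt (prob_space.variance M
         (\<lambda>\<omega>. (2 * Y \<omega> - 1) * Kodd wt (T N) (X \<omega>) x / max (fX (X \<omega>)) (trim N))))"
    \<comment> \<open>rate conditions (a)-(d)\<close>
    and cond_a: "o_p1 M (\<lambda>N \<omega>. real N powr (1 / 2) * real (T N) powr (- (real DIM('a) - 1) / 2)
                            * ln (real N) powr rt * MN N \<omega>)"
    and cond_b: "\<exists>\<epsilon>>0. (\<lambda>N. real N powr (- 1 / 2) * real (T N) powr ((real DIM('a) - 1) / 2)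
                            * ln (real N) powr (rt + \<epsilon>)) \<longlonglongrightarrow> 0"
    and cond_c: "(\<lambda>N. real N powr (1 / 2) * real (T N) powr (- (2 * \<tau> + real DIM('a) - 1) / 2))
                   \<longlonglongrightarrow> 0"
    and cond_d1: "(\<lambda>N. real N powr (1 / 2) * real (T N) powr ((real DIM('a) - 1) / 2)
                    * measure sphere_measure {x \<in> sphere 0 1. 0 < fX x \<and> fX x < trim N}) \<longlonglongrightarrow> 0"
    and cond_d2: "\<exists>B. \<forall>x\<in>sphere 0 1. x \<bullet> e \<ge> 0 \<longrightarrow> fX x \<le> B"
  shows "\<forall>x\<in>sphere 0 1.
           weak_conv_m (\<lambda>N. distr M borel (\<lambda>\<omega>. real N powr (1 / 2) / s1 N x * (Rhat N \<omega> x - R x)))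
                       std_normal_distribution"
proof
  fix x :: 'a assume "x \<in> sphere 0 1"
  then have x: "norm x = 1" by simp
  interpret prob_space M by (rule P)
  have fX_m [measurable]: "fX \<in> borel_measurable sphere_measure"
    using distributed_real_measurable[OF _ X_distr] fX_nonneg by blast
  have e0: "e \<noteq> 0" using e_first nonzero_Basis by auto
  interpret D: half_sphere_density e fX
    using e0 fX_m fX_nonneg fX_pos fX_zero by unfold_locales auto
  let ?d = "DIM('a)"
  define k where "k = ?d - 2"
  have dk: "?d = k + 2" using dim by (simp add: k_def)
  have wt0: "\<And>n T. wt n T \<ge> 0" and wt01: "\<And>n T. 0 \<le> wt n T \<and> wt n T \<le> 1" using K4 by (auto simp: K4_def)

  \<comment> \<open>Measurability of the model variables\<close>
  have b_m: "\<beta> \<in> M \<rightarrow>\<^sub>M sphere_measure" and X_m [measurable]: "X \<in> M \<rightarrow>\<^sub>M sphere_measure"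
    using beta_distr X_distr by (simp_all add: distributed_def)
  have X_sph: "norm (X \<omega>) = 1" if "\<omega> \<in> space M" for \<omega>
    using measurable_space[OF X_m that] by simp
  have [measurable]: "\<beta> \<in> borel_measurable M" "X \<in> borel_measurable M"
    using measurable_compose[OF b_m measurable_id_sphere] measurable_compose[OF X_m measurable_id_sphere] by simp_all
  have Y_m [measurable]: "Y \<in> borel_measurable M" unfolding Y_def by measurable

  \<comment> \<open>The response probability on the whole sphere\<close>
  have r_cont: "continuous_on (sphere 0 1) r"
    unfolding r_def by (rule half_space_prob_continuous[OF P beta_distr])
  have r_minus: "r (- z) = 1 - r z" if "norm z = 1" for z
  proof -
    have "z \<noteq> 0" using that by auto
    then show ?thesis unfolding r_def by (rule half_space_prob_minus[OF P beta_distr])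
  qed
  have Rr: "R z = r z" if "norm z = 1" for z using r_minus[OF that] by (simp add: R_def)
  have R_cont: "continuous_on (sphere 0 1) R"
    using r_cont by (rule continuous_on_eq) (simp add: Rr)
  \<comment> \<open>The form in which \<open>odd_part_approximation\<close> treats \<open>R\<close>;
    on the sphere it is \<open>r - 1/2\<close>.\<close>
  define h where "h z = (R z - R (- z)) / 2" for z
  have h_r: "h z = r z - 1 / 2" if "norm z = 1" for z
    using that r_minus[OF that] by (simp add: h_def Rr)
  have h_odd: "h (- z) = - h z" for z unfolding h_def minus_minus by (simp only: minus_divide_left minus_diff_eq)
  have h_bd: "\<bar>h z\<bar> \<le> 1 / 2" if "norm z = 1" for z
  proof -
    have "0 \<le> r z" "r z \<le> 1" by (auto simp: r_def)
    then show ?thesis unfolding abs_le_iff h_r[OF that] by linarith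
  qed
  have h_cont: "continuous_on (sphere 0 1) h"
    using continuous_on_diff[OF r_cont continuous_on_const[of _ "1/2"]] by (rule continuous_on_eq) (simp add: h_r)
  have h_m: "h \<in> borel_measurable sphere_measure" by (rule measurable_sphere_continuous[OF h_cont])

  \<comment> \<open>Constants of the kernel and density bounds\<close>
  obtain C where C: "C > 0" "\<And>T. Kodd_diag wt T (k + 2) \<le> C * real T ^ (k + 1)"
    by (rule Kodd_diag_le[where wt=wt and k=k, OF wt01]) blast
  obtain c where c: "c > 0" "\<And>T (x::'a). T \<ge> 1 \<Longrightarrow> norm x = 1 \<Longrightarrow>
    c * real T ^ (?d - 1) \<le> (\<integral>z. (Kodd wt T z x)\<^sup>2 \<partial>sphere_measure)"
    by (rule integral_sq_Kodd_ge[OF dim K4]) blast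
  obtain B1 where B1: "B1 > 0" "\<And>T (x::'a). norm x = 1 \<Longrightarrow> (\<integral>z. \<bar>Kodd wt T z x\<bar> \<partial>sphere_measure) \<le> B1"
    by (rule integral_abs_Kodd_le[where wt=wt, OF dim K1 wt0]) blast
  obtain C3 where C3: "C3 > 0" "\<And>T x. T \<ge> 1 \<Longrightarrow> norm x = 1 \<Longrightarrow>
    \<bar>(R x - R (- x)) / 2 - (\<integral>y. Kker wt T x y * ((R y - R (- y)) / 2) \<partial>sphere_measure)\<bar>
      \<le> C3 * real T powr (- \<tau>)"
    by (rule odd_part_approximation[OF dim K2 K3 R_smooth R_cont]) blast
  obtain B where B: "B \<ge> 1" "\<And>z. norm z = 1 \<Longrightarrow> fX z \<le> B"
  proof -
    obtain b where b: "\<forall>x\<in>sphere 0 1. x \<bullet> e \<ge> 0 \<longrightarrow> fX x \<le> b" using cond_d2 by auto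
    \<comment> \<open>At least 1, so that the bound also covers a trimming level up to 1; on the
      opposite half sphere the density is 0.\<close>
    have "fX z \<le> max b 1" if "norm z = 1" for z
      using b fX_zero that by (cases "z \<bullet> e \<ge> 0") (auto simp: le_max_iff_disj)
    then show ?thesis using that[of "max b 1"] by auto
  qed

  \<comment> \<open>Orders of magnitude and the summand with known density\<close>
  define p where "p N = real (T N) powr ((real ?d - 1) / 2)" for N
  define L where "L N = ln (real N) powr rt" for N
  define S where "S N = measure sphere_measure (D.trimmed_region (trim N))" for N
  define K where "K N z = Kodd wt (T N) z x" for N z
  define \<phi> where "\<phi> N z = K N z / max (fX z) (trim N)" for N z
  \<comment> \<open>\<open>fst v\<close> is the response and \<open>snd v\<close> the covariate. The
    true density is used, so the values of \<open>g N\<close> along the sample are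
    independent.\<close>
  define g where "g N = (\<lambda>v :: real \<times> 'a. (2 * fst v - 1) * \<phi> N (snd v))" for N
  define m where "m N = expectation (\<lambda>\<omega>. g N (Y \<omega>, X \<omega>))" for N
  define dg where "dg N = Kodd_diag wt (T N) ?d" for N
  define s where "s N = s1 N x" for N

  have T1: "real (T N) \<ge> 1" for N using T_pos[rule_format, of N] by simp
  have p_pos: "p N > 0" for N using T1[of N] by (simp add: p_def)
  have p_sq: "(p N)\<^sup>2 = real (T N) ^ (k + 1)" for N
  proof -
    have "(p N)\<^sup>2 = real (T N) powr (real (k + 1))"
      unfolding p_def power2_eq_square powr_add[symmetric] by (simp add: dk)
    then show ?thesis using T1[of N] by (subst (asm) powr_realpow) auto
  qed
  \<comment> \<open>From \<open>N = 3 > exp 1\<close> on, \<open>ln N \<ge> 1\<close>; hence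
    \<open>L N \<ge> 1\<close> and the trimming level is at most 1.\<close>
  have lnN: "ln (real N) \<ge> 1" if "N \<ge> 3" for N
  proof -
    have "exp 1 \<le> real N" using exp_le that by linarith
    then show ?thesis using that by (subst ln_ge_iff) auto
  qed
  have L_ge: "L N \<ge> 1" if "N \<ge> 3" for N
    unfolding L_def using ge_one_powr_ge_zero[OF lnN[OF that]] rt_pos by simp
  have trimL: "trim N = 1 / L N" for N by (simp add: trim_def L_def powr_minus_divide)
  have trim: "trim N > 0" "trim N \<le> 1" if "N \<ge> 3" for N
    using L_ge[OF that] by (auto simp: trimL)

  \<comment> \<open>The rate conditions in terms of \<open>p\<close>, \<open>L\<close> and
    \<open>S\<close>\<close>
  have sq: "real N powr (1/2) = sqrt (real N)" for N by (simp add: powr_half_sqrt)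
  obtain \<epsilon> where eps: "\<epsilon> > 0" and cb: "(\<lambda>N. real N powr (- 1 / 2) * p N * ln (real N) powr (rt + \<epsilon>)) \<longlonglongrightarrow> 0"
    using cond_b unfolding p_def by auto
  have sqm: "real N powr (- 1 / 2) = 1 / sqrt (real N)" for N
    using powr_minus_divide[of "real N" "1/2"] by (simp add: powr_half_sqrt)
  have rate_b: "(\<lambda>N. p N * L N / sqrt (real N)) \<longlonglongrightarrow> 0"
  proof (rule Lim_null_comparison[OF _ cb])
    show "\<forall>\<^sub>F N in sequentially. norm (p N * L N / sqrt (real N)) \<le> real N powr (- 1 / 2) * p N * ln (real N) powr (rt + \<epsilon>)"
      using eventually_ge_at_top[of 3]
    proof eventually_elim
      case (elim N)
      have "L N \<le> ln (real N) powr (rt + \<epsilon>)" unfolding L_def using lnN[OF elim] eps by (intro powr_mono) auto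
      then have "\<bar>p N * L N / sqrt (real N)\<bar> \<le> p N * ln (real N) powr (rt + \<epsilon>) / sqrt (real N)"
        using p_pos[of N] L_ge[OF elim] by (auto simp: abs_mult intro!: divide_right_mono mult_left_mono)
      also have "\<dots> = real N powr (- 1 / 2) * p N * ln (real N) powr (rt + \<epsilon>)" unfolding sqm by simp
      finally show ?case by (simp only: real_norm_def)
    qed
  qed
  have rate_b': "(\<lambda>N. p N / sqrt (real N)) \<longlonglongrightarrow> 0"
  proof (rule Lim_null_comparison[OF _ rate_b])
    show "\<forall>\<^sub>F N in sequentially. norm (p N / sqrt (real N)) \<le> p N * L N / sqrt (real N)"
      using eventually_ge_at_top[of 3]
    proof eventually_elim
      case (elim N)
      have "p N * 1 / sqrt (real N) \<le> p N * L N / sqrt (real N)"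
        using p_pos[of N] L_ge[OF elim] by (intro divide_right_mono mult_left_mono) auto
      then show ?case using p_pos[of N] by simp
    qed
  qed
  have rate_c: "(\<lambda>N. sqrt (real N) * (real (T N) powr (- \<tau>) / p N)) \<longlonglongrightarrow> 0"
  proof -
    have "real (T N) powr (- (2 * \<tau> + real ?d - 1) / 2) = real (T N) powr (- \<tau>) / p N" for N
    proof -
      have "- (2 * \<tau> + real ?d - 1) / 2 = - \<tau> + - ((real ?d - 1) / 2)" by (simp add: field_simps)
      then show ?thesis by (simp only: powr_add powr_minus_divide p_def times_divide_eq_right mult_1_right)
    qed
    then show ?thesis using cond_c by (simp add: sq)
  qed
  have rate_d: "(\<lambda>N. sqrt (real N) * p N * S N) \<longlonglongrightarrow> 0"
    using cond_d1 by (simp add: sq p_def S_def D.trimmed_region_def)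
  have p_inf: "(\<lambda>N. 1 / (p N)\<^sup>2) \<longlonglongrightarrow> 0"
  proof -
    have "(\<lambda>N. real (T N) powr (- (real k + 1))) \<longlonglongrightarrow> 0"
    proof (rule powr_neg_tendsto_0_of_rate)
      show "(2 * \<tau> + real ?d - 1) / 2 > 0" using tau_pos by (simp add: dk)
      show "(\<lambda>n. real n powr (1/2) * real (T n) powr (- ((2 * \<tau> + real ?d - 1) / 2))) \<longlonglongrightarrow> 0"
        using cond_c by (simp only: minus_divide_left)
    qed (use T_pos in auto)
    moreover have "real (T N) powr (- (real k + 1)) = 1 / (p N)\<^sup>2" for N
    proof -
      have "real (T N) powr (real (k + 1)) = real (T N) ^ (k + 1)"
        using T1[of N] by (subst powr_realpow) auto
      then show ?thesis unfolding p_sq powr_minus_divide by (simp add: add.commute)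
    qed
    ultimately show ?thesis by simp
  qed
  \<comment> \<open>The factors \<open>sqrt N\<close> of (b) and (d) cancel in the product.\<close>
  have pS: "(\<lambda>N. (p N)\<^sup>2 * S N) \<longlonglongrightarrow> 0"
  proof -
    have "(\<lambda>N. (p N / sqrt (real N)) * (sqrt (real N) * p N * S N)) \<longlonglongrightarrow> 0 * 0"
      by (intro tendsto_mult rate_b' rate_d)
    moreover have "\<forall>\<^sub>F N in sequentially. (p N / sqrt (real N)) * (sqrt (real N) * p N * S N) = (p N)\<^sup>2 * S N"
      using eventually_gt_at_top[of 0] by eventually_elim (simp add: power2_eq_square)
    ultimately show ?thesis by (simp add: Lim_transform_eventually)
  qed

  \<comment> \<open>Bounds on the kernel\<close>
  have K_m [measurable]: "K N \<in> borel_measurable sphere_measure" for N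
    unfolding K_def[abs_def] by (rule borel_measurable_Kodd[OF x])
  have K_bd: "\<bar>K N z\<bar> \<le> dg N" if "norm z = 1" for N z
    unfolding K_def dg_def by (rule abs_Kodd_le[where wt=wt, OF dim that x wt0])
  have K_odd: "K N (- z) = - K N z" if "norm z = 1" for N z
    unfolding K_def by (rule Kodd_minus[OF dim that x])
  have dg_le: "dg N \<le> C * (p N)\<^sup>2" for N using C(2)[of "T N"] by (simp add: dg_def dk p_sq)
  have dg0: "dg N \<ge> 0" for N using K_bd[OF x, of N] by linarith
  have K_sq: "c * (p N)\<^sup>2 \<le> (\<integral>z. (K N z)\<^sup>2 \<partial>sphere_measure)" for N
    using c(2)[OF _ x, of "T N"] T_pos by (simp add: K_def p_sq dk)
  have K_abs: "(\<integral>z. \<bar>K N z\<bar> \<partial>sphere_measure) \<le> B1" for N unfolding K_def by (rule B1(2)[OF x])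
  have phi_m [measurable]: "\<phi> N \<in> borel_measurable sphere_measure" for N unfolding \<phi>_def[abs_def] by measurable
  have phi_bd: "\<bar>\<phi> N z\<bar> \<le> dg N * L N" if "norm z = 1" "N \<ge> 3" for N z
  proof -
    have "\<bar>\<phi> N z\<bar> = \<bar>K N z\<bar> / max (fX z) (trim N)"
      using trim(1)[OF that(2)] by (simp add: \<phi>_def abs_divide abs_of_pos)
    also have "\<dots> \<le> dg N / trim N"
      using K_bd[OF that(1)] trim(1)[OF that(2)] dg0 by (intro frac_le) auto
    finally show ?thesis by (simp add: trimL)
  qed

  \<comment> \<open>Moments of a summand and its standard deviation\<close>
  have g_m [measurable]: "g N \<in> borel_measurable (borel \<Otimes>\<^sub>M sphere_measure)" for N
    unfolding g_def by measurable
  have YX_m [measurable]: "(\<lambda>\<omega>. (Y \<omega>, X \<omega>)) \<in> M \<rightarrow>\<^sub>M borel \<Otimes>\<^sub>M sphere_measure" by measurable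
  \<comment> \<open>\<open>2 Y - 1\<close> is a sign, so absolute and second moments involve the law
    of \<open>X\<close> alone.\<close>
  have abs_g: "\<bar>g N (Y \<omega>, X \<omega>)\<bar> = \<bar>\<phi> N (X \<omega>)\<bar>" for N \<omega>
    by (simp add: g_def abs_mult Y_def)
  have g_bd: "\<bar>g N (Y \<omega>, X \<omega>)\<bar> \<le> dg N * L N" if "\<omega> \<in> space M" "N \<ge> 3" for N \<omega>
    unfolding abs_g by (rule phi_bd[OF X_sph[OF that(1)] that(2)])
  have g_int: "integrable M (\<lambda>\<omega>. g N (Y \<omega>, X \<omega>))" if "N \<ge> 3" for N
    by (rule integrable_const_bound[of _ "dg N * L N"]) (use g_bd that in auto)
  have g2_int: "integrable M (\<lambda>\<omega>. (g N (Y \<omega>, X \<omega>))\<^sup>2)" if "N \<ge> 3" for N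
  proof (rule integrable_const_bound[of _ "(dg N * L N)\<^sup>2"])
    show "AE \<omega> in M. norm ((g N (Y \<omega>, X \<omega>))\<^sup>2) \<le> (dg N * L N)\<^sup>2"
    proof (rule AE_I2)
      fix \<omega> assume "\<omega> \<in> space M"
      from g_bd[OF this that] show "norm ((g N (Y \<omega>, X \<omega>))\<^sup>2) \<le> (dg N * L N)\<^sup>2"
        by (metis abs_ge_zero norm_power power_mono real_norm_def)
    qed
  qed measurable
  have m_eq: "m N = (\<integral>z. 2 * h z * (K N z / max (fX z) (trim N)) * fX z \<partial>sphere_measure)" if "N \<ge> 3" for N
  proof -
    have "m N = expectation (\<lambda>\<omega>. (2 * (if X \<omega> \<bullet> \<beta> \<omega> \<ge> 0 then 1 else 0) - 1) * \<phi> N (X \<omega>))"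
      by (simp add: m_def g_def Y_def)
    also have "\<dots> = (\<integral>z. (2 * r z - 1) * \<phi> N z * fX z \<partial>sphere_measure)"
      unfolding r_def by (rule expectation_binary_response[OF X_distr _ indep phi_m phi_bd])
        (use fX_nonneg that in auto)
    also have "\<dots> = (\<integral>z. 2 * h z * (K N z / max (fX z) (trim N)) * fX z \<partial>sphere_measure)"
      by (intro Bochner_Integration.integral_cong refl) (simp add: h_r \<phi>_def)
    finally show ?thesis .
  qed
  \<comment> \<open>\<open>m N + 1 / 2\<close> is the mean of the estimator with known density.
    Trimming costs the sup norm of the kernel, of order \<open>(p N)\<^sup>2\<close>, times
    \<open>S N\<close>; the smoothing part is (K3) at degree \<open>2 T\<close>, weakened to
    \<open>T powr (- \<tau>)\<close>.\<close>
  have bias: "\<bar>m N + 1 / 2 - R x\<bar> \<le> C * (p N)\<^sup>2 * S N + C3 * real (T N) powr (- \<tau>)" if N: "N \<ge> 3" for N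
  proof -
    have "\<bar>m N - (\<integral>z. K N z * h z \<partial>sphere_measure)\<bar> \<le> dg N * S N"
      unfolding m_eq[OF N] S_def
      by (rule D.trimmed_bias_le[OF K_m K_bd K_odd h_m h_bd h_odd trim(1)[OF N]])
    also have "\<dots> \<le> C * (p N)\<^sup>2 * S N" using dg_le by (intro mult_right_mono) (auto simp: S_def)
    finally have 1: "\<bar>m N - (\<integral>z. K N z * h z \<partial>sphere_measure)\<bar> \<le> C * (p N)\<^sup>2 * S N" .
    have "(\<integral>z. K N z * h z \<partial>sphere_measure) = (\<integral>y. Kker wt (2 * T N) x y * h y \<partial>sphere_measure)"
      unfolding K_def by (rule integral_Kodd_eq_Kker[OF dim x h_m h_bd h_odd])
    moreover have "\<bar>h x - (\<integral>y. Kker wt (2 * T N) x y * h y \<partial>sphere_measure)\<bar> \<le> C3 * real (2 * T N) powr (- \<tau>)"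
      using C3(2)[OF _ x, of "2 * T N"] T1[of N] by (simp add: h_def)
    moreover have "real (2 * T N) powr (- \<tau>) \<le> real (T N) powr (- \<tau>)"
      using T1[of N] tau_pos by (intro powr_mono2') auto
    then have "C3 * real (2 * T N) powr (- \<tau>) \<le> C3 * real (T N) powr (- \<tau>)"
      using C3(1) by (intro mult_left_mono) auto
    moreover have "h x = R x - 1 / 2" using h_r[OF x] Rr[OF x] by simp
    ultimately show ?thesis using 1 by linarith
  qed
  have abs_moment: "expectation (\<lambda>\<omega>. \<bar>g N (Y \<omega>, X \<omega>)\<bar>) \<le> B1" if N: "N \<ge> 3" for N
  proof -
    have "expectation (\<lambda>\<omega>. \<bar>g N (Y \<omega>, X \<omega>)\<bar>) = (\<integral>z. fX z * \<bar>\<phi> N z\<bar> \<partial>sphere_measure)"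
      unfolding abs_g by (rule distributed_integral[OF X_distr, symmetric]) (use fX_nonneg in auto)
    also have "\<dots> \<le> (\<integral>z. \<bar>K N z\<bar> \<partial>sphere_measure)"
      unfolding \<phi>_def by (rule D.trimmed_abs_moment_le[OF K_m K_bd trim(1)[OF N]])
    also note K_abs
    finally show ?thesis .
  qed
  have m_bd: "\<bar>m N\<bar> \<le> B1" if "N \<ge> 3" for N
    unfolding m_def by (rule order_trans[OF integral_abs_bound abs_moment[OF that]])
  define q where "q N = expectation (\<lambda>\<omega>. (g N (Y \<omega>, X \<omega>))\<^sup>2)" for N
  \<comment> \<open>The loss \<open>(dg N)\<^sup>2 * S N\<close> is of fourth order in
    \<open>p\<close>; it is written as \<open>(p N)\<^sup>2\<close> times the null sequence
    \<open>(p N)\<^sup>2 * S N\<close>.\<close>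
  have q_ge: "c / 2 * (p N)\<^sup>2 - C\<^sup>2 * (p N)\<^sup>2 * ((p N)\<^sup>2 * S N) \<le> B * q N" if N: "N \<ge> 3" for N
  proof -
    have "q N = expectation (\<lambda>\<omega>. (\<phi> N (X \<omega>))\<^sup>2)"
      unfolding q_def by (metis abs_g power2_abs)
    also have "\<dots> = (\<integral>z. fX z * (\<phi> N z)\<^sup>2 \<partial>sphere_measure)"
      by (rule distributed_integral[OF X_distr, symmetric]) (use fX_nonneg in auto)
    finally have "B * q N = B * (\<integral>z. fX z * (K N z / max (fX z) (trim N))\<^sup>2 \<partial>sphere_measure)"
      by (simp add: \<phi>_def)
    moreover have "(\<integral>z. (K N z)\<^sup>2 \<partial>sphere_measure) / 2 - (dg N)\<^sup>2 * S N
        \<le> B * (\<integral>z. fX z * (K N z / max (fX z) (trim N))\<^sup>2 \<partial>sphere_measure)"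
      unfolding S_def by (rule D.trimmed_second_moment_ge[OF K_m K_bd K_odd trim[OF N] B])
    moreover have "(dg N)\<^sup>2 * S N \<le> (C * (p N)\<^sup>2)\<^sup>2 * S N"
      using dg_le dg0 by (intro mult_right_mono power_mono) (auto simp: S_def)
    moreover have "(C * (p N)\<^sup>2)\<^sup>2 * S N = C\<^sup>2 * (p N)\<^sup>2 * ((p N)\<^sup>2 * S N)"
      by (simp add: power2_eq_square ac_simps)
    ultimately show ?thesis using K_sq[of N] by linarith
  qed
  have s_var: "s N = sqrt (variance (\<lambda>\<omega>. g N (Y \<omega>, X \<omega>)))" for N
    by (simp add: s_def s1_def g_def \<phi>_def K_def)
  have s0: "s N \<ge> 0" for N unfolding s_var using variance_positive by simp
  have s_eq: "s N = sqrt (q N - (m N)\<^sup>2)" if "N \<ge> 3" for N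
    unfolding s_var q_def m_def using variance_eq[OF g_int[OF that] g2_int[OF that]] by simp
  obtain c1 where c1: "c1 > 0" "\<forall>\<^sub>F N in sequentially. c1 * p N \<le> sqrt (q N - (m N)\<^sup>2)"
  proof (rule eventually_sd_ge[OF p_pos p_inf pS])
    show "\<forall>\<^sub>F N in sequentially. c / 2 * (p N)\<^sup>2 - C\<^sup>2 * (p N)\<^sup>2 * ((p N)\<^sup>2 * S N) \<le> B * q N"
      using eventually_ge_at_top[of 3] by eventually_elim (rule q_ge)
    show "\<forall>\<^sub>F N in sequentially. \<bar>m N\<bar> \<le> B1"
      using eventually_ge_at_top[of 3] by eventually_elim (rule m_bd)
  qed (use c B in auto)
  have s_ge: "\<forall>\<^sub>F N in sequentially. c1 * p N \<le> s N \<and> N \<ge> 3"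
    using c1(2) eventually_ge_at_top[of 3] by eventually_elim (simp add: s_eq)
  have s_pos: "s N > 0" if "c1 * p N \<le> s N" for N
    using that mult_pos_pos[OF c1(1) p_pos[of N]] by linarith

  \<comment> \<open>The sample\<close>
  let ?S = "borel \<Otimes>\<^sub>M (sphere_measure :: 'a measure)"
  define D where "D i \<omega> = (ys i \<omega>, xs i \<omega>)" for i \<omega>
  have indepD: "indep_vars (\<lambda>_. ?S) D UNIV" using data_indep by (simp add: D_def[abs_def])
  have D_m [measurable]: "D i \<in> M \<rightarrow>\<^sub>M ?S" for i using indepD unfolding indep_vars_def2 by simp
  have D_distr: "distr M ?S (D i) = distr M ?S (\<lambda>\<omega>. (Y \<omega>, X \<omega>))" for i
    using data_distr by (simp add: D_def[abs_def])
  have xs_m [measurable]: "xs i \<in> M \<rightarrow>\<^sub>M sphere_measure" for i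
    using measurable_compose[OF D_m measurable_snd, of i] by (simp add: D_def)
  have ys_m [measurable]: "ys i \<in> borel_measurable M" for i
    using measurable_compose[OF D_m measurable_fst, of i] by (simp add: D_def)
  have xs_sph: "norm (xs i \<omega>) = 1" if "\<omega> \<in> space M" for i \<omega>
    using measurable_space[OF xs_m that] by simp
  \<comment> \<open>\<open>fhat\<close> is evaluated at a random point, a member of the sample;
    therefore the joint measurability of \<open>F\<close> in data and point is needed.\<close>
  have fhat_m [measurable]: "(\<lambda>\<omega>. fhat N \<omega> (xs i \<omega>)) \<in> borel_measurable M" for N i
  proof -
    obtain F :: "(nat \<Rightarrow> real \<times> 'a) \<Rightarrow> 'a \<Rightarrow> real"
      where F: "(\<lambda>p. F (fst p) (snd p)) \<in> borel_measurable (PiM {..<N} (\<lambda>_. ?S) \<Otimes>\<^sub>M sphere_measure)"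
      and eq: "\<forall>\<omega>\<in>space M. \<forall>x\<in>sphere 0 1. fhat N \<omega> x = F (restrict (\<lambda>i. (ys i \<omega>, xs i \<omega>)) {..<N}) x"
      using fhat_est by blast
    have "(\<lambda>\<omega>. restrict (\<lambda>i. D i \<omega>) {..<N}) \<in> M \<rightarrow>\<^sub>M PiM {..<N} (\<lambda>_. ?S)"
      by (rule measurable_restrict) simp
    then have "(\<lambda>\<omega>. (restrict (\<lambda>i. D i \<omega>) {..<N}, xs i \<omega>)) \<in> M \<rightarrow>\<^sub>M PiM {..<N} (\<lambda>_. ?S) \<Otimes>\<^sub>M sphere_measure"
      by measurable
    from measurable_compose[OF this F]
    have "(\<lambda>\<omega>. F (restrict (\<lambda>i. D i \<omega>) {..<N}) (xs i \<omega>)) \<in> borel_measurable M" by simp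
    then show ?thesis
      by (rule measurable_cong[THEN iffD1, rotated]) (simp add: eq xs_sph D_def)
  qed
  have Kx_m [measurable]: "(\<lambda>\<omega>. K N (xs i \<omega>)) \<in> borel_measurable M" for N i
    by (rule measurable_compose[OF xs_m K_m])
  have fXx_m [measurable]: "(\<lambda>\<omega>. fX (xs i \<omega>)) \<in> borel_measurable M" for i
    by (rule measurable_compose[OF xs_m fX_m])
  have Rhat_eq: "Rhat N \<omega> x = 1 / 2 + (1 / real N) *
      (\<Sum>i<N. (2 * ys i \<omega> - 1) * K N (xs i \<omega>) / max (fhat N \<omega> (xs i \<omega>)) (trim N))" for N \<omega>
    by (simp add: Rhat_def K_def)
  have Rhat_m [measurable]: "(\<lambda>\<omega>. Rhat N \<omega> x) \<in> borel_measurable M" for N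
    unfolding Rhat_eq by measurable
  have MN_m [measurable]: "MN N \<in> borel_measurable M" for N
    unfolding MN_def by measurable

  \<comment> \<open>Central limit theorem with known density\<close>
  define A where "A N \<omega> = (\<Sum>i<N. (g N (D i \<omega>) - m N) / (sqrt (real N) * s N))" for N \<omega>
  define W where "W N \<omega> = real N powr (1 / 2) / s1 N x * (Rhat N \<omega> x - R x)" for N \<omega>
  have gD_m [measurable]: "(\<lambda>\<omega>. g N (D i \<omega>)) \<in> borel_measurable M" for N i
    by (rule measurable_compose[OF D_m g_m])
  have A_m [measurable]: "A N \<in> borel_measurable M" for N unfolding A_def[abs_def] by measurable
  have W_m [measurable]: "W N \<in> borel_measurable M" for N unfolding W_def[abs_def] by measurable
  have char_A: "(\<lambda>N. char (distr M borel (A N)) t) \<longlonglongrightarrow> complex_of_real (exp (- (t\<^sup>2) / 2))" for t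
    unfolding A_def[abs_def] m_def
  proof (rule triangular_clt_char[OF indepD YX_m D_distr g_m _ s_var])
    show "\<forall>\<^sub>F N in sequentially. AE \<omega> in M. \<bar>g N (Y \<omega>, X \<omega>)\<bar> \<le> dg N * L N"
      using eventually_ge_at_top[of 3] by eventually_elim (rule AE_I2, rule g_bd)
    show "\<forall>\<^sub>F N in sequentially. s N > 0" using s_ge by eventually_elim (use s_pos in blast)
    show "(\<lambda>N. dg N * L N / (sqrt (real N) * s N)) \<longlonglongrightarrow> 0"
    proof (rule Lim_null_comparison)
      show "(\<lambda>N. C / c1 * (p N * L N / sqrt (real N))) \<longlonglongrightarrow> 0" by (rule tendsto_mult_right_zero[OF rate_b])
      show "\<forall>\<^sub>F N in sequentially. norm (dg N * L N / (sqrt (real N) * s N)) \<le> C / c1 * (p N * L N / sqrt (real N))"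
        using s_ge
      proof eventually_elim
        case (elim N)
        have N: "N \<ge> 3" "real N > 0" using elim by auto
        \<comment> \<open>The numerator is at most of order \<open>p\<^sup>2 * L\<close>, the
          denominator at least of order \<open>sqrt N * p\<close>; the null sequence from (b)
          remains.\<close>
        have "dg N * L N / (sqrt (real N) * s N) \<le> C * (p N)\<^sup>2 * L N / (sqrt (real N) * (c1 * p N))"
          using elim dg_le[of N] dg0[of N] L_ge[OF N(1)] N p_pos[of N] c1 C(1)
          by (intro frac_le mult_mono mult_pos_pos mult_right_mono mult_left_mono) auto
        also have "\<dots> = C / c1 * (p N * L N / sqrt (real N))"
          using p_pos[of N] by (simp add: power2_eq_square)
        finally show ?case using dg0[of N] L_ge[OF N(1)] s0[of N] by (simp add: abs_of_nonneg)
      qed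
    qed
  qed

  \<comment> \<open>The error of the estimated density\<close>
  define V where "V N \<omega> = p N / (s N * L N) * ((1 / real N) * (\<Sum>i<N. \<bar>g N (D i \<omega>)\<bar>))" for N \<omega>
  \<comment> \<open>\<open>Q\<close> is the quantity of condition (a). \<open>V\<close> contains the
    inverse of its normalization, so that \<open>Q * V\<close> is \<open>sqrt N / s\<close> times
    \<open>MN\<close> times the average of \<open>\<bar>g\<bar>\<close>;
    \<open>s \<ge> c1 * p\<close> and \<open>L \<ge> 1\<close> keep the mean of \<open>V\<close>
    bounded.\<close>
  define Q where "Q N \<omega> = real N powr (1 / 2) * real (T N) powr (- (real ?d - 1) / 2) * ln (real N) powr rt * MN N \<omega>" for N \<omega>
  have Q_m [measurable]: "Q N \<in> borel_measurable M" for N unfolding Q_def[abs_def] by measurable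
  have gD_int: "integrable M (\<lambda>\<omega>. \<bar>g N (D i \<omega>)\<bar>)" "expectation (\<lambda>\<omega>. \<bar>g N (D i \<omega>)\<bar>) \<le> B1" if "N \<ge> 3" for N i
  proof -
    have am: "(\<lambda>v. \<bar>g N v\<bar>) \<in> borel_measurable ?S" by measurable
    show "integrable M (\<lambda>\<omega>. \<bar>g N (D i \<omega>)\<bar>)"
      using integrable_distr_eq[OF D_m am, of i] integrable_distr_eq[OF YX_m am] g_int[OF that] D_distr[of i] by simp
    show "expectation (\<lambda>\<omega>. \<bar>g N (D i \<omega>)\<bar>) \<le> B1"
      using integral_distr[OF D_m am, of i] integral_distr[OF YX_m am] abs_moment[OF that] D_distr[of i] by simp
  qed
  have V_int: "integrable M (V N)" if "N \<ge> 3" for N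
    unfolding V_def[abs_def] using gD_int(1)[OF that] by (intro integrable_mult_right Bochner_Integration.integrable_sum)
  have V_m [measurable]: "V N \<in> borel_measurable M" for N unfolding V_def[abs_def] by measurable
  have op_QV: "o_p1 M (\<lambda>N \<omega>. Q N \<omega> * V N \<omega>)"
  proof (rule o_p1_mult_bounded[OF Q_m P])
    show "o_p1 M Q" using cond_a by (simp add: Q_def[abs_def])
    show "\<forall>\<^sub>F N in sequentially. integrable M (V N)"
      using eventually_ge_at_top[of 3] by eventually_elim (rule V_int)
    show "V N \<omega> \<ge> 0" for N \<omega> unfolding V_def using p_pos[of N] s0[of N]
      by (intro mult_nonneg_nonneg divide_nonneg_nonneg sum_nonneg) (auto simp: L_def)
    show "\<forall>\<^sub>F N in sequentially. expectation (V N) \<le> 1 / c1 * B1"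
      using s_ge
    proof eventually_elim
      case (elim N)
      then have N: "N \<ge> 3" by simp
      have "expectation (V N) = p N / (s N * L N) * ((1 / real N) * (\<Sum>i<N. expectation (\<lambda>\<omega>. \<bar>g N (D i \<omega>)\<bar>)))"
        unfolding V_def[abs_def] using gD_int(1)[OF N] by simp
      also have "\<dots> \<le> 1 / c1 * B1"
      proof (rule mult_mono)
        have "c1 * p N * 1 \<le> s N * L N" using elim L_ge[OF N] s0[of N] c1(1) p_pos[of N] by (intro mult_mono) auto
        then have "p N / (s N * L N) \<le> p N / (c1 * p N)"
          using p_pos[of N] c1(1) by (intro divide_left_mono) (auto intro!: mult_pos_pos s_pos elim[THEN conjunct1] order_less_le_trans[OF zero_less_one L_ge[OF N]])
        then show "p N / (s N * L N) \<le> 1 / c1" using p_pos[of N] by simp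
        have "(\<Sum>i<N. expectation (\<lambda>\<omega>. \<bar>g N (D i \<omega>)\<bar>)) \<le> (\<Sum>i<N. B1)" by (intro sum_mono gD_int(2)[OF N])
        then show "1 / real N * (\<Sum>i<N. expectation (\<lambda>\<omega>. \<bar>g N (D i \<omega>)\<bar>)) \<le> B1"
          using N by (simp add: divide_le_eq mult.commute)
      qed (use c1 in \<open>auto intro!: divide_nonneg_nonneg sum_nonneg\<close>)
      finally show ?case .
    qed
  qed

  \<comment> \<open>Bias and total remainder\<close>
  define b where "b N = C / c1 * (sqrt (real N) * p N * S N) + C3 / c1 * (sqrt (real N) * (real (T N) powr (- \<tau>) / p N))" for N
  have b_lim: "b \<longlonglongrightarrow> 0"
    unfolding b_def[abs_def]
    using tendsto_add[OF tendsto_mult_right_zero[OF rate_d, of "C / c1"] tendsto_mult_right_zero[OF rate_c, of "C3 / c1"]] by simp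
  have op_rem: "o_p1 M (\<lambda>N \<omega>. W N \<omega> - A N \<omega>)"
  proof (rule o_p1_add[OF _ _ P op_QV b_lim])
    show "\<forall>\<^sub>F N in sequentially. \<forall>\<omega>\<in>space M. \<bar>W N \<omega> - A N \<omega>\<bar> \<le> \<bar>Q N \<omega> * V N \<omega>\<bar> + b N"
      using s_ge
    proof eventually_elim
      case (elim N)
      then have N: "N \<ge> 3" "real N > 0" and sp: "s N > 0" using s_pos by auto
      have r0: "sqrt (real N) / s N \<ge> 0" using sp by simp
      show ?case
      proof
        fix \<omega> assume \<omega>: "\<omega> \<in> space M"
        define gh where "gh i = (2 * ys i \<omega> - 1) * K N (xs i \<omega>) / max (fhat N \<omega> (xs i \<omega>)) (trim N)" for i
        have A_eq: "A N \<omega> = sqrt (real N) / s N * ((1 / real N) * (\<Sum>i<N. g N (D i \<omega>)) - m N)"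
        proof -
          have "A N \<omega> = ((\<Sum>i<N. g N (D i \<omega>)) - real N * m N) / (sqrt (real N) * s N)"
            unfolding A_def sum_divide_distrib[symmetric] by (simp add: sum_subtractf)
          also have "\<dots> = sqrt (real N) * ((\<Sum>i<N. g N (D i \<omega>)) - real N * m N) / (real N * s N)"
            using N sp by (simp add: field_simps)
          also have "\<dots> = sqrt (real N) / s N * ((1 / real N) * (\<Sum>i<N. g N (D i \<omega>)) - m N)"
            using N sp by (simp add: field_simps)
          finally show ?thesis .
        qed
        \<comment> \<open>Adding and subtracting the mean \<open>m N\<close> separates the exchange
          of densities, summand by summand, from the deterministic bias.\<close>
        have "W N \<omega> - A N \<omega> = sqrt (real N) / s N * ((1 / real N) * (\<Sum>i<N. gh i - g N (D i \<omega>)))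
            + sqrt (real N) / s N * (m N + 1 / 2 - R x)"
          unfolding A_eq W_def Rhat_eq sq s_def[symmetric] gh_def[symmetric]
          by (simp add: sum_subtractf algebra_simps diff_divide_distrib)
        then have "\<bar>W N \<omega> - A N \<omega>\<bar> \<le> sqrt (real N) / s N * ((1 / real N) * \<bar>\<Sum>i<N. gh i - g N (D i \<omega>)\<bar>)
            + sqrt (real N) / s N * \<bar>m N + 1 / 2 - R x\<bar>"
          using abs_triangle_ineq[of "sqrt (real N) / s N * ((1 / real N) * (\<Sum>i<N. gh i - g N (D i \<omega>)))"
              "sqrt (real N) / s N * (m N + 1 / 2 - R x)"] sp by (simp add: abs_mult)
        moreover have "sqrt (real N) / s N * ((1 / real N) * \<bar>\<Sum>i<N. gh i - g N (D i \<omega>)\<bar>)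
            \<le> Q N \<omega> * V N \<omega>"
        proof -
          have "\<bar>gh i - g N (D i \<omega>)\<bar> \<le> MN N \<omega> * \<bar>g N (D i \<omega>)\<bar>" if i: "i < N" for i
          proof -
            let ?f = "max (fX (xs i \<omega>)) (trim N)" and ?fh = "max (fhat N \<omega> (xs i \<omega>)) (trim N)"
            have pos: "?f > 0" "?fh > 0" using trim(1)[OF N(1)] by auto
            \<comment> \<open>The error is multiplicative in the summand, which lets the maximum
              \<open>MN\<close> come out of the sum.\<close>
            have eq: "gh i - g N (D i \<omega>) = g N (D i \<omega>) * (?f / ?fh - 1)"
              using pos by (simp add: gh_def g_def \<phi>_def D_def field_simps)
            have le: "\<bar>?f / ?fh - 1\<bar> \<le> MN N \<omega>"
              unfolding MN_def by (rule Max_ge) (use i in auto)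
            show ?thesis unfolding eq abs_mult mult.commute[of "MN N \<omega>"]
              by (rule mult_left_mono[OF le]) simp
          qed
          then have "\<bar>\<Sum>i<N. gh i - g N (D i \<omega>)\<bar> \<le> (\<Sum>i<N. MN N \<omega> * \<bar>g N (D i \<omega>)\<bar>)"
            by (intro order_trans[OF sum_abs] sum_mono) auto
          then have "sqrt (real N) / s N * ((1 / real N) * \<bar>\<Sum>i<N. gh i - g N (D i \<omega>)\<bar>)
              \<le> sqrt (real N) / s N * ((1 / real N) * (\<Sum>i<N. MN N \<omega> * \<bar>g N (D i \<omega>)\<bar>))"
            by (intro mult_left_mono r0) auto
          also have "\<dots> = Q N \<omega> * V N \<omega>"
          proof -
            have Lp: "L N > 0" using L_ge[OF N(1)] by simp
            have "real (T N) powr (- (real ?d - 1) / 2) = 1 / p N"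
              unfolding p_def minus_divide_left[symmetric] powr_minus_divide by simp
            then have Q_eq: "Q N \<omega> = sqrt (real N) / p N * L N * MN N \<omega>"
              unfolding Q_def sq L_def by simp
            show ?thesis
              unfolding Q_eq V_def sum_distrib_left[symmetric] using Lp p_pos[of N] by (simp add: field_simps)
          qed
          finally show ?thesis .
        qed
        moreover have "sqrt (real N) / s N * \<bar>m N + 1 / 2 - R x\<bar> \<le> b N"
        proof -
          have "sqrt (real N) / s N * \<bar>m N + 1 / 2 - R x\<bar>
              \<le> sqrt (real N) / (c1 * p N) * (C * (p N)\<^sup>2 * S N + C3 * real (T N) powr (- \<tau>))"
            using elim bias[OF N(1)] c1(1) p_pos[of N]
            by (intro mult_mono divide_left_mono mult_pos_pos) (auto intro: sp)
          also have "\<dots> = b N"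
            unfolding b_def using p_pos[of N] c1(1) by (simp add: field_simps power2_eq_square)
          finally show ?thesis .
        qed
        ultimately show "\<bar>W N \<omega> - A N \<omega>\<bar> \<le> \<bar>Q N \<omega> * V N \<omega>\<bar> + b N" by linarith
      qed
    qed
  qed measurable

  \<comment> \<open>From characteristic functions to weak convergence\<close>
  have char_W: "(\<lambda>N. char (distr M borel (W N)) t) \<longlonglongrightarrow> complex_of_real (exp (- (t\<^sup>2) / 2))" for t
    using slutsky_char[OF A_m _ char_A op_rem, of t] by simp
  have "weak_conv_m (\<lambda>N. distr M borel (W N)) std_normal_distribution"
  proof (rule levy_continuity)
    show "real_distribution (distr M borel (W N))" for N by (rule real_distribution_distr) simp
  qed (use char_W real_dist_normal_dist in \<open>auto simp: char_std_normal_distribution\<close>)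
  then show "weak_conv_m (\<lambda>N. distr M borel (\<lambda>\<omega>. real N powr (1 / 2) / s1 N x * (Rhat N \<omega> x - R x))) std_normal_distribution"
    by (simp add: W_def[abs_def])
qed

end
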